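(* Consider the ensemble $\mathcal{E}$ of matchgate random circuits on $n$ qubits in a one-dimensional two-layer superblock construction with block size $2\xi$, with independent uniformly random matchgate unitaries inside the blocks (and thus total depth $4\xi$). If this ensemble anti-concentrates, that is, if $$2^{2n}\,\mathbb{E}_{U\sim\mathcal{E}}|\langle0^n|U|0^n\rangle|^4\le(1+\epsilon)\,2^{2n}\int_{\mathrm{O}(2n)}dO\,|\langle0^n|U(O)|0^n\rangle|^4$$ for some constant $\epsilon$ (independent of $n$), then $\xi=\Omega(n^{1/3}/\log(n))$.
   Context: Majorana operators on $n$ qubits (Jordan–Wigner): $\gamma_{2i-1}=Z_1\cdots Z_{i-1}X_i$, $\gamma_{2i}=Z_1\cdots Z_{i-1}Y_i$, $i=1,\dots,n$. The matchgate group on $n$ qubits (in a line) is generated by the two-qubit unitaries $e^{i\theta P_jQ_{j+1}}$ with $P,Q\in\{X,Y\}$, $\theta\in\mathbb{R}$, together with single-qubit $X$ gates. Up to phases, its elements are the unitaries $U(O)$, $O\in\mathrm{O}(2n)$, with $U(O)\gamma_iU(O)^\dagger=\sum_{j=1}^{2n}O_{ij}\gamma_j$. A uniformly random matchgate unitary is $U(O)$ with $O$ Haar-random in $\mathrm{O}(2n)$, and $dO$ is the normalized Haar measure. Two-layer superblock construction: $n$ qubits on a line with periodic boundary conditions are divided into $m=n/\xi$ consecutive patches of $\xi$ qubits, $m$ even. In the first layer, independent random unitaries are applied to the pairs of patches $(1,2),(3,4),\dots,(m-1,m)$; in the second layer, to the pairs $(2,3),(4,5),\dots,(m,1)$. Here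 each of these unitaries is a uniformly random matchgate unitary on the $2\xi$ qubits of its block, in their (cyclic) line order, i.e. $U(O)$ with $O$ Haar-random in $\mathrm{O}(4\xi)$ and Majorana operators defined on the block's own qubits. *)

theory Defs
  imports
    "HOL-Probability.Probability"
    "HOL-Library.Landau_Symbols"
    "Jordan_Normal_Form.Schur_Decomposition"
begin

text \<open>
  Operators on \<open>n\<close> qubits are complex \<open>2^n \<times> 2^n\<close> matrices.  Qubits are numbered from \<open>0\<close>, and the
  row or column index \<open>x < 2^n\<close> stands for the computational basis state whose qubit \<open>j\<close> has the
  value \<open>bit x j\<close>; so index \<open>0\<close> is the all-zero state.
\<close>

text \<open>
  The operator on \<open>n\<close> qubits that acts as \<open>A\<close> on the qubits listed in \<open>qs\<close> (the \<open>k\<close>-th qubit of \<open>A\<close>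
  being the qubit \<open>qs ! k\<close>) and as the identity on all other qubits.
\<close>

definition subindex :: "nat list \<Rightarrow> nat \<Rightarrow> nat" where
  "subindex qs x = horner_sum of_bool 2 (map (bit x) qs)"

definition act_on :: "nat \<Rightarrow> nat list \<Rightarrow> complex mat \<Rightarrow> complex mat" where
  "act_on n qs A = Matrix.mat (2 ^ n) (2 ^ n)
     (\<lambda>(x, y). if \<forall>j<n. j \<notin> set qs \<longrightarrow> bit x j = bit y j
               then A $$ (subindex qs x, subindex qs y) else 0)"

definition pauli_X :: "complex mat" where
  "pauli_X = mat_of_rows_list 2 [[0, 1], [1, 0]]"

definition pauli_Y :: "complex mat" where
  "pauli_Y = mat_of_rows_list 2 [[0, - \<i>], [\<i>, 0]]"

definition pauli_Z :: "complex mat" where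
  "pauli_Z = mat_of_rows_list 2 [[1, 0], [0, - 1]]"

text \<open>
  Jordan--Wigner Majorana operators, numbered from \<open>0\<close>: for \<open>i < n\<close>, \<open>majorana n (2 * i)\<close> is
  \<open>Z\<^sub>0 \<cdots> Z\<^sub>i\<^sub>-\<^sub>1 X\<^sub>i\<close> and \<open>majorana n (2 * i + 1)\<close> is \<open>Z\<^sub>0 \<cdots> Z\<^sub>i\<^sub>-\<^sub>1 Y\<^sub>i\<close>.
\<close>

definition majorana :: "nat \<Rightarrow> nat \<Rightarrow> complex mat" where
  "majorana n k = foldr (*) (map (\<lambda>j. act_on n [j] pauli_Z) [0..<k div 2])
     (act_on n [k div 2] (if even k then pauli_X else pauli_Y))"

definition orth_group :: "nat \<Rightarrow> real mat set" where
  "orth_group N = {R \<in> carrier_mat N N. R * transpose_mat R = 1\<^sub>m N}"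

definition is_matchgate_unitary :: "nat \<Rightarrow> real mat \<Rightarrow> complex mat \<Rightarrow> bool" where
  "is_matchgate_unitary n R U \<longleftrightarrow>
     U \<in> carrier_mat (2 ^ n) (2 ^ n) \<and>
     U * mat_adjoint U = 1\<^sub>m (2 ^ n) \<and>
     (\<forall>i<2 * n. U * majorana n i * mat_adjoint U =
        Matrix.mat (2 ^ n) (2 ^ n)
          (\<lambda>(x, y). \<Sum>j<2 * n. complex_of_real (R $$ (i, j)) * majorana n j $$ (x, y)))"

text \<open>
  For orthogonal \<open>R\<close> the defining relations determine the unitary up to a global phase, which is
  chosen arbitrarily here; absolute values of matrix elements of circuits built from such unitaries
  do not depend on the choice.
\<close>

definition matchgate_unitary :: "nat \<Rightarrow> real mat \<Rightarrow> complex mat" where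
  "matchgate_unitary n R = (SOME U. is_matchgate_unitary n R U)"

text \<open>
  The Borel \<open>\<sigma>\<close>-algebra of the orthogonal group, as a subspace of the space of real
  \<open>N \<times> N\<close> matrices, is the one generated by the matrix entries.
\<close>

definition orth_borel :: "nat \<Rightarrow> real mat measure" where
  "orth_borel N = vimage_algebra (orth_group N)
     (\<lambda>R. \<lambda>p\<in>{..<N} \<times> {..<N}. R $$ p) (PiM ({..<N} \<times> {..<N}) (\<lambda>_. borel))"

definition is_normalized_haar :: "nat \<Rightarrow> real mat measure \<Rightarrow> bool" where
  "is_normalized_haar N \<mu> \<longleftrightarrow>
     prob_space \<mu> \<and> space \<mu> = orth_group N \<and> sets \<mu> = sets (orth_borel N) \<and>
     (\<forall>A\<in>orth_group N. distr \<mu> \<mu> (\<lambda>R. A * R) = \<mu>)"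

text \<open>
  Layers are numbered \<open>l \<in> {0, 1}\<close> and the \<open>n / \<xi>\<close> patches from \<open>0\<close>; block \<open>b\<close> of layer \<open>l\<close>
  consists of the patches \<open>2 * b + l\<close> and \<open>2 * b + l + 1\<close>, modulo the number of patches.  The
  qubits of a block are listed in their cyclic order on the line.
\<close>

definition block_qubits :: "nat \<Rightarrow> nat \<Rightarrow> nat \<Rightarrow> nat \<Rightarrow> nat list" where
  "block_qubits n \<xi> l b = map (\<lambda>k. k mod n) [(2 * b + l) * \<xi>..<(2 * b + l + 2) * \<xi>]"

text \<open>The matrices \<open>\<omega> (l, b)\<close> are the parameters of the block unitaries.\<close>

definition superblock_layer ::
    "nat \<Rightarrow> nat \<Rightarrow> (nat \<times> nat \<Rightarrow> real mat) \<Rightarrow> nat \<Rightarrow> complex mat" where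
  "superblock_layer n \<xi> \<omega> l =
     foldr (*) (map (\<lambda>b. act_on n (block_qubits n \<xi> l b) (matchgate_unitary (2 * \<xi>) (\<omega> (l, b))))
       [0..<(n div \<xi>) div 2]) (1\<^sub>m (2 ^ n))"

definition superblock_circuit ::
    "nat \<Rightarrow> nat \<Rightarrow> (nat \<times> nat \<Rightarrow> real mat) \<Rightarrow> complex mat" where
  "superblock_circuit n \<xi> \<omega> = superblock_layer n \<xi> \<omega> 1 * superblock_layer n \<xi> \<omega> 0"

definition superblock_ensemble ::
    "(nat \<Rightarrow> real mat measure) \<Rightarrow> nat \<Rightarrow> nat \<Rightarrow> (nat \<times> nat \<Rightarrow> real mat) measure" where
  "superblock_ensemble haar n \<xi> = PiM ({0, 1} \<times> {..<(n div \<xi>) div 2}) (\<lambda>_. haar (4 * \<xi>))"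

end

theory Submission
  imports Defs "HOL-Number_Theory.Cong"
begin

unbundle bit_operations_syntax

text \<open>
  Expand everything in ordered monomials \<open>\<gamma>\<^sub>I\<close> of Majorana operators.  For a Haar-random \<open>U\<close>,
  invariance under row sign changes makes the coefficients \<open>tr (Y U \<gamma>\<^sub>I U\<^sup>*)\<close> uncorrelated, invariance under
  row permutations makes their second moments depend on the degree \<open>\<bar>I\<bar>\<close> only, and conjugation by \<open>U\<close>
  preserves the weight of each degree; so these second moments are the weight of \<open>Y\<close> in degree \<open>\<bar>I\<bar>\<close>,
  divided by \<open>2n choose \<bar>I\<bar>\<close>.  This gives
  \<open>4\<^sup>n \<integral> \<bar>\<langle>0|U|0\<rangle>\<bar>\<^sup>4 = (\<Sum>k. (n choose k)\<^sup>2 / (2n choose 2k)) \<le> n + 1\<close>.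

  For the circuit, the second layer is invariant under multiplication by Pauli strings from the right.
  Averaging over them turns the fourth moment into a sum of squares over characters, of which only those
  supported on one marked qubit per block are kept.  They factorize over the blocks, and each marked
  qubit contributes a factor at least \<open>1 / (4 \<xi> - 1)\<close> from each layer; summing over the sets of marked
  qubits gives the lower bound \<open>(1 + (4 \<xi> - 1)\<^sup>-\<^sup>2) ^ (n / (2 \<xi>))\<close>.  Comparing both bounds yields
  \<open>n \<le> C \<xi>\<^sup>3 ln n\<close>.
\<close>

subsection \<open>Bits and characters\<close>

text \<open>The unitaries are picked by \<open>SOME\<close>: nothing is known about them before
  existence is proved, and an amplitude need not be a measurable function of the parameter. Averages
  therefore go through conjugations \<open>U * Y * adj U\<close>, in which the arbitrary phase
  cancels and whose entries are polynomials in the entries of the orthogonal matrix. With the given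
  convention parameters multiply in reverse: up to phase, the unitary of \<open>D * R\<close> is
  that of \<open>R\<close> times that of \<open>D\<close>. Left invariance of the Haar measure thus
  acts by right multiplication, and since the second layer is the left factor of the circuit, it
  absorbs Pauli strings inserted between the layers. The marked qubits lie where a block of the
  first layer overlaps one of the second, so that a character on them puts at most one
  \<open>Z\<close> on every block of both layers. The factor \<open>1 / (4 \<xi> - 1)\<close> is the
  share of diagonal monomials among the quadratic ones on a block: \<open>2 \<xi>\<close> out of
  \<open>2 \<xi> (4 \<xi> - 1)\<close>. The cube of \<open>\<xi>\<close> collects one such factor
  per layer and the number \<open>n / (2 \<xi>)\<close> of blocks.\<close>

lemma nat_eq_iff_bits:
  fixes x y :: nat
  assumes "x < 2 ^ n" "y < 2 ^ n"
  shows "x = y \<longleftrightarrow> (\<forall>q<n. bit x q = bit y q)"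
proof -
  have "take_bit n x = x" "take_bit n y = y"
    using assms by (simp_all add: take_bit_nat_eq_self_iff)
  then show ?thesis
    by (metis bit_eq_iff bit_take_bit_iff)
qed

lemma xor_less_power:
  fixes x y :: nat
  assumes "x < 2 ^ n" "y < 2 ^ n"
  shows "x XOR y < 2 ^ n"
proof -
  have "take_bit n (x XOR y) = x XOR y"
    using assms by (simp add: take_bit_xor take_bit_nat_eq_self)
  then show ?thesis by (simp only: take_bit_nat_eq_self_iff)
qed

lemma xor_xor_cancel [simp]: "((x::nat) XOR a) XOR a = x"
  by (simp add: xor.assoc)

lemma bij_betw_xor:
  assumes "(a::nat) < 2 ^ n"
  shows "bij_betw (\<lambda>x. x XOR a) {..<2 ^ n} {..<2 ^ n}"
  by (rule bij_betw_byWitness[where f' = "\<lambda>x. x XOR a"]) (use assms xor_less_power in auto)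

text \<open>The Walsh character of the bit strings under \<open>XOR\<close>, which is also the
  eigenvalue of the \<open>Z\<close> string on \<open>C\<close> at the basis state
  \<open>x\<close>.\<close>

definition chi :: "nat set \<Rightarrow> nat \<Rightarrow> real" where
  "chi C x = (\<Prod>q\<in>C. if bit x q then - 1 else 1)"

lemma chi_empty [simp]: "chi {} x = 1"
  by (simp add: chi_def)

lemma chi_zero [simp]: "chi C 0 = 1"
  by (simp add: chi_def)

lemma chi_xor: "chi C (x XOR y) = chi C x * chi C y"
  unfolding chi_def prod.distrib[symmetric] by (rule prod.cong) (auto simp: bit_xor_iff)

lemma chi_square [simp]: "chi C x * chi C x = 1"
  unfolding chi_def prod.distrib[symmetric] by (rule prod.neutral) auto

lemma chi_cases: "chi C x = 1 \<or> chi C x = - 1"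
  using chi_square[of C x] square_eq_1_iff by blast

lemma chi_symdiff:
  assumes "finite C" "finite D"
  shows "chi (sym_diff C D) x = chi C x * chi D x"
proof -
  let ?s = "\<lambda>q. if bit x q then - 1 else 1 :: real"
  have 1: "chi C x = prod ?s (C - D) * prod ?s (C \<inter> D)"
    unfolding chi_def using assms
    by (metis Int_Diff_Un Int_Diff_disjoint finite_Diff finite_Int mult.commute prod.union_disjoint)
  have 2: "chi D x = prod ?s (D - C) * prod ?s (C \<inter> D)"
    unfolding chi_def using assms
    by (metis Int_Diff_Un Int_Diff_disjoint Int_commute finite_Diff finite_Int mult.commute prod.union_disjoint)
  have 3: "prod ?s (C \<inter> D) * prod ?s (C \<inter> D) = 1"
    unfolding prod.distrib[symmetric] by (rule prod.neutral) auto
  have "chi (sym_diff C D) x = prod ?s (C - D) * prod ?s (D - C)"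
    unfolding chi_def using assms by (intro prod.union_disjoint) auto
  also have "\<dots> = chi C x * chi D x"
    unfolding 1 2 using 3 by (simp add: algebra_simps)
  finally show ?thesis .
qed

lemma chi_power: "finite C \<Longrightarrow> chi C (2 ^ q) = (if q \<in> C then - 1 else 1)"
  unfolding chi_def by (simp add: bit_exp_iff prod.delta)

text \<open>The sum over subsets is an expanded product of factors sign plus one, and a single set
  bit makes a factor vanish.\<close>

lemma sum_chi: "(\<Sum>C\<in>Pow {..<n}. chi C x) = (if \<forall>q<n. \<not> bit x q then 2 ^ n else 0)"
proof -
  have "(\<Sum>C\<in>Pow {..<n}. chi C x) = (\<Prod>q<n. (if bit x q then - 1 else 1) + 1)"
    unfolding chi_def by (subst prod_add) auto
  also have "\<dots> = (if \<forall>q<n. \<not> bit x q then 2 ^ n else 0)"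
    by (auto simp: prod_zero_iff)
  finally show ?thesis .
qed

lemma sum_chi_mult:
  assumes "x < 2 ^ n" "y < 2 ^ n"
  shows "(\<Sum>C\<in>Pow {..<n}. chi C x * chi C y) = (if x = y then 2 ^ n else 0)"
  unfolding chi_xor[symmetric] sum_chi using nat_eq_iff_bits[OF assms]
  by (auto simp: bit_xor_iff)

subsection \<open>Square matrices\<close>

abbreviation ops :: "nat \<Rightarrow> complex mat set" where
  "ops n \<equiv> carrier_mat (2 ^ n) (2 ^ n)"

lemma mult_entry:
  assumes "A \<in> carrier_mat d e" "B \<in> carrier_mat e f" "i < d" "j < f"
  shows "(A * B) $$ (i, j) = (\<Sum>k<e. A $$ (i, k) * B $$ (k, j))"
  using assms by (simp add: scalar_prod_def atLeast0LessThan)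

declare index_mult_mat(1) [simp del]

lemma mult_carrier_sq [simp]:
  "A \<in> carrier_mat d d \<Longrightarrow> B \<in> carrier_mat d d \<Longrightarrow> A * B \<in> carrier_mat d d"
  by (rule mult_carrier_mat)

lemmas sq_ring = assoc_mult_mat[of _ d d _ d _ d] mult_smult_distrib[of _ d d _ d]
  mult_smult_assoc_mat[of _ d d _ d] mult_carrier_sq[of _ d] for d

lemma smult_entry:
  "A \<in> carrier_mat d e \<Longrightarrow> x < d \<Longrightarrow> y < e \<Longrightarrow> (c \<cdot>\<^sub>m A) $$ (x, y) = c * A $$ (x, y)"
  by auto

abbreviation adj :: "complex mat \<Rightarrow> complex mat" where
  "adj \<equiv> mat_adjoint"

lemma adjoint_carrier [simp]: "(A :: complex mat) \<in> carrier_mat d d \<Longrightarrow> adj A \<in> carrier_mat d d"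
  by (auto simp: mat_adjoint_def)

lemma adjoint_dim [simp]:
  "dim_row (adj (A :: complex mat)) = dim_col A" "dim_col (adj A) = dim_row A"
  by (simp_all add: mat_adjoint_def)

lemma adjoint_entry [simp]:
  fixes A :: "complex mat"
  assumes "A \<in> carrier_mat d d" "i < d" "j < d"
  shows "adj A $$ (i, j) = cnj (A $$ (j, i))"
  using assms by (simp add: mat_adjoint_def mat_of_rows_def)

lemma eq_matI':
  assumes "A \<in> carrier_mat d d" "B \<in> carrier_mat d d"
    "\<And>i j. i < d \<Longrightarrow> j < d \<Longrightarrow> A $$ (i, j) = B $$ (i, j)"
  shows "A = B"
  using assms by (intro eq_matI) auto

lemma adjoint_mult:
  fixes A B :: "complex mat"
  assumes "A \<in> carrier_mat d d" "B \<in> carrier_mat d d"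
  shows "adj (A * B) = adj B * adj A"
proof (rule eq_matI')
  fix i j assume ij: "i < d" "j < d"
  have "adj (A * B) $$ (i, j) = cnj ((A * B) $$ (j, i))"
    using assms ij by (intro adjoint_entry[of _ d]) auto
  also have "\<dots> = (\<Sum>k<d. cnj (A $$ (j, k)) * cnj (B $$ (k, i)))"
    by (simp add: mult_entry[OF assms ij(2,1)])
  also have "\<dots> = (\<Sum>k<d. adj B $$ (i, k) * adj A $$ (k, j))"
    using assms ij by (intro sum.cong) (auto simp: adjoint_entry[of _ d])
  also have "\<dots> = (adj B * adj A) $$ (i, j)"
    using assms ij by (intro mult_entry[symmetric, of _ d d]) auto
  finally show "adj (A * B) $$ (i, j) = (adj B * adj A) $$ (i, j)" .
qed (use assms in auto)

lemma adjoint_adjoint [simp]: "A \<in> carrier_mat d d \<Longrightarrow> adj (adj A) = (A :: complex mat)"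
  by (rule eq_matI'[of _ d]) (auto simp: adjoint_entry[of _ d])

lemma adjoint_smult:
  "A \<in> carrier_mat d d \<Longrightarrow> adj (c \<cdot>\<^sub>m A) = cnj c \<cdot>\<^sub>m adj (A :: complex mat)"
  by (rule eq_matI'[of _ d]) (auto simp: adjoint_entry[of _ d] carrier_matD[of A d d])

lemma adjoint_one [simp]: "adj (1\<^sub>m d :: complex mat) = 1\<^sub>m d"
  by (rule eq_matI'[of _ d]) (auto simp: adjoint_entry[of _ d])

lemma mult_one_comm:
  fixes A B :: "'a :: field mat"
  assumes "A \<in> carrier_mat d d" "B \<in> carrier_mat d d" "A * B = 1\<^sub>m d"
  shows "B * A = 1\<^sub>m d"
  using mat_mult_left_right_inverse[OF assms] .

lemma mult_cancel_left:
  fixes A B X :: "complex mat"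
  assumes "A * B = 1\<^sub>m d" "A \<in> carrier_mat d d" "B \<in> carrier_mat d d" "X \<in> carrier_mat d d"
  shows "A * (B * X) = X"
  unfolding assoc_mult_mat[OF assms(2-4), symmetric] assms(1) using assms(4) by simp

lemma unitary_row:
  assumes "U \<in> carrier_mat d d" "U * adj U = 1\<^sub>m d" "x < d"
  shows "(\<Sum>y<d. (cmod (U $$ (x, y)))\<^sup>2) = 1"
proof -
  have "(U * adj U) $$ (x, x) = (\<Sum>y<d. U $$ (x, y) * adj U $$ (y, x))"
    using assms by (intro mult_entry) auto
  also have "\<dots> = complex_of_real (\<Sum>y<d. (cmod (U $$ (x, y)))\<^sup>2)"
    using assms by (simp add: adjoint_entry[of _ d] complex_norm_square del: adjoint_entry of_real_power)
  finally have "complex_of_real (\<Sum>y<d. (cmod (U $$ (x, y)))\<^sup>2) = complex_of_real 1"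
    using assms by simp
  then show ?thesis by (simp only: of_real_eq_iff)
qed

lemma unitary_col:
  assumes "U \<in> carrier_mat d d" "U * adj U = 1\<^sub>m d" "x < d"
  shows "(\<Sum>y<d. (cmod (U $$ (y, x)))\<^sup>2) = 1"
proof -
  have "adj U * adj (adj U) = 1\<^sub>m d"
    using mult_one_comm[OF assms(1) _ assms(2)] assms(1) by simp
  from unitary_row[OF _ this assms(3)] show ?thesis
    using assms by (simp add: adjoint_entry[of _ d])
qed

subsection \<open>Pauli strings\<close>

text \<open>
  \<open>pauli n a C\<close> is the product of the \<open>X\<close> on the qubits in the bit mask \<open>a\<close> and the \<open>Z\<close> on the qubits
  in the set \<open>C\<close>, the \<open>Z\<close> acting first.
\<close>

definition pauli :: "nat \<Rightarrow> nat \<Rightarrow> nat set \<Rightarrow> complex mat" where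
  "pauli n a C = Matrix.mat (2 ^ n) (2 ^ n)
     (\<lambda>(x, y). if x = y XOR a then complex_of_real (chi C y) else 0)"

lemma pauli_carrier [simp]: "pauli n a C \<in> ops n"
  by (simp add: pauli_def)

lemma pauli_dim [simp]: "dim_row (pauli n a C) = 2 ^ n" "dim_col (pauli n a C) = 2 ^ n"
  by (simp_all add: pauli_def)

lemma pauli_entry:
  "x < 2 ^ n \<Longrightarrow> y < 2 ^ n \<Longrightarrow>
    pauli n a C $$ (x, y) = (if x = y XOR a then complex_of_real (chi C y) else 0)"
  by (simp add: pauli_def)

lemma mult_pauli_entry:
  assumes "A \<in> ops n" "a < 2 ^ n" "x < 2 ^ n" "y < 2 ^ n"
  shows "(A * pauli n a C) $$ (x, y) = A $$ (x, y XOR a) * complex_of_real (chi C y)"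
proof -
  have "(A * pauli n a C) $$ (x, y) = (\<Sum>z<2 ^ n. A $$ (x, z) * pauli n a C $$ (z, y))"
    using assms by (intro mult_entry) auto
  also have "\<dots> = (\<Sum>z<2 ^ n. if z = y XOR a then A $$ (x, z) * complex_of_real (chi C y) else 0)"
    using assms by (intro sum.cong) (auto simp: pauli_entry)
  also have "\<dots> = A $$ (x, y XOR a) * complex_of_real (chi C y)"
    using assms by (simp add: xor_less_power)
  finally show ?thesis .
qed

lemma pauli_mult:
  assumes "a < 2 ^ n" "b < 2 ^ n" "finite C" "finite D"
  shows "pauli n a C * pauli n b D =
    complex_of_real (chi C b) \<cdot>\<^sub>m pauli n (a XOR b) (sym_diff C D)"
proof (rule eq_matI')
  fix x y :: nat assume xy: "x < 2 ^ n" "y < 2 ^ n"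
  have "y XOR b < 2 ^ n" using xy assms by (simp add: xor_less_power)
  then show "(pauli n a C * pauli n b D) $$ (x, y) =
      (complex_of_real (chi C b) \<cdot>\<^sub>m pauli n (a XOR b) (sym_diff C D)) $$ (x, y)"
    using assms xy
    by (subst mult_pauli_entry)
       (auto simp: pauli_entry chi_xor chi_symdiff xor.assoc xor.commute[of b a])
qed auto

lemma pauli_adjoint:
  assumes "a < 2 ^ n"
  shows "adj (pauli n a C) = complex_of_real (chi C a) \<cdot>\<^sub>m pauli n a C"
  using assms
  by (intro eq_matI'[of _ "2 ^ n"]) (auto simp: adjoint_entry[of _ "2^n"] pauli_entry chi_xor)

lemma pauli_one: "pauli n 0 {} = 1\<^sub>m (2 ^ n)"
  by (rule eq_matI'[of _ "2 ^ n"]) (auto simp: pauli_entry)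

lemma subindex_singleton: "subindex [q] x = of_bool (bit x q)"
  by (simp add: subindex_def)

lemma all_bits_except_iff:
  fixes x y :: nat
  assumes "x < 2 ^ n" "y < 2 ^ n" "q < n"
  shows "(\<forall>j<n. j \<notin> set [q] \<longrightarrow> bit x j = bit y j) \<longleftrightarrow>
    (if bit x q = bit y q then x = y else x = y XOR 2 ^ q)"
proof -
  have "y XOR 2 ^ q < 2 ^ n" using assms by (simp add: xor_less_power)
  then show ?thesis
    using nat_eq_iff_bits[OF assms(1,2)] nat_eq_iff_bits[OF assms(1), of "y XOR 2 ^ q"] assms(3)
    by (auto simp: bit_xor_iff bit_exp_iff)
qed

lemma xor_power_neq [simp]: "(y::nat) \<noteq> y XOR 2 ^ q" "y XOR 2 ^ q \<noteq> (y::nat)"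
  by (auto simp: bit_eq_iff bit_xor_iff bit_exp_iff)

lemma act_on_single:
  assumes "q < n" "A = Matrix.mat 2 2 f"
  shows "act_on n [q] A = Matrix.mat (2 ^ n) (2 ^ n) (\<lambda>(x, y).
    if x = y \<or> x = y XOR 2 ^ q then f (of_bool (bit x q), of_bool (bit y q)) else 0)"
proof (rule eq_matI'[of _ "2 ^ n"])
  fix x y :: nat assume xy: "x < 2 ^ n" "y < 2 ^ n"
  show "act_on n [q] A $$ (x, y) = Matrix.mat (2 ^ n) (2 ^ n) (\<lambda>(x, y).
    if x = y \<or> x = y XOR 2 ^ q then f (of_bool (bit x q), of_bool (bit y q)) else 0) $$ (x, y)"
    using xy all_bits_except_iff[OF xy assms(1)] assms
    by (auto simp: act_on_def subindex_singleton bit_xor_iff bit_exp_iff split: if_splits)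
qed (auto simp: act_on_def)

lemma pauli_mats:
  "pauli_X = Matrix.mat 2 2 (\<lambda>(i, j). if i = j then 0 else 1)"
  "pauli_Z = Matrix.mat 2 2 (\<lambda>(i, j). if i = j then (if i = 0 then 1 else - 1) else 0)"
  "pauli_Y = Matrix.mat 2 2 (\<lambda>(i, j). if i = j then 0 else if j = 0 then \<i> else - \<i>)"
  by (auto intro!: eq_matI simp: pauli_X_def pauli_Y_def pauli_Z_def mat_of_rows_list_def
      less_2_cases_iff numeral_2_eq_2 less_Suc_eq)

lemma act_on_pauli:
  assumes "q < n"
  shows "act_on n [q] pauli_X = pauli n (2 ^ q) {}"
    "act_on n [q] pauli_Z = pauli n 0 {q}"
    "act_on n [q] pauli_Y = \<i> \<cdot>\<^sub>m pauli n (2 ^ q) {q}"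
  unfolding act_on_single[OF assms pauli_mats(1)] act_on_single[OF assms pauli_mats(2)]
    act_on_single[OF assms pauli_mats(3)]
  by (auto intro!: eq_matI'[of _ "2 ^ n"] simp: pauli_entry chi_def bit_xor_iff bit_exp_iff)

text \<open>Since \<open>Y = \<i> X Z\<close>, an odd index adds a \<open>Z\<close> on its own qubit
  to the Jordan-Wigner string, hence the closed interval; \<open>maj_phase\<close> carries the
  factor \<open>\<i>\<close>.\<close>

definition maj_mask :: "nat \<Rightarrow> nat set" where
  "maj_mask k = (if even k then {..<k div 2} else {..k div 2})"

definition maj_phase :: "nat \<Rightarrow> complex" where
  "maj_phase k = (if even k then 1 else \<i>)"

lemma finite_maj_mask [simp]: "finite (maj_mask k)"
  by (simp add: maj_mask_def)

lemma maj_mask_symdiff: "sym_diff {..<k div 2} (if even k then {} else {k div 2}) = maj_mask k"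
  by (auto simp: maj_mask_def)

lemma foldr_Z:
  assumes "i \<le> k" "k \<le> q" "q < n" "finite C"
  shows "foldr (*) (map (\<lambda>j. act_on n [j] pauli_Z) [i..<k]) (pauli n (2 ^ q) C) =
    pauli n (2 ^ q) (sym_diff {i..<k} C)"
  using assms
proof (induction rule: inc_induct)
  case (step m)
  then have "foldr (*) (map (\<lambda>j. act_on n [j] pauli_Z) [m..<k]) (pauli n (2 ^ q) C) =
    pauli n 0 {m} * pauli n (2 ^ q) (sym_diff {Suc m..<k} C)"
    by (simp add: upt_conv_Cons act_on_pauli)
  also have "\<dots> = pauli n (2 ^ q) (sym_diff {m} (sym_diff {Suc m..<k} C))"
    using step by (subst pauli_mult) (auto simp: chi_power)
  also have "sym_diff {m} (sym_diff {Suc m..<k} C) = sym_diff {m..<k} C"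
    using step by auto
  finally show ?case .
qed simp

lemma one_smult_mat [simp]: "(1 :: 'a :: monoid_mult) \<cdot>\<^sub>m A = A"
  by (rule eq_matI) auto

lemma foldr_mult_smult:
  fixes B :: "complex mat"
  assumes "\<And>A. A \<in> set As \<Longrightarrow> A \<in> carrier_mat d d" "B \<in> carrier_mat d d"
  shows "foldr (*) As (c \<cdot>\<^sub>m B) = c \<cdot>\<^sub>m foldr (*) As B \<and> foldr (*) As B \<in> carrier_mat d d"
  using assms
proof (induction As)
  case (Cons A As)
  then have "A \<in> carrier_mat d d" "foldr (*) As B \<in> carrier_mat d d"
    "foldr (*) As (c \<cdot>\<^sub>m B) = c \<cdot>\<^sub>m foldr (*) As B"
    by auto
  then show ?case by (simp add: mult_smult_distrib[of _ d d _ d])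
qed auto

lemma act_on_carrier [simp]: "act_on n qs A \<in> ops n"
  by (simp add: act_on_def)

lemma majorana_eq:
  assumes "k < 2 * n"
  shows "majorana n k = maj_phase k \<cdot>\<^sub>m pauli n (2 ^ (k div 2)) (maj_mask k)"
proof -
  have q: "k div 2 < n" using assms by auto
  let ?Z = "map (\<lambda>j. act_on n [j] pauli_Z) [0..<k div 2]"
  let ?C = "if even k then {} else {k div 2}"
  have "majorana n k = foldr (*) ?Z (maj_phase k \<cdot>\<^sub>m pauli n (2 ^ (k div 2)) ?C)"
    using q by (auto simp: majorana_def maj_phase_def act_on_pauli)
  also have "\<dots> = maj_phase k \<cdot>\<^sub>m foldr (*) ?Z (pauli n (2 ^ (k div 2)) ?C)"
    by (rule foldr_mult_smult[of ?Z "2 ^ n", THEN conjunct1]) auto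
  also have "foldr (*) ?Z (pauli n (2 ^ (k div 2)) ?C) = pauli n (2 ^ (k div 2)) (maj_mask k)"
    using q by (subst foldr_Z) (simp_all only: atLeast0LessThan maj_mask_symdiff, auto)
  finally show ?thesis .
qed

subsection \<open>The Clifford algebra\<close>

lemma smult_smult_mat [simp]: "c \<cdot>\<^sub>m (e \<cdot>\<^sub>m A) = (c * e :: complex) \<cdot>\<^sub>m A"
  by (rule eq_matI) auto

lemma smult_mult_smult:
  fixes A B :: "complex mat"
  assumes "A \<in> carrier_mat d d" "B \<in> carrier_mat d d"
  shows "(c \<cdot>\<^sub>m A) * (e \<cdot>\<^sub>m B) = (c * e) \<cdot>\<^sub>m (A * B)"
  using assms
  by (simp add: mult_smult_distrib[of _ d d _ d] mult_smult_assoc_mat[of _ d d _ d] mult.commute)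

lemma power_div_less: "k < 2 * n \<Longrightarrow> (2::nat) ^ (k div 2) < 2 ^ n"
  by (intro power_strict_increasing) auto

lemma majorana_carrier [simp]:
  "k < 2 * n \<Longrightarrow> majorana n k \<in> ops n"
  by (simp add: majorana_eq)

lemma majorana_dim [simp]:
  "k < 2 * n \<Longrightarrow> dim_row (majorana n k) = 2 ^ n" "k < 2 * n \<Longrightarrow> dim_col (majorana n k) = 2 ^ n"
  by (simp_all add: majorana_eq)

lemma chi_maj_mask: "chi (maj_mask k) (2 ^ (k div 2)) = (if even k then 1 else - 1)"
  by (simp add: chi_power) (auto simp: maj_mask_def)

lemma majorana_adjoint [simp]:
  assumes "k < 2 * n"
  shows "adj (majorana n k) = majorana n k"
  using power_div_less[OF assms]
  by (simp add: majorana_eq[OF assms] adjoint_smult[of _ "2 ^ n"] pauli_adjoint chi_maj_mask maj_phase_def)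

lemma majorana_mult:
  assumes "i < 2 * n" "j < 2 * n"
  shows "majorana n i * majorana n j =
    (maj_phase i * maj_phase j * complex_of_real (chi (maj_mask i) (2 ^ (j div 2)))) \<cdot>\<^sub>m
    pauli n (2 ^ (i div 2) XOR 2 ^ (j div 2)) (sym_diff (maj_mask i) (maj_mask j))"
  using assms power_div_less
  by (simp add: majorana_eq smult_mult_smult[of _ "2 ^ n"] pauli_mult)

lemma majorana_square [simp]:
  assumes "k < 2 * n"
  shows "majorana n k * majorana n k = 1\<^sub>m (2 ^ n)"
  by (simp add: majorana_mult[OF assms assms] chi_maj_mask maj_phase_def pauli_one)

lemma majorana_anticommute:
  assumes "i < 2 * n" "j < 2 * n" "i \<noteq> j"
  shows "majorana n i * majorana n j = (- 1) \<cdot>\<^sub>m (majorana n j * majorana n i)"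
proof -
  \<comment> \<open>Exactly one of the two strings has a \<open>Z\<close> on the qubit that the
    other operator flips, and this one crossing produces the sign.\<close>
  have "j div 2 \<in> maj_mask i \<longleftrightarrow> i div 2 \<notin> maj_mask j"
    using assms(3) unfolding maj_mask_def
    by (cases "even i"; cases "even j") (auto elim!: evenE oddE)
  then have "chi (maj_mask i) (2 ^ (j div 2)) = - chi (maj_mask j) (2 ^ (i div 2))"
    by (simp add: chi_power)
  moreover have "sym_diff (maj_mask i) (maj_mask j) = sym_diff (maj_mask j) (maj_mask i)"
    by auto
  ultimately show ?thesis
    using assms by (simp add: majorana_mult xor.commute mult.commute mult.left_commute)
qed

lemma pauli_mult_entry:
  assumes "A \<in> ops n" "a < 2 ^ n" "x < 2 ^ n" "y < 2 ^ n"
  shows "(pauli n a C * A) $$ (x, y) = complex_of_real (chi C (x XOR a)) * A $$ (x XOR a, y)"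
proof -
  have "(pauli n a C * A) $$ (x, y) = (\<Sum>z<2 ^ n. pauli n a C $$ (x, z) * A $$ (z, y))"
    using assms by (intro mult_entry) auto
  also have "\<dots> = (\<Sum>z<2 ^ n. if z = x XOR a then complex_of_real (chi C z) * A $$ (z, y) else 0)"
    using assms by (intro sum.cong) (auto simp: pauli_entry)
  also have "\<dots> = complex_of_real (chi C (x XOR a)) * A $$ (x XOR a, y)"
    using assms by (simp add: xor_less_power)
  finally show ?thesis .
qed

text \<open>Schur's lemma for the irreducible Clifford representation, in coordinates. The two
  generators of qubit \<open>q\<close> flip the same bit of both indices, but with signs that differ
  by \<open>chi {q}\<close> of each index. This kills every entry between states that differ in bit
  \<open>q\<close> and equates diagonal entries along single bit flips.\<close>

lemma majorana_commutant_scalar: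
  assumes A: "A \<in> ops n"
    and comm: "\<And>k. k < 2 * n \<Longrightarrow> A * majorana n k = majorana n k * A"
  shows "A = A $$ (0, 0) \<cdot>\<^sub>m 1\<^sub>m (2 ^ n)"
proof -
  have comm_pauli: "A $$ (x, y XOR 2 ^ (k div 2)) * complex_of_real (chi (maj_mask k) y) =
      complex_of_real (chi (maj_mask k) (x XOR 2 ^ (k div 2))) * A $$ (x XOR 2 ^ (k div 2), y)"
    if "k < 2 * n" "x < 2 ^ n" "y < 2 ^ n" for k x y
  proof -
    let ?P = "pauli n (2 ^ (k div 2)) (maj_mask k)"
    have "maj_phase k \<cdot>\<^sub>m (A * ?P) = maj_phase k \<cdot>\<^sub>m (?P * A)"
      using comm[OF that(1)] A that(1)
      by (simp add: majorana_eq sq_ring[where d = "2^n"])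
    then have "maj_phase k * (A * ?P) $$ (x, y) = maj_phase k * (?P * A) $$ (x, y)"
      using smult_entry[OF mult_carrier_mat[OF A pauli_carrier]] that
        smult_entry[OF mult_carrier_mat[OF pauli_carrier A]] by metis
    then have "(A * ?P) $$ (x, y) = (?P * A) $$ (x, y)"
      by (simp add: maj_phase_def split: if_splits)
    then show ?thesis
      using A that power_div_less by (simp add: mult_pauli_entry pauli_mult_entry)
  qed
  \<comment> \<open>Taking \<open>comm_pauli\<close> at the flipped column
    \<open>y XOR 2 ^ q\<close> leaves the unshifted entry on the left.\<close>
  have step: "A $$ (x, y) * chi {..<q} y = chi {..<q} x * A $$ (x XOR 2 ^ q, y XOR 2 ^ q)"
    "A $$ (x, y) * (chi {..<q} y * chi {q} y) =
      chi {..<q} x * chi {q} x * A $$ (x XOR 2 ^ q, y XOR 2 ^ q)"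
    if "q < n" "x < 2 ^ n" "y < 2 ^ n" for q x y
  proof -
    have q: "(2::nat) ^ q < 2 ^ n" using that by simp
    have "{..q} = sym_diff {..<q} {q}" by auto
    then have le: "chi {..q} z = chi {..<q} z * chi {q} z" for z
      using chi_symdiff[of "{..<q}" "{q}"] by simp
    show "A $$ (x, y) * chi {..<q} y = chi {..<q} x * A $$ (x XOR 2 ^ q, y XOR 2 ^ q)"
      using comm_pauli[of "2 * q" x "y XOR 2 ^ q"] that q
      by (simp add: maj_mask_def xor_less_power chi_xor chi_power)
    show "A $$ (x, y) * (chi {..<q} y * chi {q} y) =
      chi {..<q} x * chi {q} x * A $$ (x XOR 2 ^ q, y XOR 2 ^ q)"
      using comm_pauli[of "2 * q + 1" x "y XOR 2 ^ q"] that q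
      by (simp add: maj_mask_def xor_less_power chi_xor chi_power le)
  qed
  have off: "A $$ (x, y) = 0" if xy: "x < 2 ^ n" "y < 2 ^ n" "x \<noteq> y" for x y
  proof -
    obtain q where q: "q < n" "bit x q \<noteq> bit y q"
      using nat_eq_iff_bits xy by blast
    then have sx: "chi {q} x = - chi {q} y"
      by (auto simp: chi_def)
    let ?c = "\<lambda>C x. complex_of_real (chi C x)"
    have "A $$ (x, y) * (?c {..<q} y * ?c {q} y) = ?c {q} x * (?c {..<q} x * A $$ (x XOR 2 ^ q, y XOR 2 ^ q))"
      using step(2)[OF q(1) xy(1,2)] by (simp add: mult_ac)
    also have "\<dots> = - ?c {q} y * (A $$ (x, y) * ?c {..<q} y)"
      using step(1)[OF q(1) xy(1,2)] by (simp only: sx of_real_minus mult.commute)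
    finally have "A $$ (x, y) * (?c {..<q} y * ?c {q} y) = 0"
      by (simp add: mult_ac)
    then show ?thesis
      using chi_cases[of "{..<q}" y] chi_cases[of "{q}" y] by auto
  qed
  \<comment> \<open>The bits of \<open>x\<close> are switched on one at a time, starting from the
    zero state.\<close>
  have diag: "A $$ (take_bit k x, take_bit k x) = A $$ (0, 0)" if "k \<le> n" "x < 2 ^ n" for k x
    using that(1)
  proof (induction k)
    case (Suc k)
    have less: "take_bit k x < 2 ^ n"
      using that(2) take_bit_nat_less_eq_self[of k x] by (rule le_less_trans[rotated])
    show ?case
    proof (cases "bit x k")
      case True
      then have eq: "take_bit (Suc k) x = take_bit k x XOR 2 ^ k"
        by (intro bit_eqI) (auto simp: bit_take_bit_iff bit_xor_iff bit_exp_iff less_Suc_eq)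
      show ?thesis
        using step(1)[of k "take_bit k x" "take_bit k x"] less Suc chi_cases[of "{..<k}" "take_bit k x"]
        unfolding eq by auto
    next
      case False
      then have "take_bit (Suc k) x = take_bit k x"
        by (intro bit_eqI) (auto simp: bit_take_bit_iff less_Suc_eq)
      then show ?thesis using Suc by simp
    qed
  qed simp
  show ?thesis
  proof (rule eq_matI'[of _ "2 ^ n"])
    fix x y :: nat assume xy: "x < 2 ^ n" "y < 2 ^ n"
    show "A $$ (x, y) = (A $$ (0, 0) \<cdot>\<^sub>m 1\<^sub>m (2 ^ n)) $$ (x, y)"
    proof (cases "x = y")
      case True
      have "take_bit n x = x" using xy by (simp add: take_bit_nat_eq_self)
      then show ?thesis using True diag[of n x] xy by simp
    next
      case False
      then show ?thesis using off[OF xy] xy by simp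
    qed
  qed (use A in auto)
qed

subsection \<open>Sums of matrices\<close>

text \<open>The dimension is an explicit argument so that the empty sum is still a \<open>d\<close>
  by \<open>d\<close> matrix.\<close>

definition msum :: "nat \<Rightarrow> ('i \<Rightarrow> complex mat) \<Rightarrow> 'i set \<Rightarrow> complex mat" where
  "msum d f I = Matrix.mat d d (\<lambda>p. \<Sum>i\<in>I. f i $$ p)"

lemma msum_carrier [simp]: "msum d f I \<in> carrier_mat d d"
  by (simp add: msum_def)

lemma msum_dim [simp]: "dim_row (msum d f I) = d" "dim_col (msum d f I) = d"
  by (simp_all add: msum_def)

lemma msum_entry [simp]: "x < d \<Longrightarrow> y < d \<Longrightarrow> msum d f I $$ (x, y) = (\<Sum>i\<in>I. f i $$ (x, y))"
  by (simp add: msum_def)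

lemma msum_cong: "I = J \<Longrightarrow> (\<And>i. i \<in> J \<Longrightarrow> f i = g i) \<Longrightarrow> msum d f I = msum d g J"
  by (simp add: msum_def)

lemma mult_msum:
  assumes "A \<in> carrier_mat d d" "\<And>i. i \<in> I \<Longrightarrow> f i \<in> carrier_mat d d"
  shows "A * msum d f I = msum d (\<lambda>i. A * f i) I"
proof (rule eq_matI'[of _ d])
  fix x y assume xy: "x < d" "y < d"
  have "(A * msum d f I) $$ (x, y) = (\<Sum>k<d. \<Sum>i\<in>I. A $$ (x, k) * f i $$ (k, y))"
    using mult_entry[OF assms(1) msum_carrier xy] xy by (simp add: sum_distrib_left)
  also have "\<dots> = (\<Sum>i\<in>I. (A * f i) $$ (x, y))"
    using assms xy by (subst sum.swap) (auto intro!: sum.cong mult_entry[symmetric])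
  finally show "(A * msum d f I) $$ (x, y) = msum d (\<lambda>i. A * f i) I $$ (x, y)"
    using xy by simp
qed (use assms in auto)

lemma msum_mult:
  assumes "A \<in> carrier_mat d d" "\<And>i. i \<in> I \<Longrightarrow> f i \<in> carrier_mat d d"
  shows "msum d f I * A = msum d (\<lambda>i. f i * A) I"
proof (rule eq_matI'[of _ d])
  fix x y assume xy: "x < d" "y < d"
  have "(msum d f I * A) $$ (x, y) = (\<Sum>k<d. \<Sum>i\<in>I. f i $$ (x, k) * A $$ (k, y))"
    using mult_entry[OF msum_carrier assms(1) xy] xy by (simp add: sum_distrib_right)
  also have "\<dots> = (\<Sum>i\<in>I. (f i * A) $$ (x, y))"
    using assms xy by (subst sum.swap) (auto intro!: sum.cong mult_entry[symmetric])
  finally show "(msum d f I * A) $$ (x, y) = msum d (\<lambda>i. f i * A) I $$ (x, y)"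
    using xy by simp
qed (use assms in auto)

lemma smult_msum:
  assumes "\<And>i. i \<in> I \<Longrightarrow> f i \<in> carrier_mat d d"
  shows "c \<cdot>\<^sub>m msum d f I = msum d (\<lambda>i. c \<cdot>\<^sub>m f i) I"
  using assms carrier_matD[OF assms]
  by (intro eq_matI'[of _ d]) (auto simp: sum_distrib_left)

lemma adjoint_msum:
  assumes "\<And>i. i \<in> I \<Longrightarrow> f i \<in> carrier_mat d d"
  shows "adj (msum d f I) = msum d (\<lambda>i. adj (f i)) I"
  using assms carrier_matD[OF assms]
  by (intro eq_matI'[of _ d]) (auto simp: adjoint_entry[of _ d])

subsection \<open>Rotated Majorana operators\<close>

text \<open>What conjugation has to make of the \<open>i\<close>-th generator, expressed without a
  unitary. It is linear in \<open>R\<close>, which is what measurability rests on later.\<close>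

definition rot :: "nat \<Rightarrow> real mat \<Rightarrow> nat \<Rightarrow> complex mat" where
  "rot n R i = msum (2 ^ n) (\<lambda>j. complex_of_real (R $$ (i, j)) \<cdot>\<^sub>m majorana n j) {..<2 * n}"

lemma rot_carrier [simp]: "rot n R i \<in> ops n"
  by (simp add: rot_def)

lemma is_matchgate_unitary_iff:
  "is_matchgate_unitary n R U \<longleftrightarrow> U \<in> ops n \<and>
     U * adj U = 1\<^sub>m (2 ^ n) \<and>
     (\<forall>i<2 * n. U * majorana n i * adj U = rot n R i)"
proof -
  have "Matrix.mat (2 ^ n) (2 ^ n)
      (\<lambda>(x, y). \<Sum>j<2 * n. complex_of_real (R $$ (i, j)) * majorana n j $$ (x, y)) = rot n R i" for i
    by (rule eq_matI'[of _ "2 ^ n"]) (auto simp: rot_def)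
  then show ?thesis by (simp add: is_matchgate_unitary_def)
qed

lemma rot_adjoint [simp]: "adj (rot n R i) = rot n R i"
  unfolding rot_def
  by (subst adjoint_msum) (auto simp: adjoint_smult[of _ "2 ^ n"] intro!: msum_cong)

lemma orth_group_rows:
  assumes "R \<in> orth_group N" "i < N" "j < N"
  shows "(\<Sum>k<N. R $$ (i, k) * R $$ (j, k)) = (if i = j then 1 else 0)"
proof -
  have R: "R \<in> carrier_mat N N" "R * transpose_mat R = 1\<^sub>m N"
    using assms by (auto simp: orth_group_def)
  have "(\<Sum>k<N. R $$ (i, k) * R $$ (j, k)) = (\<Sum>k<N. R $$ (i, k) * transpose_mat R $$ (k, j))"
    using R assms by (intro sum.cong) auto
  also have "\<dots> = (R * transpose_mat R) $$ (i, j)"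
    using R assms by (intro mult_entry[symmetric]) auto
  finally show ?thesis using R assms by simp
qed

lemma orth_group_cols:
  assumes "R \<in> orth_group N" "i < N" "j < N"
  shows "(\<Sum>k<N. R $$ (k, i) * R $$ (k, j)) = (if i = j then 1 else 0)"
proof -
  have R: "R \<in> carrier_mat N N" "R * transpose_mat R = 1\<^sub>m N"
    using assms by (auto simp: orth_group_def)
  have R': "transpose_mat R * R = 1\<^sub>m N"
    by (rule mult_one_comm[OF R(1) _ R(2)]) (use R(1) in simp)
  have "(\<Sum>k<N. R $$ (k, i) * R $$ (k, j)) = (\<Sum>k<N. transpose_mat R $$ (i, k) * R $$ (k, j))"
    using R assms by (intro sum.cong) auto
  also have "\<dots> = (transpose_mat R * R) $$ (i, j)"
    using R assms by (intro mult_entry[symmetric]) auto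
  finally show ?thesis using R' assms by simp
qed

text \<open>Used twice: with \<open>Y\<close> the identity for the Clifford relations of the rotated
  operators, and with a general \<open>Y\<close> for the superoperator
  \<open>maj_sum\<close>.\<close>

lemma rot_sandwich_entry:
  assumes Y: "Y \<in> ops n" and "x < 2 ^ n" "y < 2 ^ n"
  shows "(rot n R i * Y * rot n R j) $$ (x, y) =
    (\<Sum>a<2 * n. \<Sum>b<2 * n. complex_of_real (R $$ (i, a) * R $$ (j, b)) *
       (majorana n a * Y * majorana n b) $$ (x, y))"
proof -
  define d :: nat where "d = 2 ^ n"
  note simps = mult_smult_distrib[of _ d d _ d] mult_smult_assoc_mat[of _ d d _ d]
  let ?c = "\<lambda>i a. complex_of_real (R $$ (i, a))"
  have Yd: "Y \<in> carrier_mat d d" and md: "\<And>a. a < 2 * n \<Longrightarrow> majorana n a \<in> carrier_mat d d"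
    and xy: "x < d" "y < d"
    using assms by (simp_all add: d_def)
  have "rot n R i * Y = msum d (\<lambda>a. ?c i a \<cdot>\<^sub>m (majorana n a * Y)) {..<2 * n}"
    unfolding rot_def d_def[symmetric] using Yd md
    by (subst msum_mult) (auto simp: simps intro!: msum_cong)
  then have "rot n R i * Y * rot n R j =
      msum d (\<lambda>a. (?c i a \<cdot>\<^sub>m (majorana n a * Y)) * rot n R j) {..<2 * n}"
    using Yd md rot_carrier[of n R j, folded d_def] by (simp, subst msum_mult) auto
  then have "(rot n R i * Y * rot n R j) $$ (x, y) =
      (\<Sum>a<2 * n. ((?c i a \<cdot>\<^sub>m (majorana n a * Y)) * rot n R j) $$ (x, y))"
    using xy by simp
  also have "\<dots> = (\<Sum>a<2 * n. \<Sum>b<2 * n.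
      ((?c i a \<cdot>\<^sub>m (majorana n a * Y)) * (?c j b \<cdot>\<^sub>m majorana n b)) $$ (x, y))"
    unfolding rot_def d_def[symmetric] using Yd md xy
    by (intro sum.cong refl, subst mult_msum) auto
  also have "\<dots> = (\<Sum>a<2 * n. \<Sum>b<2 * n. complex_of_real (R $$ (i, a) * R $$ (j, b)) *
       (majorana n a * Y * majorana n b) $$ (x, y))"
    using Yd md xy by (intro sum.cong refl, subst smult_mult_smult[of _ d]) (auto simp: smult_entry[of _ d d])
  finally show ?thesis .
qed

text \<open>Anticommutation cancels the terms with distinct indices; the rest is the inner product
  of two rows of \<open>R\<close>, so orthonormal rows give the Clifford relations.\<close>

lemma rot_mult_add_entry:
  assumes R: "R \<in> orth_group (2 * n)" and ij: "i < 2 * n" "j < 2 * n" and xy: "x < 2 ^ n" "y < 2 ^ n"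
  shows "(rot n R i * rot n R j) $$ (x, y) + (rot n R j * rot n R i) $$ (x, y) =
    (if i = j \<and> x = y then 2 else 0)"
proof -
  define g where "g a b = majorana n a * 1\<^sub>m (2 ^ n) * majorana n b" for a b
  have anti: "g a b $$ (x, y) + g b a $$ (x, y) =
      (if a = b then if x = y then 2 else 0 else 0)" if "a < 2 * n" "b < 2 * n" for a b
    using majorana_anticommute[of a n b] that xy
    by (cases "a = b") (auto simp: g_def right_mult_one_mat[OF majorana_carrier])
  have "(rot n R i * rot n R j) $$ (x, y) + (rot n R j * rot n R i) $$ (x, y) =
    (\<Sum>a<2 * n. \<Sum>b<2 * n. complex_of_real (R $$ (i, a) * R $$ (j, b)) *
       (g a b $$ (x, y) + g b a $$ (x, y)))"
    using rot_sandwich_entry[OF one_carrier_mat xy, of R i j, unfolded right_mult_one_mat[OF rot_carrier], folded g_def]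
      rot_sandwich_entry[OF one_carrier_mat xy, of R j i, unfolded right_mult_one_mat[OF rot_carrier], folded g_def]
    by (simp only:, subst (2) sum.swap) (simp add: sum.distrib algebra_simps)
  also have "\<dots> = (\<Sum>a<2 * n. \<Sum>b<2 * n. if a = b then
      complex_of_real (R $$ (i, a) * R $$ (j, a)) * (if x = y then 2 else 0) else 0)"
    by (intro sum.cong) (auto simp: anti)
  also have "\<dots> = complex_of_real (\<Sum>a<2 * n. R $$ (i, a) * R $$ (j, a)) * (if x = y then 2 else 0)"
    by (simp add: sum_distrib_right)
  finally show ?thesis using orth_group_rows[OF R ij] by simp
qed

lemma rot_square:
  assumes "R \<in> orth_group (2 * n)" "i < 2 * n"
  shows "rot n R i * rot n R i = 1\<^sub>m (2 ^ n)"
proof (rule eq_matI'[of _ "2 ^ n"])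
  fix x y :: nat assume xy: "x < 2 ^ n" "y < 2 ^ n"
  show "(rot n R i * rot n R i) $$ (x, y) = 1\<^sub>m (2 ^ n) $$ (x, y)"
    using rot_mult_add_entry[OF assms assms(2) xy] xy by (auto split: if_splits)
qed auto

lemma rot_anticommute:
  assumes "R \<in> orth_group (2 * n)" "i < 2 * n" "j < 2 * n" "i \<noteq> j"
  shows "rot n R i * rot n R j = (- 1) \<cdot>\<^sub>m (rot n R j * rot n R i)"
proof (rule eq_matI'[of _ "2 ^ n"])
  fix x y :: nat assume xy: "x < 2 ^ n" "y < 2 ^ n"
  show "(rot n R i * rot n R j) $$ (x, y) = ((- 1) \<cdot>\<^sub>m (rot n R j * rot n R i)) $$ (x, y)"
    using rot_mult_add_entry[OF assms(1-3) xy] xy assms(4)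
      smult_entry[OF mult_carrier_sq[OF rot_carrier rot_carrier] xy]
    by (simp add: eq_neg_iff_add_eq_0)
qed auto

subsection \<open>Existence and uniqueness of matchgate unitaries\<close>

lemma mult_rewrite_left:
  fixes A B :: "complex mat"
  assumes "A * B = c \<cdot>\<^sub>m (C * D)"
    and "A \<in> carrier_mat d d" "B \<in> carrier_mat d d" "C \<in> carrier_mat d d" "D \<in> carrier_mat d d"
      "X \<in> carrier_mat d d"
  shows "A * (B * X) = c \<cdot>\<^sub>m (C * (D * X))"
proof -
  have "A * (B * X) = (A * B) * X"
    using assms(2-) by (simp add: assoc_mult_mat[of _ d d _ d _ d])
  also have "\<dots> = c \<cdot>\<^sub>m (C * (D * X))"
    unfolding assms(1) using assms(2-) by (simp add: assoc_mult_mat[of _ d d _ d _ d] mult_smult_assoc_mat[of _ d d _ d]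
       )
  finally show ?thesis .
qed

lemma total_Z_anticommute:
  assumes "k < 2 * n"
  shows "pauli n 0 {..<n} * majorana n k = (- 1) \<cdot>\<^sub>m (majorana n k * pauli n 0 {..<n})"
proof -
  have "k div 2 < n" using assms by auto
  then show ?thesis
    using power_div_less[OF assms] assms
    by (simp add: majorana_eq sq_ring[where d = "2^n"] pauli_mult chi_power Un_commute)
qed

text \<open>Take \<open>F\<close> as the \<open>k\<close>-th generator times the total parity
  \<open>Z\<close>. The parity anticommutes with every generator, and the \<open>k\<close>-th
  generator with all others, so the signs cancel except at \<open>k\<close>, where only the parity
  contributes one.\<close>

lemma flip_exists:
  assumes k: "k < 2 * n"
  shows "\<exists>F G. F \<in> ops n \<and> G \<in> ops n \<and>
    F * G = 1\<^sub>m (2 ^ n) \<and> F * majorana n k = (- 1) \<cdot>\<^sub>m (majorana n k * F) \<and>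
    (\<forall>j<2 * n. j \<noteq> k \<longrightarrow> F * majorana n j = majorana n j * F)"
proof -
  define d :: nat where "d = 2 ^ n"
  define Z where "Z = pauli n 0 {..<n}"
  let ?m = "majorana n k"
  have c: "Z \<in> carrier_mat d d" "?m \<in> carrier_mat d d"
    using k by (simp_all add: d_def Z_def)
  note simps = sq_ring[where d = d]
  have Z: "Z * majorana n j = (- 1) \<cdot>\<^sub>m (majorana n j * Z)" "majorana n j \<in> carrier_mat d d"
    if "j < 2 * n" for j
    using total_Z_anticommute[OF that] that by (simp_all add: Z_def d_def)
  have ZZ: "Z * Z = 1\<^sub>m d"
    by (simp add: Z_def d_def pauli_mult pauli_one)
  have "(?m * Z) * (Z * ?m) = ?m * ((Z * Z) * ?m)"
    using c by (simp only: simps)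
  also have "\<dots> = 1\<^sub>m d" using c k by (simp add: ZZ d_def)
  finally have 1: "(?m * Z) * (Z * ?m) = 1\<^sub>m d" .
  have 2: "(?m * Z) * ?m = (- 1) \<cdot>\<^sub>m (?m * (?m * Z))"
    using c k Z[OF k] by (simp add: simps)
  have 3: "(?m * Z) * majorana n j = majorana n j * (?m * Z)" if j: "j < 2 * n" "j \<noteq> k" for j
  proof -
    have "?m * (majorana n j * Z) = (- 1) \<cdot>\<^sub>m (majorana n j * (?m * Z))"
      using majorana_anticommute[OF k j(1)] j c Z(2)[OF j(1)]
      by (intro mult_rewrite_left[of _ _ _ _ _ d]) auto
    then show ?thesis using c k Z[OF j(1)] by (simp add: simps)
  qed
  show ?thesis
    using 1 2 3 c unfolding d_def
    by (intro exI[of _ "?m * Z"] exI[of _ "Z * ?m"]) auto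
qed

text \<open>
  If adding \<open>rot n R k * W * majorana n k\<close> to \<open>W\<close> gives zero, then \<open>W\<close> intertwines the \<open>k\<close>-th generators
  with the wrong sign, which multiplication by the \<open>F\<close> of \<open>flip_exists\<close> corrects.
\<close>

lemma intertwiner_exists:
  assumes R: "R \<in> orth_group (2 * n)" and "k \<le> 2 * n"
  shows "\<exists>W. W \<in> ops n \<and> W \<noteq> 0\<^sub>m (2 ^ n) (2 ^ n) \<and>
    (\<forall>j<k. rot n R j * W = W * majorana n j)"
  using assms(2)
proof (induction k)
  case 0
  have "1\<^sub>m (2 ^ n) \<noteq> (0\<^sub>m (2 ^ n) (2 ^ n) :: complex mat)"
  proof
    assume "1\<^sub>m (2 ^ n) = (0\<^sub>m (2 ^ n) (2 ^ n) :: complex mat)"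
    then have "1\<^sub>m (2 ^ n) $$ (0, 0) = (0\<^sub>m (2 ^ n) (2 ^ n) $$ (0, 0) :: complex)"
      by (simp only:)
    then show False by simp
  qed
  then show ?case by (intro exI[of _ "1\<^sub>m (2 ^ n)"]) auto
next
  case (Suc k)
  define d :: nat where "d = 2 ^ n"
  note simps = sq_ring[where d = d]
    mult_add_distrib_mat[of _ d d _ d] add_mult_distrib_mat[of _ d d _ _ d]
  obtain W where W: "W \<in> carrier_mat d d" "W \<noteq> 0\<^sub>m d d"
    and int: "\<And>j. j < k \<Longrightarrow> rot n R j * W = W * majorana n j"
    using Suc by (auto simp: d_def)
  let ?g = "rot n R k" and ?m = "majorana n k"
  have k: "k < 2 * n" using Suc.prems by simp
  have c: "?m \<in> carrier_mat d d" "rot n R j \<in> carrier_mat d d" for j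
    using k by (simp_all add: d_def)
  have cm: "majorana n j \<in> carrier_mat d d" if "j \<le> k" for j
    using k that by (simp add: d_def)
  \<comment> \<open>Up to normalization the average of \<open>W\<close> over the involution that
    maps it to \<open>?g * W * ?m\<close>; since both factors square to one, the average intertwines
    the \<open>k\<close>-th generators.\<close>
  define V where "V = W + ?g * (W * ?m)"
  have Vc: "V \<in> carrier_mat d d" using c W by (simp add: V_def simps)
  have Wm: "?g * (W * ?m) \<in> carrier_mat d d" "W * ?m \<in> carrier_mat d d" "?g * W \<in> carrier_mat d d"
    using c W by (simp_all add: simps)
  show ?case
  proof (cases "V = 0\<^sub>m d d")
    case False
    have "rot n R j * V = V * majorana n j" if "j < Suc k" for j
    proof (cases "j = k")
      case True
      have "?g * (?g * (W * ?m)) = (?g * ?g) * (W * ?m)"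
        using c W by (simp add: simps)
      then have 1: "?g * (?g * (W * ?m)) = W * ?m"
        using rot_square[OF R k] Wm by (simp add: d_def left_mult_one_mat[of _ "2 ^ n" "2 ^ n"])
      have "?g * (W * (?m * ?m)) = ?g * W"
        using k W by (simp add: d_def)
      then show ?thesis
        using 1 c W Wm True by (simp add: V_def simps comm_add_mat[of _ d d])
    next
      case False
      then have j: "j < k" using that by simp
      \<comment> \<open>One sign comes from passing \<open>?g\<close> and one from passing
        \<open>?m\<close>; they cancel, so the relations obtained earlier survive the
        averaging.\<close>
      have "rot n R j * (?g * (W * ?m)) = (- 1) \<cdot>\<^sub>m (?g * (rot n R j * (W * ?m)))"
        using rot_anticommute[OF R _ k] j k c Wm by (intro mult_rewrite_left[of _ _ _ _ _ d]) auto
      also have "rot n R j * (W * ?m) = 1 \<cdot>\<^sub>m (W * (majorana n j * ?m))"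
        using int[OF j] c W cm[of j] j by (intro mult_rewrite_left[of _ _ _ _ _ d]) auto
      also have "majorana n j * ?m = (- 1) \<cdot>\<^sub>m (?m * majorana n j)"
        using j k by (intro majorana_anticommute) auto
      finally have "rot n R j * (?g * (W * ?m)) = (?g * (W * ?m)) * majorana n j"
        using c W cm[of j] j by (simp add: simps)
      then show ?thesis
        using c W cm[of j] j int[OF j] Wm by (simp add: V_def simps)
    qed
    then show ?thesis using False Vc unfolding d_def by blast
  next
    case True
    have gW: "?g * W = (- 1) \<cdot>\<^sub>m (W * ?m)"
    proof -
      have "V * ?m = 0\<^sub>m d d" using True c by simp
      moreover have "?g * (W * (?m * ?m)) = ?g * W"
        using k W by (simp add: d_def)
      ultimately have "W * ?m + ?g * W = 0\<^sub>m d d"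
        using c W Wm by (simp add: V_def simps)
      then have "(W * ?m) $$ (x, y) + (?g * W) $$ (x, y) = 0" if "x < d" "y < d" for x y
        using that Wm by (metis carrier_matD index_add_mat(1) index_zero_mat(1))
      then show ?thesis
        using Wm by (intro eq_matI'[of _ d])
          (auto simp: smult_entry[OF Wm(2)] eq_neg_iff_add_eq_0 add.commute)
    qed
    obtain F G where F: "F \<in> carrier_mat d d" "G \<in> carrier_mat d d" "F * G = 1\<^sub>m d"
      "F * ?m = (- 1) \<cdot>\<^sub>m (?m * F)"
      "\<And>j. j < 2 * n \<Longrightarrow> j \<noteq> k \<Longrightarrow> F * majorana n j = majorana n j * F"
      using flip_exists[OF k] unfolding d_def by auto
    have "W * F \<noteq> 0\<^sub>m d d"
    proof
      assume "W * F = 0\<^sub>m d d"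
      moreover have "W * (F * G) = (W * F) * G"
        using W F(1,2) by (simp add: assoc_mult_mat[of _ d d _ d _ d])
      ultimately have "W = 0\<^sub>m d d" using W F(2,3) by simp
      then show False using W by simp
    qed
    moreover have "rot n R j * (W * F) = (W * F) * majorana n j" if "j < Suc k" for j
    proof (cases "j = k")
      case True
      have "?g * (W * F) = (- 1) \<cdot>\<^sub>m (W * (?m * F))"
        using gW c W F by (intro mult_rewrite_left[of _ _ _ _ _ d]) auto
      then show ?thesis using True F c W by (simp add: simps)
    next
      case False
      then have j: "j < k" using that by simp
      have "rot n R j * (W * F) = 1 \<cdot>\<^sub>m (W * (majorana n j * F))"
        using int[OF j] c W F cm[of j] j by (intro mult_rewrite_left[of _ _ _ _ _ d]) auto
      then show ?thesis using F(5)[of j] j k F(1) cm[of j] W by (simp add: simps)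
    qed
    ultimately show ?thesis
      using W F unfolding d_def by (intro exI[of _ "W * F"]) auto
  qed
qed

text \<open>For a nonzero intertwiner \<open>W\<close>, the product \<open>adj W * W\<close>
  commutes with all generators and is a scalar \<open>r\<close>. This is the squared norm of every
  column, so it is positive, and \<open>W\<close> divided by its square root is unitary.\<close>

lemma matchgate_unitary_exists:
  assumes R: "R \<in> orth_group (2 * n)"
  shows "\<exists>U. is_matchgate_unitary n R U"
proof -
  define d :: nat where "d = 2 ^ n"
  note simps = sq_ring[where d = d]
  obtain W where W: "W \<in> carrier_mat d d" "W \<noteq> 0\<^sub>m d d"
    and int: "\<And>j. j < 2 * n \<Longrightarrow> rot n R j * W = W * majorana n j"
    using intertwiner_exists[OF R order_refl] by (auto simp: d_def)
  have cm: "majorana n j \<in> carrier_mat d d" "rot n R j \<in> carrier_mat d d" if "j < 2 * n" for j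
    using that by (simp_all add: d_def)
  have aW: "adj W \<in> carrier_mat d d" using W by simp
  have ai: "adj W * rot n R j = majorana n j * adj W" if "j < 2 * n" for j
    using arg_cong[OF int[OF that], of adj] W cm[OF that] that
    by (simp add: adjoint_mult[of _ d])
  define r where "r = (\<Sum>k<d. (cmod (W $$ (k, 0)))\<^sup>2)"
  have diag: "(adj W * W) $$ (y, y) = complex_of_real (\<Sum>k<d. (cmod (W $$ (k, y)))\<^sup>2)"
    if "y < d" for y
    using that W mult_entry[OF aW W(1) that that]
    by (simp add: adjoint_entry[of _ d] complex_norm_square mult.commute
        del: adjoint_entry of_real_power)
  have "adj W * W = (adj W * W) $$ (0, 0) \<cdot>\<^sub>m 1\<^sub>m (2 ^ n)"
  proof (rule majorana_commutant_scalar)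
    fix k assume k: "k < 2 * n"
    have "adj W * W * majorana n k = adj W * (rot n R k * W)"
      using W aW cm[OF k] int[OF k] by (simp add: simps)
    also have "\<dots> = majorana n k * (adj W * W)"
      using W aW cm[OF k] ai[OF k]
        mult_rewrite_left[of "adj W" "rot n R k" 1 "majorana n k" "adj W" d W] by simp
    finally show "adj W * W * majorana n k = majorana n k * (adj W * W)" .
  qed (use W aW in \<open>auto simp: d_def\<close>)
  then have WW: "adj W * W = complex_of_real r \<cdot>\<^sub>m 1\<^sub>m d"
    using diag[of 0] by (simp add: d_def r_def)
  have "r \<noteq> 0"
  proof
    assume "r = 0"
    then have "(\<Sum>k<d. (cmod (W $$ (k, y)))\<^sup>2) = 0" if "y < d" for y
      using diag[OF that] WW that by (simp del: of_real_sum of_real_power)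
    then have "W $$ (k, y) = 0" if "y < d" "k < d" for k y
      using that by (auto simp: sum_nonneg_eq_0_iff)
    then show False using W by (auto intro!: eq_matI'[of _ d])
  qed
  moreover have "r \<ge> 0" by (simp add: r_def sum_nonneg)
  ultimately have r: "r > 0" by simp
  define U where "U = complex_of_real (1 / sqrt r) \<cdot>\<^sub>m W"
  have U: "U \<in> carrier_mat d d" "adj U \<in> carrier_mat d d"
    using W by (auto simp: U_def)
  have "complex_of_real (1 / sqrt r) * complex_of_real (1 / sqrt r) * complex_of_real r = 1"
    unfolding of_real_mult[symmetric] using r by (simp add: field_simps)
  then have aUU: "adj U * U = 1\<^sub>m d"
    using W aW WW r by (simp add: U_def adjoint_smult[of _ d] smult_mult_smult[of _ d])
  then have UU: "U * adj U = 1\<^sub>m d"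
    by (rule mult_one_comm[OF U(2,1)])
  have "U * majorana n j * adj U = rot n R j" if "j < 2 * n" for j
  proof -
    have "U * majorana n j = rot n R j * U"
      using int[OF that] W cm[OF that] by (simp add: U_def simps)
    then have "U * majorana n j * adj U = rot n R j * (U * adj U)"
      using U cm[OF that] by (simp add: simps)
    then show ?thesis using UU cm[OF that] by simp
  qed
  then show ?thesis
    using U UU unfolding is_matchgate_unitary_iff d_def by blast
qed

lemma is_matchgate_unitary_matchgate_unitary:
  "R \<in> orth_group (2 * n) \<Longrightarrow> is_matchgate_unitary n R (matchgate_unitary n R)"
  unfolding matchgate_unitary_def by (rule someI_ex[OF matchgate_unitary_exists])

text \<open>The quotient \<open>adj U * U'\<close> commutes with all generators, hence is a scalar;
  unitarity makes it a phase.\<close>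

lemma is_matchgate_unitary_unique:
  assumes "is_matchgate_unitary n R U" "is_matchgate_unitary n R U'"
  shows "\<exists>\<theta>. cmod \<theta> = 1 \<and> U' = \<theta> \<cdot>\<^sub>m U"
proof -
  define d :: nat where "d = 2 ^ n"
  note simps = sq_ring[where d = d]
  have U: "U \<in> carrier_mat d d" "U * adj U = 1\<^sub>m d"
    "\<And>i. i < 2 * n \<Longrightarrow> U * majorana n i * adj U = rot n R i"
    and U': "U' \<in> carrier_mat d d" "U' * adj U' = 1\<^sub>m d"
    "\<And>i. i < 2 * n \<Longrightarrow> U' * majorana n i * adj U' = rot n R i"
    using assms unfolding is_matchgate_unitary_iff d_def by auto
  have c: "adj U \<in> carrier_mat d d" "adj U' \<in> carrier_mat d d"
    using U U' by auto
  have aU: "adj U * U = 1\<^sub>m d" "adj U' * U' = 1\<^sub>m d"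
    by (rule mult_one_comm[OF U(1) c(1) U(2)], rule mult_one_comm[OF U'(1) c(2) U'(2)])
  have int: "V * majorana n k = rot n R k * V"
    if "k < 2 * n" "V \<in> carrier_mat d d" "adj V * V = 1\<^sub>m d"
      "V * majorana n k * adj V = rot n R k" for V k
  proof -
    have cm: "majorana n k \<in> carrier_mat d d" using that by (simp add: d_def)
    have "rot n R k * V = V * (majorana n k * (adj V * V))"
      using that cm by (simp add: simps that(4)[symmetric])
    then show ?thesis using that cm by simp
  qed
  define A where "A = adj U * U'"
  have Ac: "A \<in> carrier_mat d d" using c U' by (simp add: A_def simps)
  have "A = A $$ (0, 0) \<cdot>\<^sub>m 1\<^sub>m (2 ^ n)"
  proof (rule majorana_commutant_scalar)
    fix k assume k: "k < 2 * n"
    have cm: "majorana n k \<in> carrier_mat d d" "rot n R k \<in> carrier_mat d d"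
      using k by (simp_all add: d_def)
    have "adj U * rot n R k = majorana n k * adj U"
      using arg_cong[OF int[OF k U(1) aU(1) U(3)[OF k]], of adj] U cm k
      by (simp add: adjoint_mult[of _ d])
    then have "adj U * (rot n R k * U') = 1 \<cdot>\<^sub>m (majorana n k * (adj U * U'))"
      using c cm U' by (intro mult_rewrite_left[of _ _ _ _ _ d]) auto
    then show "A * majorana n k = majorana n k * A"
      using c cm U' int[OF k U'(1) aU(2) U'(3)[OF k]] by (simp add: A_def simps)
  qed (use Ac d_def in auto)
  then obtain \<theta> where \<theta>: "A = \<theta> \<cdot>\<^sub>m 1\<^sub>m d" by (auto simp: d_def)
  have "U' = (U * adj U) * U'" using U U' by simp
  also have "\<dots> = U * A" using U(1) U'(1) c by (simp add: simps A_def)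
  also have "\<dots> = \<theta> \<cdot>\<^sub>m U" using U(1) by (simp add: \<theta> simps)
  finally have eq: "U' = \<theta> \<cdot>\<^sub>m U" .
  have "1\<^sub>m d = (\<theta> * cnj \<theta>) \<cdot>\<^sub>m (1\<^sub>m d :: complex mat)"
    using U'(2) U(2) U(1) c unfolding eq
    by (simp add: adjoint_smult[of _ d] smult_mult_smult[of _ d])
  then have "(1\<^sub>m d :: complex mat) $$ (0, 0) = ((\<theta> * cnj \<theta>) \<cdot>\<^sub>m (1\<^sub>m d :: complex mat)) $$ (0, 0)"
    by simp
  then have "\<theta> * cnj \<theta> = 1" by (simp add: d_def)
  then have "complex_of_real ((cmod \<theta>)\<^sup>2) = complex_of_real 1"
    by (simp add: complex_norm_square del: of_real_power)
  then have "(cmod \<theta>)\<^sup>2 = 1" by (simp only: of_real_eq_iff)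
  then have "cmod \<theta> = 1" by (simp add: power2_eq_1_iff) (metis norm_ge_zero not_one_le_zero neg_0_le_iff_le)
  then show ?thesis using eq by blast
qed

section \<open>Pauli strings as matchgates with diagonal sign parameter\<close>

definition sign_mat :: "nat \<Rightarrow> (nat \<Rightarrow> real) \<Rightarrow> real mat" where
  "sign_mat N s = Matrix.mat N N (\<lambda>(i, j). if i = j then s i else 0)"

lemma sign_mat_orth:
  assumes "\<And>i. i < N \<Longrightarrow> s i * s i = 1"
  shows "sign_mat N s \<in> orth_group N"
proof -
  have "sign_mat N s * transpose_mat (sign_mat N s) = 1\<^sub>m N"
  proof (rule eq_matI'[of _ N])
    fix i j assume ij: "i < N" "j < N"
    have "(sign_mat N s * transpose_mat (sign_mat N s)) $$ (i, j) =
      (\<Sum>k<N. sign_mat N s $$ (i, k) * transpose_mat (sign_mat N s) $$ (k, j))"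
      using ij by (intro mult_entry) (auto simp: sign_mat_def)
    also have "\<dots> = (\<Sum>k<N. if k = i then (if i = j then s i * s i else 0) else 0)"
      using ij by (intro sum.cong) (auto simp: sign_mat_def)
    also have "\<dots> = 1\<^sub>m N $$ (i, j)" using ij assms by simp
    finally show "(sign_mat N s * transpose_mat (sign_mat N s)) $$ (i, j) = 1\<^sub>m N $$ (i, j)" .
  qed (auto simp: sign_mat_def)
  then show ?thesis by (simp add: orth_group_def) (simp add: sign_mat_def)
qed

lemma orth_group_mult:
  assumes "A \<in> orth_group N" "B \<in> orth_group N"
  shows "A * B \<in> orth_group N"
proof -
  have c: "A \<in> carrier_mat N N" "B \<in> carrier_mat N N"
    "transpose_mat A \<in> carrier_mat N N" "transpose_mat B \<in> carrier_mat N N"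
    and 1: "A * transpose_mat A = 1\<^sub>m N" "B * transpose_mat B = 1\<^sub>m N"
    using assms by (auto simp: orth_group_def)
  have "(A * B) * transpose_mat (A * B) = A * ((B * transpose_mat B) * transpose_mat A)"
    using c by (simp add: transpose_mult[of _ N N _ N] assoc_mult_mat[of _ N N _ N _ N]
        mult_carrier_mat[of _ N N _ N])
  then show ?thesis using c 1 by (simp add: orth_group_def mult_carrier_mat[of _ N N _ N])
qed

lemma sign_mat_mult_entry:
  assumes "R \<in> carrier_mat N N" "i < N" "j < N"
  shows "(sign_mat N s * R) $$ (i, j) = s i * R $$ (i, j)"
proof -
  have "(sign_mat N s * R) $$ (i, j) = (\<Sum>k<N. sign_mat N s $$ (i, k) * R $$ (k, j))"
    using assms by (intro mult_entry) (auto simp: sign_mat_def)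
  also have "\<dots> = (\<Sum>k<N. if k = i then s i * R $$ (i, j) else 0)"
    using assms by (intro sum.cong) (auto simp: sign_mat_def)
  finally show ?thesis using assms by simp
qed

lemma rot_sign_mat:
  assumes "R \<in> orth_group (2 * n)" "i < 2 * n"
  shows "rot n (sign_mat (2 * n) s * R) i = complex_of_real (s i) \<cdot>\<^sub>m rot n R i"
  unfolding rot_def using assms
  by (subst smult_msum) (auto intro!: msum_cong simp: sign_mat_mult_entry orth_group_def)

lemma pauli_conj_majorana:
  assumes "k < 2 * n" "a < 2 ^ n" "finite C"
  shows "pauli n a C * majorana n k =
    complex_of_real (chi C (2 ^ (k div 2)) * chi (maj_mask k) a) \<cdot>\<^sub>m (majorana n k * pauli n a C)"
proof -
  have sq: "complex_of_real (chi (maj_mask k) a) * complex_of_real (chi (maj_mask k) a) = 1"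
    by (simp only: of_real_mult[symmetric] chi_square of_real_1)
  have cancel: "complex_of_real (chi (maj_mask k) a) * (complex_of_real (chi (maj_mask k) a) * z) = z" for z
    by (simp only: mult.assoc[symmetric] sq mult_1_left)
  show ?thesis
    using assms power_div_less[OF assms(1)]
    by (simp add: majorana_eq sq_ring[where d = "2^n"] pauli_mult xor.commute Un_commute mult_ac cancel)
qed

lemma pauli_unitary:
  assumes "a < 2 ^ n" "finite C"
  shows "pauli n a C * adj (pauli n a C) = 1\<^sub>m (2 ^ n)"
  using assms
  by (simp add: pauli_adjoint sq_ring[where d = "2^n"] pauli_mult pauli_one
      flip: of_real_mult)

text \<open>Conjugation by a Pauli string only changes signs of generators, so the string is a
  matchgate whose parameter is a sign matrix \<open>D\<close>. Left multiplication of the parameter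
  by \<open>D\<close> is then right multiplication of the unitary by the string. The phase
  \<open>\<theta>\<close> reflects the arbitrary choices on both sides.\<close>

lemma matchgate_unitary_pauli:
  assumes "a < 2 ^ n" "finite C"
  shows "\<exists>D\<in>orth_group (2 * n). \<forall>R\<in>orth_group (2 * n). \<exists>\<theta>. cmod \<theta> = 1 \<and>
    matchgate_unitary n (D * R) = \<theta> \<cdot>\<^sub>m (matchgate_unitary n R * pauli n a C)"
proof -
  define d :: nat where "d = 2 ^ n"
  note simps = sq_ring[where d = d]
  define s where "s k = chi C (2 ^ (k div 2)) * chi (maj_mask k) a" for k
  have s: "s k * s k = 1" for k
    using chi_square[of C "2 ^ (k div 2)"] chi_square[of "maj_mask k" a]
    by (simp add: s_def algebra_simps del: chi_square)
  define D where "D = sign_mat (2 * n) s"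
  have D: "D \<in> orth_group (2 * n)" unfolding D_def by (rule sign_mat_orth) (rule s)
  let ?P = "pauli n a C"
  have P: "?P \<in> carrier_mat d d" "adj ?P \<in> carrier_mat d d"
    by (simp_all add: d_def)
  have PP: "?P * adj ?P = 1\<^sub>m d" using pauli_unitary[OF assms] by (simp add: d_def)
  have mg: "is_matchgate_unitary n (D * R) (U * ?P)"
    if "is_matchgate_unitary n R U" "R \<in> orth_group (2 * n)" for R U
  proof -
    have U: "U \<in> carrier_mat d d" "U * adj U = 1\<^sub>m d"
      "\<And>i. i < 2 * n \<Longrightarrow> U * majorana n i * adj U = rot n R i"
      using that unfolding is_matchgate_unitary_iff d_def by auto
    have aU: "adj U \<in> carrier_mat d d" using U by simp
    have "(U * ?P) * adj (U * ?P) = U * ((?P * adj ?P) * adj U)"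
      using U aU P by (simp add: adjoint_mult[of _ d] simps)
    then have 1: "(U * ?P) * adj (U * ?P) = 1\<^sub>m d" using U aU PP by simp
    have "(U * ?P) * majorana n k * adj (U * ?P) = rot n (D * R) k" if k: "k < 2 * n" for k
    proof -
      have cm: "majorana n k \<in> carrier_mat d d" using k by (simp add: d_def)
      have "(U * ?P) * majorana n k * adj (U * ?P) =
          U * ((?P * majorana n k) * (adj ?P * adj U))"
        using U aU P cm by (simp add: adjoint_mult[of _ d] simps)
      also have "\<dots> = complex_of_real (s k) \<cdot>\<^sub>m
          (U * (majorana n k * ((?P * adj ?P) * adj U)))"
        using U(1) aU P cm pauli_conj_majorana[OF k assms] by (simp add: simps s_def)
      also have "\<dots> = complex_of_real (s k) \<cdot>\<^sub>m rot n R k"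
        using U(1) aU cm U(3)[OF k] PP by (simp add: simps)
      also have "\<dots> = rot n (D * R) k"
        using \<open>R \<in> orth_group (2 * n)\<close> k by (simp add: D_def rot_sign_mat)
      finally show ?thesis .
    qed
    then show ?thesis
      using 1 U P by (simp add: is_matchgate_unitary_iff d_def)
  qed
  show ?thesis
  proof (intro bexI[OF _ D] ballI)
    fix R assume R: "R \<in> orth_group (2 * n)"
    show "\<exists>\<theta>. cmod \<theta> = 1 \<and> matchgate_unitary n (D * R) = \<theta> \<cdot>\<^sub>m (matchgate_unitary n R * ?P)"
      by (rule is_matchgate_unitary_unique[OF mg[OF is_matchgate_unitary_matchgate_unitary[OF R] R]
            is_matchgate_unitary_matchgate_unitary[OF orth_group_mult[OF D R]]])
  qed
qed

subsection \<open>Monomials in the Majorana operators\<close>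

text \<open>Lists rather than sets, so that inductions run over the factors; \<open>gam\<close>
  fixes the sign of a monomial by listing its indices in increasing order.\<close>

definition mprod :: "nat \<Rightarrow> (nat \<Rightarrow> complex mat) \<Rightarrow> nat list \<Rightarrow> complex mat" where
  "mprod n f L = foldr (*) (map f L) (1\<^sub>m (2 ^ n))"

abbreviation gam :: "nat \<Rightarrow> nat set \<Rightarrow> complex mat" where
  "gam n I \<equiv> mprod n (majorana n) (sorted_list_of_set I)"

abbreviation gam_rot :: "nat \<Rightarrow> real mat \<Rightarrow> nat set \<Rightarrow> complex mat" where
  "gam_rot n R I \<equiv> mprod n (rot n R) (sorted_list_of_set I)"

lemma mprod_Nil [simp]: "mprod n f [] = 1\<^sub>m (2 ^ n)"
  and mprod_Cons: "mprod n f (i # L) = f i * mprod n f L"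
  by (simp_all add: mprod_def)

lemma mprod_carrier:
  assumes "\<And>i. i \<in> set L \<Longrightarrow> f i \<in> ops n"
  shows "mprod n f L \<in> ops n"
  using assms by (induction L) (auto simp: mprod_Cons )

lemma mprod_majorana_carrier:
  "set L \<subseteq> {..<2 * n} \<Longrightarrow> mprod n (majorana n) L \<in> ops n"
  by (intro mprod_carrier) auto

lemma set_sorted_subset: "I \<subseteq> {..<k::nat} \<Longrightarrow> set (sorted_list_of_set I) = I"
  by (rule set_sorted_list_of_set, rule finite_subset[OF _ finite_lessThan])

lemma gam_carrier [simp]: "I \<subseteq> {..<2 * n} \<Longrightarrow> gam n I \<in> ops n"
  by (intro mprod_majorana_carrier) (simp add: set_sorted_subset)

lemma gam_rot_carrier [simp]: "gam_rot n R I \<in> ops n"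
  by (intro mprod_carrier) simp

lemma mprod_snoc:
  assumes "set L \<subseteq> {..<2 * n}" "k < 2 * n"
  shows "mprod n (majorana n) (L @ [k]) = mprod n (majorana n) L * majorana n k"
  using assms
proof (induction L)
  case (Cons i L)
  then show ?case
    using mprod_majorana_carrier[of L n]
    by (simp add: mprod_Cons sq_ring[where d = "2^n"])
qed (use majorana_carrier[of k n] in \<open>simp add: mprod_Cons\<close>)

lemma sorted_list_of_set_insert_greater:
  assumes "I \<subseteq> {..<k::nat}"
  shows "sorted_list_of_set (insert k I) = sorted_list_of_set I @ [k]"
proof -
  have fin: "finite I" using assms finite_subset by auto
  have "sorted_list_of_set (set (sorted_list_of_set I @ [k])) = sorted_list_of_set I @ [k]"
    by (rule sorted_list_of_set.idem_if_sorted_distinct)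
      (use fin assms in \<open>auto simp: sorted_append less_imp_le\<close>)
  moreover have "set (sorted_list_of_set I @ [k]) = insert k I"
    using fin by simp
  ultimately show ?thesis by (simp only:)
qed

lemma gam_insert:
  assumes "I \<subseteq> {..<k}" "k < 2 * n"
  shows "gam n (insert k I) = gam n I * majorana n k"
  using assms
  by (simp add: sorted_list_of_set_insert_greater)
     (intro mprod_snoc, auto simp: set_sorted_subset)

lemma majorana_mprod:
  assumes "i < 2 * n" "set L \<subseteq> {..<2 * n}"
  shows "majorana n i * mprod n (majorana n) L =
    (- 1) ^ length (filter (\<lambda>j. j \<noteq> i) L) \<cdot>\<^sub>m (mprod n (majorana n) L * majorana n i)"
  using assms
proof (induction L)
  case Nil
  then show ?case using majorana_carrier[of i n] by simp
next
  case (Cons j L)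
  define d :: nat where "d = 2 ^ n"
  note simps = sq_ring[where d = d]
  let ?M = "mprod n (majorana n) L"
  have c: "majorana n i \<in> carrier_mat d d" "majorana n j \<in> carrier_mat d d" "?M \<in> carrier_mat d d"
    using Cons.prems mprod_majorana_carrier[of L n] by (simp_all add: d_def)
  have "majorana n i * majorana n j = (if j = i then 1 else - 1) \<cdot>\<^sub>m (majorana n j * majorana n i)"
    using majorana_anticommute[of i n j] Cons.prems by auto
  then have "majorana n i * (majorana n j * ?M) =
      (if j = i then 1 else - 1) \<cdot>\<^sub>m (majorana n j * (majorana n i * ?M))"
    by (rule mult_rewrite_left[OF _ c(1,2) c(2,1) c(3)])
  then show ?case
    using Cons c by (simp add: mprod_Cons simps)
qed

lemma conj_mprod:
  assumes U: "is_matchgate_unitary n R U" and "set L \<subseteq> {..<2 * n}"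
  shows "U * mprod n (majorana n) L * adj U = mprod n (rot n R) L"
  using assms(2)
proof (induction L)
  case Nil
  then show ?case
    using U by (simp add: is_matchgate_unitary_iff right_mult_one_mat[of _ "2 ^ n" "2 ^ n"])
next
  case (Cons j L)
  define d :: nat where "d = 2 ^ n"
  note simps = sq_ring[where d = d]
  let ?M = "mprod n (majorana n) L"
  have U': "U \<in> carrier_mat d d" "U * adj U = 1\<^sub>m d" "U * majorana n j * adj U = rot n R j"
    using U Cons.prems by (auto simp: is_matchgate_unitary_iff d_def)
  have c: "majorana n j \<in> carrier_mat d d" "?M \<in> carrier_mat d d" "adj U \<in> carrier_mat d d"
    using Cons.prems mprod_majorana_carrier[of L n] U' by (simp_all add: d_def)
  have "adj U * U = 1\<^sub>m d" by (rule mult_one_comm[OF U'(1) c(3) U'(2)])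
  then have "U * (majorana n j * ?M) * adj U =
      U * (majorana n j * ((adj U * U) * (?M * adj U)))"
    using U'(1) c by (simp add: simps)
  also have "\<dots> = (U * majorana n j * adj U) * (U * ?M * adj U)"
    using U'(1) c by (simp only: simps)
  finally show ?case
    using Cons U' by (simp add: mprod_Cons)
qed

lemma conj_gam:
  "is_matchgate_unitary n R U \<Longrightarrow> I \<subseteq> {..<2 * n} \<Longrightarrow> U * gam n I * adj U = gam_rot n R I"
  by (rule conj_mprod) (auto simp: set_sorted_subset)

lemma gam_unitary:
  assumes "I \<subseteq> {..<2 * n}"
  shows "adj (gam n I) * gam n I = 1\<^sub>m (2 ^ n)"
proof -
  define d :: nat where "d = 2 ^ n"
  note simps = sq_ring[where d = d]
  have "adj (mprod n (majorana n) L) * mprod n (majorana n) L = 1\<^sub>m d"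
    if "set L \<subseteq> {..<2 * n}" for L
    using that
  proof (induction L)
    case (Cons j L)
    let ?M = "mprod n (majorana n) L"
    have c: "majorana n j \<in> carrier_mat d d" "?M \<in> carrier_mat d d" "adj ?M \<in> carrier_mat d d"
      using Cons.prems mprod_majorana_carrier[of L n] by (simp_all add: d_def)
    have "majorana n j * (majorana n j * ?M) = ?M"
      by (rule mult_cancel_left[OF _ c(1,1,2)]) (use Cons.prems d_def in simp)
    then show ?case
      using c Cons by (simp add: mprod_Cons adjoint_mult[of _ d] simps)
  qed (simp add: d_def)
  then show ?thesis using set_sorted_subset[OF assms] assms by (simp add: d_def)
qed

subsection \<open>Completeness of the monomials\<close>

text \<open>The unnormalized average over conjugations by monomials. The cut-off \<open>k\<close>
  allows adding one generator at a time.\<close>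

definition twirl :: "nat \<Rightarrow> nat \<Rightarrow> complex mat \<Rightarrow> complex mat" where
  "twirl n k X = msum (2 ^ n) (\<lambda>I. gam n I * X * adj (gam n I)) (Pow {..<k})"

lemma twirl_carrier [simp]: "twirl n k X \<in> ops n"
  by (simp add: twirl_def)

lemma twirl_Suc:
  assumes "k < 2 * n" "X \<in> ops n"
  shows "twirl n (Suc k) X = twirl n k (X + majorana n k * X * majorana n k)"
proof (rule eq_matI'[of _ "2 ^ n"])
  fix x y :: nat assume xy: "x < 2 ^ n" "y < 2 ^ n"
  define d :: nat where "d = 2 ^ n"
  note simps = sq_ring[where d = d]
    mult_add_distrib_mat[of _ d d _ d] add_mult_distrib_mat[of _ d d _ _ d]
  let ?m = "majorana n k"
  let ?f = "\<lambda>X I. (gam n I * X * adj (gam n I)) $$ (x, y)"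
  have Pow: "Pow {..<Suc k} = Pow {..<k} \<union> insert k ` Pow {..<k}"
    by (simp add: lessThan_Suc Pow_insert)
  have inj: "inj_on (insert k) (Pow {..<k})"
    by (rule inj_onI) (metis Diff_insert_absorb PowD lessThan_iff less_irrefl subsetD)
  have "twirl n (Suc k) X $$ (x, y) = sum (?f X) (Pow {..<k}) + sum (?f X) (insert k ` Pow {..<k})"
    unfolding twirl_def using xy by (simp only: msum_entry Pow) (intro sum.union_disjoint, auto)
  also have "sum (?f X) (insert k ` Pow {..<k}) = (\<Sum>I\<in>Pow {..<k}. ?f X (insert k I))"
    by (simp add: sum.reindex[OF inj])
  also have "sum (?f X) (Pow {..<k}) + (\<Sum>I\<in>Pow {..<k}. ?f X (insert k I)) =
      (\<Sum>I\<in>Pow {..<k}. ?f (X + ?m * X * ?m) I)"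
    unfolding sum.distrib[symmetric]
  proof (rule sum.cong[OF refl])
    fix I assume "I \<in> Pow {..<k}"
    then have I: "I \<subseteq> {..<k}" by simp
    then have "I \<subseteq> {..<2 * n}" using assms by auto
    then have c: "gam n I \<in> carrier_mat d d" "adj (gam n I) \<in> carrier_mat d d"
      "?m \<in> carrier_mat d d" "X \<in> carrier_mat d d"
      using assms by (simp_all add: d_def)
    have "gam n I * (X + ?m * X * ?m) * adj (gam n I) =
        gam n I * X * adj (gam n I) +
        gam n (insert k I) * X * adj (gam n (insert k I))"
      using c assms(1) gam_insert[OF I assms(1)] by (simp add: simps adjoint_mult[of _ d])
    then show "?f X I + ?f X (insert k I) = ?f (X + ?m * X * ?m) I"
      using c xy gam_insert[OF I assms(1)]
      by (simp add: d_def)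
  qed
  finally show "twirl n (Suc k) X $$ (x, y) = twirl n k (X + ?m * X * ?m) $$ (x, y)"
    using xy by (simp add: twirl_def)
qed auto

text \<open>By \<open>twirl_Suc\<close> the last generator is averaged first, and the result
  \<open>Z\<close> commutes with it. Each monomial commutes or anticommutes with that generator, and
  the sign appears twice, from the monomial and from its adjoint. Earlier generators are covered by
  induction applied to \<open>Z\<close>.\<close>

lemma twirl_commute:
  assumes "k \<le> 2 * n" "j < k" "X \<in> ops n"
  shows "twirl n k X * majorana n j = majorana n j * twirl n k X"
  using assms
proof (induction k arbitrary: X)
  case (Suc k)
  define d :: nat where "d = 2 ^ n"
  note simps = sq_ring[where d = d]
    mult_add_distrib_mat[of _ d d _ d] add_mult_distrib_mat[of _ d d _ _ d]
  let ?m = "majorana n k"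
  define Z where "Z = X + ?m * X * ?m"
  have k: "k < 2 * n" using Suc.prems by simp
  have c: "X \<in> carrier_mat d d" "?m \<in> carrier_mat d d"
    using Suc.prems k by (simp_all add: d_def)
  then have mXm: "?m * (X * ?m) \<in> carrier_mat d d" "?m * X \<in> carrier_mat d d" "X * ?m \<in> carrier_mat d d"
    by (simp_all add: simps)
  have Z: "Z \<in> carrier_mat d d" using c mXm by (simp add: Z_def simps)
  have mm: "?m * (?m * Y) = Y" if "Y \<in> carrier_mat d d" for Y
    by (rule mult_cancel_left[OF _ c(2,2) that]) (use k d_def in simp)
  have mZ: "?m * Z = Z * ?m"
    using c mXm k mm[of "X * ?m"]
    by (simp add: Z_def simps d_def[symmetric] comm_add_mat[of _ d d])
  show ?case
  proof (cases "j = k")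
    case False
    then show ?thesis
      using Suc Z k by (simp add: twirl_Suc Z_def[symmetric] d_def)
  next
    case True
    have "(gam n I * Z * adj (gam n I)) * ?m = ?m * (gam n I * Z * adj (gam n I))"
      if "I \<in> Pow {..<k}" for I
    proof -
      have I: "I \<subseteq> {..<2 * n}" using that k by auto
      have gc: "gam n I \<in> carrier_mat d d" "adj (gam n I) \<in> carrier_mat d d"
        using I by (simp_all add: d_def)
      define s :: complex where "s = (- 1) ^ length (filter (\<lambda>j. j \<noteq> k) (sorted_list_of_set I))"
      have s: "s * s = 1" "cnj s = s"
        by (simp_all add: s_def flip: power_mult_distrib)
      have 1: "?m * gam n I = s \<cdot>\<^sub>m (gam n I * ?m)"
        unfolding s_def by (rule majorana_mprod) (use k I set_sorted_subset in auto)
      have "adj (gam n I) * ?m = s \<cdot>\<^sub>m (?m * adj (gam n I))"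
        using arg_cong[OF 1, of adj] gc c k s
        by (simp add: adjoint_mult[of _ d] adjoint_smult[of _ d] simps)
      then have "(gam n I * Z * adj (gam n I)) * ?m =
          s \<cdot>\<^sub>m (gam n I * (Z * (?m * adj (gam n I))))"
        using gc c Z by (simp add: simps)
      also have "Z * (?m * adj (gam n I)) = 1 \<cdot>\<^sub>m (?m * (Z * adj (gam n I)))"
        using gc c Z mZ by (intro mult_rewrite_left[of _ _ _ _ _ d]) auto
      also have "s \<cdot>\<^sub>m (gam n I * (1 \<cdot>\<^sub>m (?m * (Z * adj (gam n I))))) =
          ?m * (gam n I * (Z * adj (gam n I)))"
        using mult_rewrite_left[OF 1, of d "Z * adj (gam n I)"] gc c Z by (simp add: simps)
      finally show ?thesis using gc c Z by (simp add: simps)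
    qed
    moreover have "gam n I * Z * adj (gam n I) \<in> carrier_mat d d" if "I \<in> Pow {..<k}" for I
    proof -
      have "I \<subseteq> {..<2 * n}" using that k by auto
      then show ?thesis using Z by (simp add: simps d_def)
    qed
    moreover have "twirl n (Suc k) X = msum d (\<lambda>I. gam n I * Z * adj (gam n I)) (Pow {..<k})"
      using twirl_Suc[OF k, of X] c by (simp add: Z_def twirl_def d_def)
    ultimately show ?thesis
      using c True by (simp add: msum_mult mult_msum del: Pow_iff cong: msum_cong)
  qed
qed auto

text \<open>Commuting with all generators forces a scalar, and the trace determines it: each of the
  \<open>4 ^ n\<close> conjugations preserves the trace of \<open>X\<close>, while the identity has
  trace \<open>2 ^ n\<close>.\<close>

lemma twirl_full:
  assumes X: "X \<in> ops n"
  shows "twirl n (2 * n) X = (2 ^ n * (\<Sum>x<2 ^ n. X $$ (x, x))) \<cdot>\<^sub>m 1\<^sub>m (2 ^ n)"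
proof -
  define d :: nat where "d = 2 ^ n"
  have "twirl n (2 * n) X = twirl n (2 * n) X $$ (0, 0) \<cdot>\<^sub>m 1\<^sub>m (2 ^ n)"
    by (rule majorana_commutant_scalar) (use twirl_commute X in auto)
  then obtain c where c: "twirl n (2 * n) X = c \<cdot>\<^sub>m 1\<^sub>m (2 ^ n)" by blast
  have tr: "(\<Sum>x<d. (gam n I * X * adj (gam n I)) $$ (x, x)) = (\<Sum>x<d. X $$ (x, x))"
    if I: "I \<subseteq> {..<2 * n}" for I
  proof -
    have c: "gam n I \<in> carrier_mat d d" "adj (gam n I) \<in> carrier_mat d d" "X \<in> carrier_mat d d"
      "gam n I * X \<in> carrier_mat d d"
      using I X by (simp_all add: d_def)
    have "(\<Sum>x<d. (gam n I * X * adj (gam n I)) $$ (x, x)) =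
        (\<Sum>x<d. \<Sum>y<d. (gam n I * X) $$ (x, y) * adj (gam n I) $$ (y, x))"
      using c by (intro sum.cong mult_entry) auto
    also have "\<dots> = (\<Sum>y<d. \<Sum>x<d. adj (gam n I) $$ (y, x) * (gam n I * X) $$ (x, y))"
      by (subst sum.swap) (simp add: mult.commute)
    also have "\<dots> = (\<Sum>y<d. (adj (gam n I) * (gam n I * X)) $$ (y, y))"
      using c by (intro sum.cong mult_entry[symmetric]) auto
    also have "adj (gam n I) * (gam n I * X) = X"
      by (rule mult_cancel_left[OF _ c(2,1,3)]) (simp add: gam_unitary[OF I] d_def)
    finally show ?thesis .
  qed
  have "(\<Sum>x<d. twirl n (2 * n) X $$ (x, x)) =
      (\<Sum>I\<in>Pow {..<2 * n}. \<Sum>x<d. (gam n I * X * adj (gam n I)) $$ (x, x))"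
    unfolding twirl_def by (subst sum.swap) (simp add: d_def)
  also have "\<dots> = 2 ^ (2 * n) * (\<Sum>x<d. X $$ (x, x))"
    using tr by (simp add: card_Pow)
  also have "(\<Sum>x<d. twirl n (2 * n) X $$ (x, x)) = of_nat d * c"
    by (simp add: c d_def)
  finally have "2 ^ n * c = 2 ^ n * (2 ^ n * (\<Sum>x<d. X $$ (x, x)))"
    by (simp add: d_def mult_2 power_add)
  then show ?thesis by (simp add: d_def c)
qed

abbreviation sq :: "nat \<Rightarrow> (nat \<times> nat) set" where
  "sq n \<equiv> {..<2 ^ n} \<times> {..<2 ^ n}"

definition unit_mat :: "nat \<Rightarrow> nat \<Rightarrow> nat \<Rightarrow> complex mat" where
  "unit_mat n y z = Matrix.mat (2 ^ n) (2 ^ n) (\<lambda>(a, b). if a = y \<and> b = z then 1 else 0)"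

lemma unit_mat_carrier [simp]: "unit_mat n y z \<in> ops n"
  by (simp add: unit_mat_def)

text \<open>Lets products of an amplitude with a conjugate amplitude be read as entries of a
  conjugated operator, which do not depend on the phase of \<open>U\<close>.\<close>

lemma conj_unit_mat_entry:
  assumes U: "U \<in> ops n" and "x < 2 ^ n" "w < 2 ^ n" "y < 2 ^ n" "z < 2 ^ n"
  shows "(U * unit_mat n y z * adj U) $$ (x, w) = U $$ (x, y) * cnj (U $$ (w, z))"
proof -
  have UE: "(U * unit_mat n y z) $$ (x, b) = (if b = z then U $$ (x, y) else 0)" if "b < 2 ^ n" for b
  proof -
    have "(U * unit_mat n y z) $$ (x, b) = (\<Sum>a<2 ^ n. U $$ (x, a) * unit_mat n y z $$ (a, b))"
      using assms that by (intro mult_entry) auto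
    also have "\<dots> = (\<Sum>a<2 ^ n. if a = y then (if b = z then U $$ (x, y) else 0) else 0)"
      using that by (intro sum.cong) (auto simp: unit_mat_def)
    finally show ?thesis using assms by simp
  qed
  have "(U * unit_mat n y z * adj U) $$ (x, w) =
      (\<Sum>b<2 ^ n. (U * unit_mat n y z) $$ (x, b) * adj U $$ (b, w))"
    using assms by (intro mult_entry) auto
  also have "\<dots> = (\<Sum>b<2 ^ n. if b = z then U $$ (x, y) * cnj (U $$ (w, z)) else 0)"
    using assms by (intro sum.cong) (auto simp: UE adjoint_entry[of _ "2^n"])
  finally show ?thesis using assms by simp
qed

text \<open>Twirling the matrix unit of \<open>y\<close> and \<open>y'\<close> produces this sum as
  its entry \<open>(x, x')\<close>, and \<open>twirl_full\<close> evaluates it by the trace of the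
  matrix unit.\<close>

lemma gam_complete:
  assumes "p \<in> sq n" "q \<in> sq n"
  shows "(\<Sum>I\<in>Pow {..<2 * n}. gam n I $$ p * cnj (gam n I $$ q)) = (if p = q then 2 ^ n else 0)"
proof -
  obtain x y x' y' where pq: "p = (x, y)" "q = (x', y')" by fastforce
  have xy: "x < 2 ^ n" "y < 2 ^ n" "x' < 2 ^ n" "y' < 2 ^ n" using assms pq by auto
  let ?X = "unit_mat n y y'"
  have "(\<Sum>I\<in>Pow {..<2 * n}. gam n I $$ p * cnj (gam n I $$ q)) = twirl n (2 * n) ?X $$ (x, x')"
    using xy by (simp add: twirl_def conj_unit_mat_entry pq)
  also have "\<dots> = (if x = x' then 2 ^ n * (\<Sum>a<2 ^ n. ?X $$ (a, a)) else 0)"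
    using xy by (simp add: twirl_full)
  also have "(\<Sum>a<2 ^ n. ?X $$ (a, a)) = (\<Sum>a<2 ^ n. if a = y then (if y = y' then 1 else 0) else 0)"
    by (intro sum.cong) (auto simp: unit_mat_def)
  finally show ?thesis using xy pq by auto
qed

subsection \<open>Hilbert--Schmidt pairing\<close>

text \<open>Equals the trace of \<open>adj A * B\<close>.\<close>

definition hs :: "nat \<Rightarrow> complex mat \<Rightarrow> complex mat \<Rightarrow> complex" where
  "hs n A B = (\<Sum>p\<in>sq n. cnj (A $$ p) * B $$ p)"

lemma hs_cnj: "cnj (hs n A B) = hs n B A"
  by (simp add: hs_def mult.commute)

lemma hs_smult_right: "B \<in> ops n \<Longrightarrow> hs n A (c \<cdot>\<^sub>m B) = c * hs n A B"
  unfolding hs_def sum_distrib_left by (intro sum.cong) auto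

lemma hs_smult_left: "A \<in> ops n \<Longrightarrow> hs n (c \<cdot>\<^sub>m A) B = cnj c * hs n A B"
  unfolding hs_def sum_distrib_left by (intro sum.cong) auto

lemma hs_msum_right: "hs n A (msum (2 ^ n) f I) = (\<Sum>i\<in>I. hs n A (f i))"
  unfolding hs_def by (subst sum.swap) (auto simp: sum_distrib_left intro!: sum.cong)

lemma hs_msum_left: "hs n (msum (2 ^ n) f I) B = (\<Sum>i\<in>I. hs n (f i) B)"
  by (metis (no_types, lifting) cnj_sum hs_cnj hs_msum_right sum.cong)

lemma hs_pairs: "hs n A B = (\<Sum>x<2 ^ n. \<Sum>y<2 ^ n. cnj (A $$ (x, y)) * B $$ (x, y))"
  by (simp add: hs_def sum.cartesian_product case_prod_beta)

lemma hs_mult_left: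
  assumes "A \<in> ops n" "B \<in> ops n"
    "X \<in> ops n"
  shows "hs n A (X * B) = hs n (adj X * A) B"
proof -
  have "hs n A (X * B) =
      (\<Sum>x<2 ^ n. \<Sum>y<2 ^ n. \<Sum>z<2 ^ n. cnj (A $$ (x, y)) * (X $$ (x, z) * B $$ (z, y)))"
    unfolding hs_pairs sum_distrib_left[symmetric]
    using assms by (intro sum.cong refl arg_cong2[of _ _ _ _ "(*)"] mult_entry) auto
  also have "\<dots> = (\<Sum>z<2 ^ n. \<Sum>y<2 ^ n. \<Sum>x<2 ^ n. cnj (A $$ (x, y)) * (X $$ (x, z) * B $$ (z, y)))"
    by (subst (2) sum.swap, subst sum.swap, subst (2) sum.swap) (rule refl)
  also have "\<dots> = (\<Sum>z<2 ^ n. \<Sum>y<2 ^ n. cnj ((adj X * A) $$ (z, y)) * B $$ (z, y))"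
  proof (intro sum.cong refl)
    fix z y :: nat assume zy: "z \<in> {..<2 ^ n}" "y \<in> {..<2 ^ n}"
    have "(adj X * A) $$ (z, y) = (\<Sum>x<2 ^ n. adj X $$ (z, x) * A $$ (x, y))"
      using assms zy by (intro mult_entry) auto
    then show "(\<Sum>x<2 ^ n. cnj (A $$ (x, y)) * (X $$ (x, z) * B $$ (z, y))) =
        cnj ((adj X * A) $$ (z, y)) * B $$ (z, y)"
      using assms zy by (simp add: adjoint_entry[of _ "2^n"] sum_distrib_left sum_distrib_right mult_ac)
  qed
  finally show ?thesis by (simp add: hs_pairs)
qed

lemma hs_adjoint:
  assumes "A \<in> ops n" "B \<in> ops n"
  shows "hs n A B = hs n (adj B) (adj A)"
  unfolding hs_pairs
  by (subst sum.swap, intro sum.cong refl)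
     (use assms in \<open>auto simp: adjoint_entry[of _ "2^n"] mult.commute\<close>)

lemma hs_mult_right:
  assumes "A \<in> ops n" "B \<in> ops n"
    "X \<in> ops n"
  shows "hs n A (B * X) = hs n (A * adj X) B"
proof -
  have "hs n A (B * X) = hs n (adj X * adj B) (adj A)"
    using assms by (subst hs_adjoint) (auto simp: adjoint_mult[of _ "2^n"])
  also have "\<dots> = hs n (adj B) (X * adj A)"
    using assms by (subst hs_mult_left) auto
  also have "\<dots> = hs n (A * adj X) B"
    using assms by (subst hs_adjoint) (auto simp: adjoint_mult[of _ "2^n"])
  finally show ?thesis .
qed

lemma hs_sandwich:
  assumes "A \<in> ops n" "B \<in> ops n"
    "X \<in> ops n" "Z \<in> ops n"
  shows "hs n A (X * B * Z) = hs n (adj X * A * adj Z) B"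
  using assms hs_mult_right[of A n "X * B" Z] hs_mult_left[of "A * adj Z" n B X]
  by (simp add: sq_ring[where d = "2^n"])

lemma gam_expand:
  assumes Y: "Y \<in> ops n"
  shows "Y = msum (2 ^ n) (\<lambda>I. (hs n (gam n I) Y / 2 ^ n) \<cdot>\<^sub>m gam n I) (Pow {..<2 * n})"
proof (rule eq_matI'[of _ "2 ^ n"])
  fix x y :: nat assume xy: "x < 2 ^ n" "y < 2 ^ n"
  define p where "p = (x, y)"
  have p: "p \<in> sq n" using xy by (simp add: p_def)
  have "msum (2 ^ n) (\<lambda>I. (hs n (gam n I) Y / 2 ^ n) \<cdot>\<^sub>m gam n I) (Pow {..<2 * n}) $$ (x, y) =
      (\<Sum>I\<in>Pow {..<2 * n}. hs n (gam n I) Y * gam n I $$ p) / 2 ^ n"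
    unfolding sum_divide_distrib p_def using xy
    by (auto intro!: sum.cong simp: smult_entry[OF gam_carrier])
  also have "(\<Sum>I\<in>Pow {..<2 * n}. hs n (gam n I) Y * gam n I $$ p) =
      (\<Sum>q\<in>sq n. Y $$ q * (\<Sum>I\<in>Pow {..<2 * n}. gam n I $$ p * cnj (gam n I $$ q)))"
    unfolding hs_def sum_distrib_right sum_distrib_left by (subst sum.swap) (simp add: mult_ac)
  also have "\<dots> = (\<Sum>q\<in>sq n. if p = q then 2 ^ n * Y $$ p else 0)"
    using p by (intro sum.cong refl, subst gam_complete) auto
  also have "\<dots> = 2 ^ n * Y $$ p"
    by (subst sum.delta') (use p in auto)
  finally show "Y $$ (x, y) =
      msum (2 ^ n) (\<lambda>I. (hs n (gam n I) Y / 2 ^ n) \<cdot>\<^sub>m gam n I) (Pow {..<2 * n}) $$ (x, y)"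
    by (simp add: p_def)
qed (use Y in auto)

lemma hs_expand:
  assumes "B \<in> ops n"
  shows "(\<Sum>I\<in>Pow {..<2 * n}. hs n A (gam n I) * hs n (gam n I) B) = 2 ^ n * hs n A B"
  by (subst (2) gam_expand[OF assms])
    (simp add: hs_msum_right hs_smult_right mult.commute flip: sum_divide_distrib)

subsection \<open>The grading is preserved by matchgates\<close>

text \<open>
  Conjugation by a matchgate unitary commutes with the superoperator below, because \<open>R\<close> has
  orthonormal columns, and the monomials of different degrees are eigenvectors of it with different
  eigenvalues.
\<close>

definition maj_sum :: "nat \<Rightarrow> complex mat \<Rightarrow> complex mat" where
  "maj_sum n Y = msum (2 ^ n) (\<lambda>i. majorana n i * Y * majorana n i) {..<2 * n}"

lemma maj_sum_conj:
  assumes U: "is_matchgate_unitary n R U" and R: "R \<in> orth_group (2 * n)"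
    and Y: "Y \<in> ops n"
  shows "maj_sum n (U * Y * adj U) = U * maj_sum n Y * adj U"
proof -
  define d :: nat where "d = 2 ^ n"
  note simps = sq_ring[where d = d]
  have U': "U \<in> carrier_mat d d" "U * adj U = 1\<^sub>m d"
    "\<And>j. j < 2 * n \<Longrightarrow> U * majorana n j * adj U = rot n R j"
    using U by (auto simp: is_matchgate_unitary_iff d_def)
  have c: "Y \<in> carrier_mat d d" "adj U \<in> carrier_mat d d"
    "\<And>j. j < 2 * n \<Longrightarrow> majorana n j \<in> carrier_mat d d"
    using Y U' by (simp_all add: d_def)
  have UU: "adj U * U = 1\<^sub>m d" by (rule mult_one_comm[OF U'(1) c(2) U'(2)])
  have cancel: "adj U * (U * X) = X" if "X \<in> carrier_mat d d" for X
    by (rule mult_cancel_left[OF UU c(2) U'(1) that])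
  define Y' where "Y' = U * Y * adj U"
  have Y': "Y' \<in> carrier_mat d d" using U'(1) c by (simp add: Y'_def)
  have conj_term: "U * (majorana n i * Y * majorana n i) * adj U = rot n R i * Y' * rot n R i"
    if "i < 2 * n" for i
    unfolding U'(3)[OF that, symmetric] Y'_def
    using U'(1) c(1,2) c(3)[OF that] by (simp add: simps cancel)
  have "U * maj_sum n Y * adj U = msum d (\<lambda>i. rot n R i * Y' * rot n R i) {..<2 * n}"
    unfolding maj_sum_def d_def[symmetric] using U'(1) c conj_term
    by (subst mult_msum, simp, simp, subst msum_mult) (auto intro!: msum_cong)
  also have "\<dots> = maj_sum n Y'"
  proof (rule eq_matI'[of _ d])
    fix x y assume xy: "x < d" "y < d"
    have "msum d (\<lambda>i. rot n R i * Y' * rot n R i) {..<2 * n} $$ (x, y) =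
      (\<Sum>i<2 * n. \<Sum>a<2 * n. \<Sum>b<2 * n. complex_of_real (R $$ (i, a) * R $$ (i, b)) *
       (majorana n a * Y' * majorana n b) $$ (x, y))"
      using xy Y' by (simp add: d_def rot_sandwich_entry)
    also have "\<dots> = (\<Sum>a<2 * n. \<Sum>b<2 * n. \<Sum>i<2 * n. complex_of_real (R $$ (i, a) * R $$ (i, b)) *
       (majorana n a * Y' * majorana n b) $$ (x, y))"
      by (subst sum.swap, subst (2) sum.swap) (rule refl)
    also have "\<dots> = (\<Sum>a<2 * n. \<Sum>b<2 * n. if a = b then (majorana n a * Y' * majorana n a) $$ (x, y) else 0)"
    proof (intro sum.cong refl)
      fix a b assume "a \<in> {..<2 * n}" "b \<in> {..<2 * n}"
      then show "(\<Sum>i<2 * n. complex_of_real (R $$ (i, a) * R $$ (i, b)) *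
         (majorana n a * Y' * majorana n b) $$ (x, y)) =
         (if a = b then (majorana n a * Y' * majorana n a) $$ (x, y) else 0)"
        unfolding sum_distrib_right[symmetric] of_real_sum[symmetric]
        using orth_group_cols[OF R, of a b] by simp
    qed
    also have "\<dots> = maj_sum n Y' $$ (x, y)"
      using xy by (simp add: maj_sum_def d_def)
    finally show "msum d (\<lambda>i. rot n R i * Y' * rot n R i) {..<2 * n} $$ (x, y) = maj_sum n Y' $$ (x, y)" .
  qed (simp_all add: maj_sum_def d_def)
  finally show ?thesis by (simp add: Y'_def)
qed

text \<open>For a monomial of degree \<open>j\<close>, each of the \<open>2 * n - j\<close> absent
  generators contributes the sign \<open>(- 1) ^ j\<close> and each of the \<open>j\<close> present
  ones the opposite sign.\<close>

definition grade_eig :: "nat \<Rightarrow> nat \<Rightarrow> real" where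
  "grade_eig n j = (- 1) ^ j * (2 * real n - 2 * real j)"

text \<open>Within one parity the value is linear in the degree. Across parities, equality would
  mean \<open>j + k = 2 * n\<close>, which makes the parities agree after all.\<close>

lemma grade_eig_inj:
  assumes "grade_eig n j = grade_eig n k"
  shows "j = k"
proof (cases "even j = even k")
  case True
  then show ?thesis using assms by (cases "even k") (auto simp: grade_eig_def)
next
  case False
  then have "real j + real k = 2 * real n"
    using assms by (cases "even k") (auto simp: grade_eig_def)
  then have "j + k = 2 * n" by linarith
  then have "even (j + k)" by simp
  then show ?thesis using False by simp
qed

lemma maj_sum_gam:
  assumes I: "I \<subseteq> {..<2 * n}"
  shows "maj_sum n (gam n I) = complex_of_real (grade_eig n (card I)) \<cdot>\<^sub>m gam n I"
proof -
  define d :: nat where "d = 2 ^ n"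
  note simps = sq_ring[where d = d]
  define s :: "nat \<Rightarrow> complex" where "s i = (if i \<in> I then - ((- 1) ^ card I) else (- 1) ^ card I)" for i
  have fin: "finite I" using I by (rule finite_subset) simp
  have g: "gam n I \<in> carrier_mat d d" using I by (simp add: d_def)
  have "majorana n i * gam n I * majorana n i = s i \<cdot>\<^sub>m gam n I" if i: "i < 2 * n" for i
  proof -
    have m: "majorana n i \<in> carrier_mat d d" "majorana n i * majorana n i = 1\<^sub>m d"
      using i by (simp_all add: d_def)
    have "{x. x \<noteq> i} \<inter> I = I - {i}" by auto
    then have len: "length (filter (\<lambda>j. j \<noteq> i) (sorted_list_of_set I)) = card (I - {i})"
      using fin by (simp add: distinct_length_filter)
    have "(- 1 :: complex) ^ length (filter (\<lambda>j. j \<noteq> i) (sorted_list_of_set I)) = s i"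
    proof (cases "i \<in> I")
      case True
      then have "card I = Suc (card (I - {i}))" using fin by (simp only: card_Suc_Diff1)
      then show ?thesis
        using True unfolding s_def len by (simp only: if_True power_Suc) simp
    qed (simp add: s_def len)
    then have "majorana n i * gam n I = s i \<cdot>\<^sub>m (gam n I * majorana n i)"
      using majorana_mprod[OF i, of "sorted_list_of_set I"] I set_sorted_subset[OF I] by simp
    then show ?thesis using g m by (simp add: simps)
  qed
  then have eq: "maj_sum n (gam n I) = msum d (\<lambda>i. s i \<cdot>\<^sub>m gam n I) {..<2 * n}"
    by (auto simp: maj_sum_def d_def intro!: msum_cong)
  have "(\<Sum>i<2 * n. s i) = - ((- 1) ^ card I) * of_nat (card I) + (- 1) ^ card I * of_nat (2 * n - card I)"
  proof -
    have "{..<2 * n} \<inter> {i. i \<in> I} = I" "{..<2 * n} \<inter> - {i. i \<in> I} = {..<2 * n} - I"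
      using I by auto
    moreover have "card ({..<2 * n} - I) = 2 * n - card I"
      using I fin by (simp add: card_Diff_subset)
    ultimately show ?thesis by (simp add: s_def sum.If_cases)
  qed
  also have "card I \<le> 2 * n" using I by (metis card_lessThan card_mono finite_lessThan)
  then have "- ((- 1) ^ card I) * of_nat (card I) + (- 1) ^ card I * of_nat (2 * n - card I) =
      complex_of_real (grade_eig n (card I))"
    by (simp add: grade_eig_def of_nat_diff algebra_simps)
  finally have s: "(\<Sum>i<2 * n. s i) = complex_of_real (grade_eig n (card I))" .
  show ?thesis
    unfolding eq using g
    by (intro eq_matI'[of _ d]) (auto simp: smult_entry[of _ d d] s[symmetric] sum_distrib_right)
qed

lemma hs_maj_sum:
  assumes "A \<in> ops n" "B \<in> ops n"
  shows "hs n A (maj_sum n B) = hs n (maj_sum n A) B"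
  unfolding maj_sum_def hs_msum_right hs_msum_left
proof (intro sum.cong refl)
  fix i assume "i \<in> {..<2 * n}"
  then have "majorana n i \<in> ops n" "adj (majorana n i) = majorana n i"
    by auto
  then show "hs n A (majorana n i * B * majorana n i) = hs n (majorana n i * A * majorana n i) B"
    using assms by (subst hs_sandwich) auto
qed

text \<open>A rotated monomial is a conjugated one, hence an eigenvector of \<open>maj_sum\<close>
  with the eigenvalue of its degree. The superoperator is self-adjoint, so eigenvectors with
  different eigenvalues are orthogonal.\<close>

lemma hs_gam_rot_grade:
  assumes R: "R \<in> orth_group (2 * n)" and I: "I \<subseteq> {..<2 * n}" and J: "J \<subseteq> {..<2 * n}"
    and ne: "card I \<noteq> card J"
  shows "hs n (gam n I) (gam_rot n R J) = 0"
proof -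
  obtain U where U: "is_matchgate_unitary n R U" using matchgate_unitary_exists[OF R] by blast
  let ?G = "gam_rot n R J"
  have Uc: "U \<in> ops n" using U by (simp add: is_matchgate_unitary_iff)
  have "maj_sum n ?G = complex_of_real (grade_eig n (card J)) \<cdot>\<^sub>m ?G"
    using maj_sum_conj[OF U R gam_carrier[OF J]] conj_gam[OF U J] Uc gam_carrier[OF J]
    by (simp add: maj_sum_gam[OF J] sq_ring[where d = "2^n"])
  then have "complex_of_real (grade_eig n (card J)) * hs n (gam n I) ?G =
      complex_of_real (grade_eig n (card I)) * hs n (gam n I) ?G"
    using hs_maj_sum[of "gam n I" n ?G] I
    by (simp add: maj_sum_gam hs_smult_right hs_smult_left)
  then show ?thesis using grade_eig_inj[of n "card J" "card I"] ne by auto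
qed

abbreviation gsets :: "nat \<Rightarrow> nat \<Rightarrow> nat set set" where
  "gsets n j \<equiv> {I. I \<subseteq> {..<2 * n} \<and> card I = j}"

text \<open>This is \<open>2 ^ n\<close> times the squared Hilbert-Schmidt norm of the degree
  \<open>j\<close> part of \<open>Y\<close>.\<close>

definition weight :: "nat \<Rightarrow> nat \<Rightarrow> complex mat \<Rightarrow> real" where
  "weight n j Y = (\<Sum>I\<in>gsets n j. (cmod (hs n Y (gam n I)))\<^sup>2)"

lemma weight_nonneg: "weight n j Y \<ge> 0"
  by (simp add: weight_def sum_nonneg)

lemma weight_ge:
  assumes "T \<subseteq> gsets n j"
  shows "weight n j Y \<ge> (\<Sum>I\<in>T. (cmod (hs n Y (gam n I)))\<^sup>2)"
  unfolding weight_def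
  by (rule sum_mono2) (use assms in \<open>auto intro: finite_subset[of _ "Pow {..<2 * n}"]\<close>)

lemma rot_one: "i < 2 * n \<Longrightarrow> rot n (1\<^sub>m (2 * n)) i = majorana n i"
proof (rule eq_matI'[of _ "2 ^ n"])
  fix x y :: nat assume i: "i < 2 * n" and xy: "x < 2 ^ n" "y < 2 ^ n"
  have "rot n (1\<^sub>m (2 * n)) i $$ (x, y) =
      (\<Sum>j<2 * n. (complex_of_real (1\<^sub>m (2 * n) $$ (i, j)) \<cdot>\<^sub>m majorana n j) $$ (x, y))"
    unfolding rot_def using xy by (rule msum_entry)
  also have "\<dots> = (\<Sum>j<2 * n. if j = i then majorana n i $$ (x, y) else 0)"
    using i xy by (intro sum.cong) auto
  finally show "rot n (1\<^sub>m (2 * n)) i $$ (x, y) = majorana n i $$ (x, y)" using i by simp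
qed auto

lemma mprod_cong: "(\<And>i. i \<in> set L \<Longrightarrow> f i = g i) \<Longrightarrow> mprod n f L = mprod n g L"
  by (induction L) (auto simp: mprod_Cons)

lemma gam_rot_one: "I \<subseteq> {..<2 * n} \<Longrightarrow> gam_rot n (1\<^sub>m (2 * n)) I = gam n I"
  by (intro mprod_cong rot_one) (auto simp: set_sorted_subset)

text \<open>An identity for each single \<open>R\<close>, not an average. Rotated monomials of
  degree \<open>j\<close> see only the degree \<open>j\<close> part \<open>Yj\<close> of
  \<open>Y\<close>, and Parseval's identity in the rotated basis gives
  \<open>2 ^ n * hs n Yj Yj\<close> whatever \<open>R\<close> is; comparison with the identity
  matrix finishes the proof.\<close>

lemma weight_rot:
  assumes R: "R \<in> orth_group (2 * n)" and Y: "Y \<in> ops n"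
  shows "(\<Sum>I\<in>gsets n j. (cmod (hs n Y (gam_rot n R I)))\<^sup>2) = weight n j Y"
proof -
  define Yj where "Yj = msum (2 ^ n) (\<lambda>I. (hs n (gam n I) Y / 2 ^ n) \<cdot>\<^sub>m gam n I) (gsets n j)"
  have Yj: "Yj \<in> ops n" by (simp add: Yj_def)
  have fin: "finite (gsets n j)" by (rule finite_subset[of _ "Pow {..<2 * n}"]) auto
  have key: "complex_of_real (\<Sum>I\<in>gsets n j. (cmod (hs n Y (gam_rot n R I)))\<^sup>2) = 2 ^ n * hs n Yj Yj"
    if R: "R \<in> orth_group (2 * n)" for R
  proof -
    obtain U where U: "is_matchgate_unitary n R U" using matchgate_unitary_exists[OF R] by blast
    have Uc: "U \<in> ops n" "U * adj U = 1\<^sub>m (2 ^ n)"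
      using U by (simp_all add: is_matchgate_unitary_iff)
    have hsYj: "hs n Yj (gam_rot n R J) = (if card J = j then hs n Y (gam_rot n R J) else 0)"
      if J: "J \<subseteq> {..<2 * n}" for J
    proof -
      have "hs n Yj (gam_rot n R J) =
          (\<Sum>I\<in>gsets n j. hs n Y (gam n I) * hs n (gam n I) (gam_rot n R J)) / 2 ^ n"
        unfolding Yj_def hs_msum_left sum_divide_distrib
        by (intro sum.cong refl) (simp add: hs_smult_left hs_cnj)
      \<comment> \<open>For \<open>card J = j\<close> the missing degrees contribute zero, so the
        sum may run over all monomials, where \<open>hs_expand\<close> applies; for other
        \<open>J\<close> every term is zero.\<close>
      also have "(\<Sum>I\<in>gsets n j. hs n Y (gam n I) * hs n (gam n I) (gam_rot n R J)) =
          (if card J = j then \<Sum>I\<in>Pow {..<2 * n}. hs n Y (gam n I) * hs n (gam n I) (gam_rot n R J) else 0)"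
      proof (cases "card J = j")
        case True
        have "(\<Sum>I\<in>gsets n j. hs n Y (gam n I) * hs n (gam n I) (gam_rot n R J)) =
          (\<Sum>I\<in>Pow {..<2 * n}. hs n Y (gam n I) * hs n (gam n I) (gam_rot n R J))"
        proof (intro sum.mono_neutral_left ballI)
          fix I assume "I \<in> Pow {..<2 * n} - gsets n j"
          then have "hs n (gam n I) (gam_rot n R J) = 0"
            using True by (intro hs_gam_rot_grade[OF R _ J]) auto
          then show "hs n Y (gam n I) * hs n (gam n I) (gam_rot n R J) = 0" by simp
        qed auto
        then show ?thesis using True by simp
      next
        case False
        then show ?thesis using hs_gam_rot_grade[OF R _ J] by (auto intro!: sum.neutral)
      qed
      finally show ?thesis by (simp add: hs_expand)
    qed
    \<comment> \<open>Pulling \<open>Yj\<close> back by \<open>U\<close> replaces rotated monomials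
      by ordinary ones without changing the norm.\<close>
    define Z where "Z = adj U * Yj * U"
    have Zc: "Z \<in> ops n" using Yj Uc by (simp add: Z_def)
    have hsZ: "hs n Yj (gam_rot n R J) = hs n Z (gam n J)" if "J \<subseteq> {..<2 * n}" for J
      unfolding conj_gam[OF U that, symmetric] Z_def
      using that Yj Uc by (subst hs_sandwich) auto
    have "U * Z * adj U = (U * adj U) * Yj * (U * adj U)"
      unfolding Z_def using Yj Uc(1) by (simp add: sq_ring[where d = "2^n"])
    then have "U * Z * adj U = Yj" using Yj Uc by simp
    then have hsZZ: "hs n Z Z = hs n Yj Yj"
      using hs_sandwich[of Z n Yj "adj U" U] Zc Yj Uc(1) by (simp add: Z_def[symmetric])
    have "complex_of_real (\<Sum>J\<in>gsets n j. (cmod (hs n Y (gam_rot n R J)))\<^sup>2) =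
        (\<Sum>J\<in>gsets n j. hs n Yj (gam_rot n R J) * cnj (hs n Yj (gam_rot n R J)))"
      unfolding of_real_sum complex_norm_square by (intro sum.cong refl) (simp add: hsYj)
    also have "\<dots> = (\<Sum>J\<in>Pow {..<2 * n}. hs n Yj (gam_rot n R J) * cnj (hs n Yj (gam_rot n R J)))"
      by (intro sum.mono_neutral_left) (auto simp: hsYj)
    also have "\<dots> = (\<Sum>J\<in>Pow {..<2 * n}. hs n Z (gam n J) * hs n (gam n J) Z)"
      by (intro sum.cong refl) (simp add: hsZ hs_cnj)
    also have "\<dots> = 2 ^ n * hs n Yj Yj" by (simp add: hs_expand[OF Zc] hsZZ)
    finally show ?thesis .
  qed
  have "1\<^sub>m (2 * n) \<in> orth_group (2 * n)" by (simp add: orth_group_def)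
  note key[OF this] key[OF R]
  then have "complex_of_real (\<Sum>I\<in>gsets n j. (cmod (hs n Y (gam_rot n R I)))\<^sup>2) =
    complex_of_real (\<Sum>I\<in>gsets n j. (cmod (hs n Y (gam_rot n (1\<^sub>m (2 * n)) I)))\<^sup>2)"
    by simp
  then have "(\<Sum>I\<in>gsets n j. (cmod (hs n Y (gam_rot n R I)))\<^sup>2) =
    (\<Sum>I\<in>gsets n j. (cmod (hs n Y (gam_rot n (1\<^sub>m (2 * n)) I)))\<^sup>2)"
    by (simp only: of_real_eq_iff)
  also have "\<dots> = weight n j Y"
    unfolding weight_def by (intro sum.cong refl) (simp add: gam_rot_one)
  finally show ?thesis .
qed

subsection \<open>Row permutations and row sign changes\<close>

lemma orth_group_permutation:
  assumes "\<And>i. i < N \<Longrightarrow> \<sigma> i < N" "inj_on \<sigma> {..<N}"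
  shows "Matrix.mat N N (\<lambda>(i, j). if j = \<sigma> i then 1 else 0) \<in> orth_group N" (is "?P \<in> _")
proof -
  have "?P * transpose_mat ?P = 1\<^sub>m N"
  proof (rule eq_matI'[of _ N])
    fix i j assume ij: "i < N" "j < N"
    have "(?P * transpose_mat ?P) $$ (i, j) = (\<Sum>k<N. ?P $$ (i, k) * transpose_mat ?P $$ (k, j))"
      using ij by (intro mult_entry) auto
    also have "\<dots> = (\<Sum>k<N. if k = \<sigma> i then (if \<sigma> i = \<sigma> j then 1 else 0) else 0)"
      using ij by (intro sum.cong) auto
    also have "\<dots> = 1\<^sub>m N $$ (i, j)"
      using ij assms by (auto dest: inj_onD)
    finally show "(?P * transpose_mat ?P) $$ (i, j) = 1\<^sub>m N $$ (i, j)" .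
  qed auto
  then show ?thesis by (simp add: orth_group_def)
qed

lemma rot_permutation:
  assumes R: "R \<in> carrier_mat (2 * n) (2 * n)" and \<sigma>: "\<And>i. i < 2 * n \<Longrightarrow> \<sigma> i < 2 * n" and i: "i < 2 * n"
  shows "rot n (Matrix.mat (2 * n) (2 * n) (\<lambda>(i, j). if j = \<sigma> i then 1 else 0) * R) i = rot n R (\<sigma> i)"
    (is "rot n (?P * R) i = _")
proof -
  have "(?P * R) $$ (i, j) = R $$ (\<sigma> i, j)" if "j < 2 * n" for j
  proof -
    have "(?P * R) $$ (i, j) = (\<Sum>k<2 * n. ?P $$ (i, k) * R $$ (k, j))"
      using R i that by (intro mult_entry) auto
    also have "\<dots> = (\<Sum>k<2 * n. if k = \<sigma> i then R $$ (\<sigma> i, j) else 0)"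
      using i by (intro sum.cong) auto
    finally show ?thesis using \<sigma>[OF i] by simp
  qed
  then show ?thesis unfolding rot_def by (auto intro!: msum_cong)
qed

lemma mprod_map: "mprod n f (map \<sigma> L) = mprod n (\<lambda>i. f (\<sigma> i)) L"
  by (simp add: mprod_def comp_def)

text \<open>The map sends the \<open>k\<close>-th smallest element of \<open>I\<close> to that of
  \<open>J\<close> and is an arbitrary bijection between the complements. Preserving the order on
  \<open>I\<close> means that no reordering sign arises when it is applied to an ordered
  monomial.\<close>

lemma extend_bijection:
  fixes N :: nat
  assumes I: "I \<subseteq> {..<N}" and J: "J \<subseteq> {..<N}" and card: "card I = card J"
  obtains \<sigma> where "\<And>i. i < N \<Longrightarrow> \<sigma> i < N" "inj_on \<sigma> {..<N}"
    "map \<sigma> (sorted_list_of_set I) = sorted_list_of_set J"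
proof -
  have fin: "finite I" "finite J"
    using I J by (auto intro: finite_subset[OF _ finite_lessThan])
  let ?I = "sorted_list_of_set I" and ?J = "sorted_list_of_set J"
  have len: "length ?I = length ?J" using card fin by simp
  have bi: "bij_betw (\<lambda>k. ?I ! k) {..<length ?I} I" "bij_betw (\<lambda>k. ?J ! k) {..<length ?I} J"
    using fin len by (auto intro!: bij_betw_nth)
  define f where "f = (\<lambda>k. ?J ! k) \<circ> inv_into {..<length ?I} (\<lambda>k. ?I ! k)"
  have f: "bij_betw f I J"
    unfolding f_def using bi by (intro bij_betw_trans[OF bij_betw_inv_into])
  have fk: "f (?I ! k) = ?J ! k" if "k < length ?I" for k
    using that bi(1) by (simp add: f_def bij_betw_def inv_into_f_f)
  have "card ({..<N} - I) = card ({..<N} - J)"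
    using I J card fin by (simp add: card_Diff_subset)
  then obtain g where g: "bij_betw g ({..<N} - I) ({..<N} - J)"
    using finite_same_card_bij[of "{..<N} - I" "{..<N} - J"] by auto
  define \<sigma> where "\<sigma> i = (if i \<in> I then f i else g i)" for i
  have "bij_betw \<sigma> (I \<union> ({..<N} - I)) (J \<union> ({..<N} - J))"
    using f g unfolding \<sigma>_def by (rule bij_betw_disjoint_Un) auto
  then have \<sigma>: "bij_betw \<sigma> {..<N} {..<N}"
    using I J by (simp add: Un_absorb1)
  have "map \<sigma> ?I = ?J"
  proof (rule nth_equalityI)
    fix k assume "k < length (map \<sigma> ?I)"
    then have k: "k < length ?I" by simp
    then have "?I ! k \<in> I" using nth_mem[of k ?I] fin by simp
    then show "map \<sigma> ?I ! k = ?J ! k" using k by (simp only: nth_map \<sigma>_def fk if_True)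
  qed (use len in simp)
  then show ?thesis
    using that[of \<sigma>] \<sigma> by (auto simp: bij_betw_def)
qed

lemma gam_rot_permutation:
  assumes I: "I \<subseteq> {..<2 * n}" and J: "J \<subseteq> {..<2 * n}" and card: "card I = card J"
  obtains P where "P \<in> orth_group (2 * n)"
    "\<And>R. R \<in> orth_group (2 * n) \<Longrightarrow> gam_rot n (P * R) I = gam_rot n R J"
proof -
  obtain \<sigma> where \<sigma>: "\<And>i. i < 2 * n \<Longrightarrow> \<sigma> i < 2 * n" "inj_on \<sigma> {..<2 * n}"
    "map \<sigma> (sorted_list_of_set I) = sorted_list_of_set J"
    using extend_bijection[OF I J card] by blast
  let ?P = "Matrix.mat (2 * n) (2 * n) (\<lambda>(i, j). if j = \<sigma> i then 1 else 0)"
  have "gam_rot n (?P * R) I = gam_rot n R J" if "R \<in> orth_group (2 * n)" for R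
    unfolding \<sigma>(3)[symmetric] mprod_map
    using that I by (intro mprod_cong rot_permutation \<sigma>(1)) (auto simp: orth_group_def set_sorted_subset)
  then show ?thesis using that[of ?P] orth_group_permutation[OF \<sigma>(1,2)] by blast
qed

lemma gam_rot_sign:
  assumes I: "I \<subseteq> {..<2 * n}" and R: "R \<in> orth_group (2 * n)" and i: "i < 2 * n"
  shows "gam_rot n (sign_mat (2 * n) (\<lambda>k. if k = i then - 1 else 1) * R) I =
    (if i \<in> I then - 1 else 1) \<cdot>\<^sub>m gam_rot n R I"
proof -
  define d :: nat where "d = 2 ^ n"
  let ?s = "\<lambda>k. if k = i then - 1 else (1 :: real)"
  let ?D = "sign_mat (2 * n) ?s"
  have "mprod n (rot n (?D * R)) L = (if i \<in> set L then - 1 else 1) \<cdot>\<^sub>m mprod n (rot n R) L"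
    if "distinct L" "set L \<subseteq> {..<2 * n}" for L
    using that
  proof (induction L)
    case (Cons j L)
    have c: "rot n R j \<in> carrier_mat d d" "mprod n (rot n R) L \<in> carrier_mat d d"
      by (auto simp: d_def intro!: mprod_carrier)
    show ?case
      using Cons rot_sign_mat[OF R, of j ?s] c
      by (auto simp: mprod_Cons smult_mult_smult[of _ d])
  qed simp
  from this[of "sorted_list_of_set I"] show ?thesis
    using I by (simp add: set_sorted_subset)
qed

subsection \<open>Diagonal Pauli strings and the vacuum\<close>

text \<open>The indices of both generators of every qubit in \<open>Q\<close>; the product of such a
  pair is a \<open>Z\<close> on its qubit up to phase.\<close>

definition pairs :: "nat set \<Rightarrow> nat set" where
  "pairs Q = (\<lambda>q. 2 * q) ` Q \<union> (\<lambda>q. 2 * q + 1) ` Q"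

lemma mem_pairs_iff: "k \<in> pairs Q \<longleftrightarrow> k div 2 \<in> Q"
proof
  assume "k div 2 \<in> Q"
  then show "k \<in> pairs Q"
    unfolding pairs_def by (cases "even k") (auto elim!: evenE oddE)
qed (auto simp: pairs_def)

lemma pairs_subset: "Q \<subseteq> {..<n} \<Longrightarrow> pairs Q \<subseteq> {..<2 * n}"
  by (auto simp: pairs_def)

lemma pairs_inj:
  assumes "pairs Q = pairs Q'"
  shows "Q = Q'"
proof -
  have eq: "{q. 2 * q \<in> pairs A} = A" for A by (simp add: mem_pairs_iff)
  show ?thesis using eq[of Q] unfolding assms eq[of Q'] by simp
qed

lemma card_pairs: "finite Q \<Longrightarrow> card (pairs Q) = 2 * card Q"
proof -
  assume fin: "finite Q"
  have "2 * x \<noteq> Suc (2 * y)" for x y :: nat by presburger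
  then show ?thesis
    unfolding pairs_def using fin by (subst card_Un_disjoint) (auto simp: card_image inj_on_def)
qed

lemma pairs_insert: "pairs (insert k Q) = insert (2 * k + 1) (insert (2 * k) (pairs Q))"
  by (auto simp: pairs_def)

text \<open>Induction on a bound for the qubits: the two generators of the top qubit exceed all
  earlier indices, so appending them keeps the monomial ordered, and their product is
  \<open>\<i>\<close> times \<open>Z\<close>.\<close>

lemma pauli_Z_gam:
  assumes "Q \<subseteq> {..<n}"
  shows "\<exists>c. cmod c = 1 \<and> pauli n 0 Q = c \<cdot>\<^sub>m gam n (pairs Q)"
proof -
  have "\<exists>c. cmod c = 1 \<and> pauli n 0 Q = c \<cdot>\<^sub>m gam n (pairs Q)" if "Q \<subseteq> {..<k}" "k \<le> n" for k
    using that
  proof (induction k arbitrary: Q)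
    case 0
    then show ?case by (intro exI[of _ 1]) (simp add: pairs_def pauli_one)
  next
    case (Suc k)
    show ?case
    proof (cases "k \<in> Q")
      case False
      then have "Q \<subseteq> {..<k}" using Suc.prems by (auto simp: less_Suc_eq)
      then show ?thesis using Suc by simp
    next
      case True
      define Q' where "Q' = Q - {k}"
      have Q': "Q' \<subseteq> {..<k}" using Suc.prems by (auto simp: Q'_def less_Suc_eq)
      have Q: "Q = insert k Q'" using True by (auto simp: Q'_def)
      have fin: "finite Q'" using Q' by (rule finite_subset) simp
      obtain c where c: "cmod c = 1" "pauli n 0 Q' = c \<cdot>\<^sub>m gam n (pairs Q')"
        using Suc.IH[OF Q'] Suc.prems by auto
      define d :: nat where "d = 2 ^ n"
      have k: "2 * k < 2 * n" "2 * k + 1 < 2 * n" using Suc.prems by auto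
      have sub: "pairs Q' \<subseteq> {..<2 * k}" "insert (2 * k) (pairs Q') \<subseteq> {..<2 * k + 1}"
        using pairs_subset[OF Q'] by auto
      then have "pairs Q' \<subseteq> {..<2 * n}" using k by auto
      then have cr: "gam n (pairs Q') \<in> carrier_mat d d" "majorana n (2 * k) \<in> carrier_mat d d"
        "majorana n (2 * k + 1) \<in> carrier_mat d d"
        using k by (simp_all add: d_def)
      have "sym_diff {..<k} {..k} = {k}" by auto
      then have mm: "majorana n (2 * k) * majorana n (2 * k + 1) = \<i> \<cdot>\<^sub>m pauli n 0 {k}"
        using majorana_mult[OF k] by (simp add: maj_phase_def maj_mask_def chi_power)
      have "sym_diff Q' {k} = Q" using Q Q' by auto
      then have "pauli n 0 Q = pauli n 0 Q' * pauli n 0 {k}"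
        using fin by (simp add: pauli_mult)
      also have "pauli n 0 {k} = (- \<i>) \<cdot>\<^sub>m (majorana n (2 * k) * majorana n (2 * k + 1))"
        unfolding mm by simp
      also have "pauli n 0 Q' * \<dots> =
          (- \<i> * c) \<cdot>\<^sub>m (gam n (pairs Q') * majorana n (2 * k) * majorana n (2 * k + 1))"
        unfolding c(2) using cr
        by (simp add: smult_mult_smult[of _ d] assoc_mult_mat[of _ d d _ d _ d] mult.commute)
      also have "gam n (pairs Q') * majorana n (2 * k) * majorana n (2 * k + 1) = gam n (pairs Q)"
        unfolding Q pairs_insert gam_insert[OF sub(2) k(2)] gam_insert[OF sub(1) k(1)] by (rule refl)
      finally show ?thesis
        using c(1) by (intro exI[of _ "- \<i> * c"]) (simp add: norm_mult)
    qed
  qed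
  then show ?thesis using assms by blast
qed

abbreviation vac :: "nat \<Rightarrow> complex mat" where
  "vac n \<equiv> unit_mat n 0 0"

text \<open>The projector on the zero state is the product of the projectors
  \<open>(1 + Z) / 2\<close> on the single qubits, here expanded.\<close>

lemma vac_expand: "vac n = msum (2 ^ n) (\<lambda>Q. (1 / 2 ^ n) \<cdot>\<^sub>m pauli n 0 Q) (Pow {..<n})"
proof (rule eq_matI'[of _ "2 ^ n"])
  fix x y :: nat assume xy: "x < 2 ^ n" "y < 2 ^ n"
  have zero: "(\<forall>q<n. \<not> bit x q) \<longleftrightarrow> x = 0"
    using nat_eq_iff_bits[of x n 0] xy by simp
  have "msum (2 ^ n) (\<lambda>Q. (1 / 2 ^ n) \<cdot>\<^sub>m pauli n 0 Q) (Pow {..<n}) $$ (x, y) =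
      (\<Sum>Q\<in>Pow {..<n}. if x = y then complex_of_real (chi Q x) / 2 ^ n else 0)"
    using xy by (auto intro!: sum.cong simp: smult_entry[OF pauli_carrier] pauli_entry)
  also have "\<dots> = (if x = y then complex_of_real (\<Sum>Q\<in>Pow {..<n}. chi Q x) / 2 ^ n else 0)"
    by (simp add: sum_divide_distrib)
  also have "\<dots> = vac n $$ (x, y)"
    using xy zero by (auto simp: unit_mat_def sum_chi card_Pow)
  finally show "vac n $$ (x, y) = msum (2 ^ n) (\<lambda>Q. (1 / 2 ^ n) \<cdot>\<^sub>m pauli n 0 Q) (Pow {..<n}) $$ (x, y)"
    by simp
qed auto

lemma hs_vac: "hs n (vac n) B = B $$ (0, 0)"
proof -
  have "hs n (vac n) B = (\<Sum>p\<in>sq n. if p = (0, 0) then B $$ (0, 0) else 0)"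
    unfolding hs_def by (intro sum.cong) (auto simp: unit_mat_def split: if_splits)
  then show ?thesis by simp
qed

lemma hs_pauli_Z:
  "hs n (pauli n 0 C) B = (\<Sum>x<2 ^ n. complex_of_real (chi C x) * B $$ (x, x))"
proof -
  have "hs n (pauli n 0 C) B =
      (\<Sum>x<2 ^ n. \<Sum>y<2 ^ n. if y = x then complex_of_real (chi C x) * B $$ (x, x) else 0)"
    unfolding hs_pairs by (intro sum.cong) (auto simp: pauli_entry)
  then show ?thesis by simp
qed

lemma conj_pauli_Z_diag:
  assumes U: "U \<in> ops n" and x: "x < 2 ^ n"
  shows "(U * pauli n 0 C * adj U) $$ (x, x) =
    complex_of_real (\<Sum>y<2 ^ n. chi C y * (cmod (U $$ (x, y)))\<^sup>2)"
proof -
  have "(U * pauli n 0 C * adj U) $$ (x, x) =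
      (\<Sum>z<2 ^ n. (U * pauli n 0 C) $$ (x, z) * adj U $$ (z, x))"
    using U x by (intro mult_entry) auto
  also have "\<dots> = (\<Sum>z<2 ^ n. complex_of_real (chi C z * (cmod (U $$ (x, z)))\<^sup>2))"
    using U x
    by (intro sum.cong)
      (auto simp: mult_pauli_entry adjoint_entry[of _ "2^n"] complex_norm_square mult_ac simp del: of_real_power)
  finally show ?thesis by simp
qed

lemma pauli_Z_mprod:
  assumes "q < n" "set L \<subseteq> {..<2 * n}"
  shows "pauli n 0 {q} * mprod n (majorana n) L =
    (- 1) ^ length (filter (\<lambda>j. j div 2 = q) L) \<cdot>\<^sub>m (mprod n (majorana n) L * pauli n 0 {q})"
  using assms
proof (induction L)
  case Nil
  then show ?case
    by (simp add: left_mult_one_mat[of _ "2 ^ n" "2 ^ n"] right_mult_one_mat[of _ "2 ^ n" "2 ^ n"])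
next
  case (Cons j L)
  define d :: nat where "d = 2 ^ n"
  note simps = sq_ring[where d = d]
  let ?M = "mprod n (majorana n) L" and ?Z = "pauli n 0 {q}"
  have c: "?Z \<in> carrier_mat d d" "majorana n j \<in> carrier_mat d d" "?M \<in> carrier_mat d d"
    using Cons.prems mprod_majorana_carrier[of L n] by (simp_all add: d_def)
  have "?Z * majorana n j = (if j div 2 = q then - 1 else 1) \<cdot>\<^sub>m (majorana n j * ?Z)"
    using pauli_conj_majorana[of j n 0 "{q}"] Cons.prems by (auto simp: chi_power)
  then have "?Z * (majorana n j * ?M) = (if j div 2 = q then - 1 else 1) \<cdot>\<^sub>m (majorana n j * (?Z * ?M))"
    by (rule mult_rewrite_left[OF _ c(1,2) c(2,1) c(3)])
  then show ?case
    using Cons c by (auto simp: mprod_Cons simps)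
qed

text \<open>The zero state is fixed by every \<open>Z\<close>, so a monomial that anticommutes with
  the \<open>Z\<close> of some qubit has vanishing vacuum entry. Commuting with it requires both
  generators of that qubit or neither.\<close>

lemma gam_vacuum_entry_nonzero:
  assumes I: "I \<subseteq> {..<2 * n}" and nz: "gam n I $$ (0, 0) \<noteq> 0"
  shows "\<exists>Q\<subseteq>{..<n}. I = pairs Q"
proof -
  have fin: "finite I" using I by (rule finite_subset) simp
  have par: "2 * q \<in> I \<longleftrightarrow> 2 * q + 1 \<in> I" if q: "q < n" for q
  proof -
    let ?l = "length (filter (\<lambda>j. j div 2 = q) (sorted_list_of_set I))"
    have c: "gam n I \<in> ops n" using I by simp
    have "(pauli n 0 {q} * gam n I) $$ (0, 0) =
        ((- 1) ^ ?l \<cdot>\<^sub>m (gam n I * pauli n 0 {q})) $$ (0, 0)"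
      using pauli_Z_mprod[OF q, of "sorted_list_of_set I"] I by (simp add: set_sorted_subset)
    then have "gam n I $$ (0, 0) = (- 1) ^ ?l * gam n I $$ (0, 0)"
      using c by (simp add: pauli_mult_entry mult_pauli_entry smult_entry[OF mult_carrier_sq[OF c pauli_carrier]])
    then have "even ?l" using nz by (cases "even ?l") auto
    moreover have "?l = card ({j. j div 2 = q} \<inter> I)"
      using fin by (simp add: distinct_length_filter)
    moreover have "{j. j div 2 = q} = {2 * q, 2 * q + 1}" by auto
    ultimately have "even (card ({2 * q, 2 * q + 1} \<inter> I))" by simp
    then show ?thesis
      by (cases "2 * q \<in> I"; cases "2 * q + 1 \<in> I") (auto simp: Int_insert_left)
  qed
  have "I = pairs {q. 2 * q \<in> I}"
  proof (intro Set.set_eqI)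
    fix k
    show "k \<in> I \<longleftrightarrow> k \<in> pairs {q. 2 * q \<in> I}"
    proof (cases "even k")
      case True
      then show ?thesis by (auto simp: mem_pairs_iff)
    next
      case False
      then obtain q where k: "k = 2 * q + 1" by (auto elim: oddE)
      show ?thesis
      proof (cases "q < n")
        case True
        then show ?thesis using par k by (simp add: mem_pairs_iff)
      next
        case False
        then have "k \<notin> I" "2 * q \<notin> I" using I k by auto
        then show ?thesis using k by (simp add: mem_pairs_iff)
      qed
    qed
  qed
  moreover have "{q. 2 * q \<in> I} \<subseteq> {..<n}" using I by auto
  ultimately show ?thesis by blast
qed

lemma gam_entry_le_1:
  assumes I: "I \<subseteq> {..<2 * n}"
  shows "cmod (gam n I $$ (0, 0)) \<le> 1"
proof -
  have c: "gam n I \<in> ops n" "adj (gam n I) \<in> ops n" using I by auto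
  have "(\<Sum>k<2 ^ n. (cmod (gam n I $$ (k, 0)))\<^sup>2) = 1"
    by (rule unitary_col[OF c(1) mult_one_comm[OF c(2,1) gam_unitary[OF I]]]) simp
  moreover have "(cmod (gam n I $$ (0, 0)))\<^sup>2 \<le> (\<Sum>k<2 ^ n. (cmod (gam n I $$ (k, 0)))\<^sup>2)"
    by (rule member_le_sum) auto
  ultimately show ?thesis by (simp add: power_le_one_iff abs_square_le_1)
qed

text \<open>Only the monomials \<open>pairs Q\<close> with \<open>card Q = k\<close> can contribute,
  and unitarity bounds each contribution by one.\<close>

lemma weight_vac_le: "weight n (2 * k) (vac n) \<le> real (n choose k)"
proof -
  let ?S = "{Q. Q \<subseteq> {..<n} \<and> card Q = k}"
  have fin: "finite (gsets n (2 * k))" by (rule finite_subset[of _ "Pow {..<2 * n}"]) auto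
  have finS: "finite ?S" by (rule finite_subset[of _ "Pow {..<n}"]) auto
  have "weight n (2 * k) (vac n) = (\<Sum>I\<in>gsets n (2 * k). (cmod (gam n I $$ (0, 0)))\<^sup>2)"
    by (simp add: weight_def hs_vac)
  also have "\<dots> \<le> (\<Sum>I\<in>gsets n (2 * k). if I \<in> pairs ` ?S then 1 else 0)"
  proof (rule sum_mono)
    fix I assume I: "I \<in> gsets n (2 * k)"
    show "(cmod (gam n I $$ (0, 0)))\<^sup>2 \<le> (if I \<in> pairs ` ?S then 1 else 0)"
    proof (cases "gam n I $$ (0, 0) = 0")
      case False
      then obtain Q where Q: "Q \<subseteq> {..<n}" "I = pairs Q"
        using gam_vacuum_entry_nonzero I by blast
      then have "finite Q" by (auto intro: finite_subset)
      then have "Q \<in> ?S" using I Q card_pairs[of Q] by auto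
      then show ?thesis
        using Q gam_entry_le_1[of I n] I by (auto simp: abs_square_le_1)
    qed auto
  qed
  also have "\<dots> = real (card (gsets n (2 * k) \<inter> pairs ` ?S))"
    using fin by (simp add: sum.If_cases Int_def)
  also have "\<dots> \<le> real (card (pairs ` ?S))"
    using finS by (intro of_nat_mono card_mono) auto
  also have "\<dots> \<le> real (card ?S)"
    using card_image_le[OF finS, of pairs] by simp
  also have "card ?S = n choose k" by (simp add: n_subsets)
  finally show ?thesis .
qed

subsection \<open>Haar averages\<close>

lemma conj_msum:
  assumes "U \<in> carrier_mat d d" "\<And>i. i \<in> I \<Longrightarrow> f i \<in> carrier_mat d d"
  shows "U * msum d (\<lambda>i. c i \<cdot>\<^sub>m f i) I * adj U =
    msum d (\<lambda>i. c i \<cdot>\<^sub>m (U * f i * adj U)) I"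
proof -
  have "U * msum d (\<lambda>i. c i \<cdot>\<^sub>m f i) I = msum d (\<lambda>i. c i \<cdot>\<^sub>m (U * f i)) I"
    using assms by (subst mult_msum) (auto simp: mult_smult_distrib[of _ d d _ d] intro!: msum_cong)
  then show ?thesis
    using assms
    by (simp, subst msum_mult) (auto simp: mult_smult_assoc_mat[of _ d d _ d] intro!: msum_cong)
qed

locale matchgate_haar =
  fixes n :: nat and \<mu> :: "real mat measure"
  assumes haar: "is_normalized_haar (2 * n) \<mu>"
begin

sublocale prob_space \<mu>
  using haar by (simp add: is_normalized_haar_def)

lemma space_haar: "space \<mu> = orth_group (2 * n)"
  and sets_haar: "sets \<mu> = sets (orth_borel (2 * n))"
  using haar by (simp_all add: is_normalized_haar_def)

lemma measurable_entry:
  assumes "i < 2 * n" "j < 2 * n"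
  shows "(\<lambda>R. R $$ (i, j)) \<in> borel_measurable \<mu>"
proof -
  let ?I = "{..<2 * n} \<times> {..<2 * n}"
  have "(\<lambda>R. \<lambda>p\<in>?I. R $$ p) \<in> orth_borel (2 * n) \<rightarrow>\<^sub>M PiM ?I (\<lambda>_. borel)"
    unfolding orth_borel_def by (rule measurable_vimage_algebra1) (auto simp: space_PiM)
  moreover have "(\<lambda>f. f (i, j)) \<in> PiM ?I (\<lambda>_. borel) \<rightarrow>\<^sub>M (borel :: real measure)"
    by (rule measurable_component_singleton) (use assms in auto)
  ultimately have "(\<lambda>R. (\<lambda>p\<in>?I. R $$ p) (i, j)) \<in> borel_measurable (orth_borel (2 * n))"
    by (rule measurable_compose)
  then show ?thesis
    using assms measurable_cong_sets[OF sets_haar refl, of "borel :: real measure"] by simp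
qed

lemma measurable_entry_complex:
  "i < 2 * n \<Longrightarrow> j < 2 * n \<Longrightarrow> (\<lambda>R. complex_of_real (R $$ (i, j))) \<in> borel_measurable \<mu>"
  by (rule measurable_compose[OF measurable_entry borel_measurable_continuous_onI])
    (auto intro!: continuous_intros)

lemma measurable_left_mult:
  assumes A: "A \<in> orth_group (2 * n)"
  shows "(\<lambda>R. A * R) \<in> \<mu> \<rightarrow>\<^sub>M \<mu>"
proof -
  let ?I = "{..<2 * n} \<times> {..<2 * n}"
  have Ac: "A \<in> carrier_mat (2 * n) (2 * n)" using A by (simp add: orth_group_def)
  have "(\<lambda>R. A * R) \<in> \<mu> \<rightarrow>\<^sub>M orth_borel (2 * n)"
    unfolding orth_borel_def
  proof (rule measurable_vimage_algebra2)
    show "(\<lambda>R. A * R) \<in> space \<mu> \<rightarrow> orth_group (2 * n)"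
      using A orth_group_mult by (auto simp: space_haar)
    show "(\<lambda>R. \<lambda>p\<in>?I. (A * R) $$ p) \<in> \<mu> \<rightarrow>\<^sub>M PiM ?I (\<lambda>_. borel)"
    proof (rule measurable_restrict)
      fix p assume "p \<in> ?I"
      then obtain i j where p: "p = (i, j)" "i < 2 * n" "j < 2 * n" by auto
      have "(\<lambda>R. \<Sum>k<2 * n. A $$ (i, k) * R $$ (k, j)) \<in> borel_measurable \<mu>"
        using p by (intro borel_measurable_sum borel_measurable_times borel_measurable_const measurable_entry) auto
      moreover have "(A * R) $$ p = (\<Sum>k<2 * n. A $$ (i, k) * R $$ (k, j))" if "R \<in> space \<mu>" for R
        using that Ac p unfolding p(1) by (intro mult_entry) (auto simp: space_haar orth_group_def)
      ultimately show "(\<lambda>R. (A * R) $$ p) \<in> borel_measurable \<mu>"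
        by (subst measurable_cong) auto
    qed
  qed
  then show ?thesis
    using measurable_cong_sets[OF refl sets_haar] by blast
qed

lemma integral_left_mult:
  fixes f :: "real mat \<Rightarrow> 'b :: {banach, second_countable_topology}"
  assumes "A \<in> orth_group (2 * n)" "f \<in> borel_measurable \<mu>"
  shows "(\<integral>R. f (A * R) \<partial>\<mu>) = (\<integral>R. f R \<partial>\<mu>)"
proof -
  have "distr \<mu> \<mu> (\<lambda>R. A * R) = \<mu>"
    using haar assms(1) by (simp add: is_normalized_haar_def)
  then show ?thesis
    using integral_distr[OF measurable_left_mult[OF assms(1)] assms(2)] by simp
qed

lemma measurable_mprod_entry:
  assumes "set L \<subseteq> {..<2 * n}" "x < 2 ^ n" "y < 2 ^ n"
  shows "(\<lambda>R. mprod n (rot n R) L $$ (x, y)) \<in> borel_measurable \<mu>"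
  using assms
proof (induction L arbitrary: x)
  case (Cons i L)
  have c: "mprod n (rot n R) L \<in> ops n" for R
    by (rule mprod_carrier) simp
  have "mprod n (rot n R) (i # L) $$ (x, y) =
      (\<Sum>z<2 ^ n. (\<Sum>j<2 * n. complex_of_real (R $$ (i, j)) * majorana n j $$ (x, z)) *
        mprod n (rot n R) L $$ (z, y))" for R
  proof -
    have "mprod n (rot n R) (i # L) $$ (x, y) =
        (\<Sum>z<2 ^ n. rot n R i $$ (x, z) * mprod n (rot n R) L $$ (z, y))"
      unfolding mprod_Cons using Cons.prems by (intro mult_entry[OF rot_carrier c]) auto
    also have "\<dots> = (\<Sum>z<2 ^ n. (\<Sum>j<2 * n. complex_of_real (R $$ (i, j)) * majorana n j $$ (x, z)) *
        mprod n (rot n R) L $$ (z, y))"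
      using Cons.prems
      by (intro sum.cong refl) (auto simp: rot_def smult_entry[OF majorana_carrier] intro!: sum.cong)
    finally show ?thesis .
  qed
  moreover have "(\<lambda>R. \<Sum>z<2 ^ n. (\<Sum>j<2 * n. complex_of_real (R $$ (i, j)) * majorana n j $$ (x, z)) *
        mprod n (rot n R) L $$ (z, y)) \<in> borel_measurable \<mu>"
    using Cons
    by (intro borel_measurable_sum borel_measurable_times borel_measurable_const measurable_entry_complex) auto
  ultimately show ?case by simp
qed auto

lemma measurable_gam_rot_entry:
  "I \<subseteq> {..<2 * n} \<Longrightarrow> x < 2 ^ n \<Longrightarrow> y < 2 ^ n \<Longrightarrow>
    (\<lambda>R. gam_rot n R I $$ (x, y)) \<in> borel_measurable \<mu>"
  by (rule measurable_mprod_entry) (auto simp: set_sorted_subset)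

lemma measurable_hs:
  "I \<subseteq> {..<2 * n} \<Longrightarrow> (\<lambda>R. hs n Y (gam_rot n R I)) \<in> borel_measurable \<mu>"
  unfolding hs_pairs
  by (intro borel_measurable_sum borel_measurable_times borel_measurable_const measurable_gam_rot_entry) auto

lemma measurable_cnj_hs:
  "I \<subseteq> {..<2 * n} \<Longrightarrow> (\<lambda>R. cnj (hs n Y (gam_rot n R I))) \<in> borel_measurable \<mu>"
  by (rule measurable_compose[OF measurable_hs borel_measurable_continuous_onI])
    (auto intro!: continuous_intros)

lemma hs_gam_rot_le:
  assumes "R \<in> orth_group (2 * n)" "Y \<in> ops n" "I \<subseteq> {..<2 * n}"
  shows "(cmod (hs n Y (gam_rot n R I)))\<^sup>2 \<le> weight n (card I) Y"
  unfolding weight_rot[OF assms(1,2), symmetric]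
  by (rule member_le_sum) (use assms in \<open>auto intro: finite_subset[of _ "Pow {..<2 * n}"]\<close>)

lemma integrable_hs_square:
  assumes Y: "Y \<in> ops n" and I: "I \<subseteq> {..<2 * n}"
  shows "integrable \<mu> (\<lambda>R. (cmod (hs n Y (gam_rot n R I)))\<^sup>2)"
proof (rule integrable_const_bound[where B = "weight n (card I) Y"])
  show "AE R in \<mu>. norm ((cmod (hs n Y (gam_rot n R I)))\<^sup>2) \<le> weight n (card I) Y"
    by (rule AE_I2) (use hs_gam_rot_le[OF _ Y I] in \<open>simp add: space_haar\<close>)
  show "(\<lambda>R. (cmod (hs n Y (gam_rot n R I)))\<^sup>2) \<in> borel_measurable \<mu>"
    by (intro borel_measurable_power measurable_compose[OF measurable_hs[OF I] borel_measurable_norm])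
qed

text \<open>A row permutation carries one monomial to any other of the same degree, so by invariance
  all these integrals agree. Their sum has a constant integrand, by
  \<open>weight_rot\<close>.\<close>

lemma integral_hs_square:
  assumes Y: "Y \<in> ops n" and I: "I \<subseteq> {..<2 * n}"
  shows "(\<integral>R. (cmod (hs n Y (gam_rot n R I)))\<^sup>2 \<partial>\<mu>) =
    weight n (card I) Y / real ((2 * n) choose card I)"
proof -
  let ?F = "\<lambda>I R. (cmod (hs n Y (gam_rot n R I)))\<^sup>2"
  have card_le: "card I \<le> 2 * n" using I by (metis card_lessThan card_mono finite_lessThan)
  have eq: "(\<integral>R. ?F J R \<partial>\<mu>) = (\<integral>R. ?F I R \<partial>\<mu>)" if J: "J \<in> gsets n (card I)" for J
  proof -
    obtain P where P: "P \<in> orth_group (2 * n)"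
      "\<And>R. R \<in> orth_group (2 * n) \<Longrightarrow> gam_rot n (P * R) I = gam_rot n R J"
      using gam_rot_permutation[of I n J] I J by auto
    have "(\<integral>R. ?F I R \<partial>\<mu>) = (\<integral>R. ?F I (P * R) \<partial>\<mu>)"
      using integral_left_mult[OF P(1) borel_measurable_integrable[OF integrable_hs_square[OF Y I]]] by simp
    also have "\<dots> = (\<integral>R. ?F J R \<partial>\<mu>)"
      by (rule Bochner_Integration.integral_cong) (simp_all add: P(2) space_haar)
    finally show ?thesis by simp
  qed
  have "real ((2 * n) choose card I) * (\<integral>R. ?F I R \<partial>\<mu>) = (\<Sum>J\<in>gsets n (card I). \<integral>R. ?F J R \<partial>\<mu>)"
    using eq n_subsets[of "{..<2 * n}" "card I"] by simp
  also have "\<dots> = (\<integral>R. (\<Sum>J\<in>gsets n (card I). ?F J R) \<partial>\<mu>)"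
    by (rule Bochner_Integration.integral_sum[symmetric]) (use integrable_hs_square[OF Y] in auto)
  also have "\<dots> = (\<integral>R. weight n (card I) Y \<partial>\<mu>)"
    by (rule Bochner_Integration.integral_cong) (simp_all add: space_haar weight_rot[OF _ Y])
  also have "\<dots> = weight n (card I) Y" by (simp add: prob_space)
  finally show ?thesis
    using card_le by (simp add: field_simps)
qed

text \<open>Changing the sign of a row that belongs to exactly one of the two sets negates the
  integrand but preserves the measure.\<close>

lemma integral_hs_cross:
  assumes Y: "Y \<in> ops n"
    and I: "I \<subseteq> {..<2 * n}" and J: "J \<subseteq> {..<2 * n}" and ne: "I \<noteq> J"
  shows "(\<integral>R. hs n Y (gam_rot n R I) * cnj (hs n Y (gam_rot n R J)) \<partial>\<mu>) = 0"
proof -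
  let ?f = "\<lambda>R. hs n Y (gam_rot n R I) * cnj (hs n Y (gam_rot n R J))"
  obtain i where i: "i \<in> sym_diff I J" using ne by blast
  then have i2: "i < 2 * n" using I J by auto
  let ?s = "\<lambda>k. if k = i then - 1 else (1 :: real)"
  let ?D = "sign_mat (2 * n) ?s"
  have D: "?D \<in> orth_group (2 * n)" by (rule sign_mat_orth) auto
  have meas: "?f \<in> borel_measurable \<mu>"
    by (intro borel_measurable_times measurable_hs measurable_cnj_hs I J)
  have "(\<integral>R. ?f R \<partial>\<mu>) = (\<integral>R. ?f (?D * R) \<partial>\<mu>)"
    by (rule integral_left_mult[OF D meas, symmetric])
  also have "\<dots> = (\<integral>R. - ?f R \<partial>\<mu>)"
  proof (rule Bochner_Integration.integral_cong[OF refl])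
    fix R assume "R \<in> space \<mu>"
    then have R: "R \<in> orth_group (2 * n)" by (simp add: space_haar)
    show "?f (?D * R) = - ?f R"
      using i by (auto simp: gam_rot_sign[OF I R i2] gam_rot_sign[OF J R i2] hs_smult_right)
  qed
  also have "\<dots> = - (\<integral>R. ?f R \<partial>\<mu>)" by simp
  finally show ?thesis by simp
qed

lemma integrable_hs_cross:
  assumes Y: "Y \<in> ops n"
    and I: "I \<subseteq> {..<2 * n}" and J: "J \<subseteq> {..<2 * n}"
  shows "integrable \<mu> (\<lambda>R. hs n Y (gam_rot n R I) * cnj (hs n Y (gam_rot n R J)))"
proof (rule integrable_const_bound[where B = "weight n (card I) Y + weight n (card J) Y"])
  show "AE R in \<mu>. norm (hs n Y (gam_rot n R I) * cnj (hs n Y (gam_rot n R J))) \<le>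
      weight n (card I) Y + weight n (card J) Y"
  proof (rule AE_I2)
    fix R assume "R \<in> space \<mu>"
    then have R: "R \<in> orth_group (2 * n)" by (simp add: space_haar)
    let ?a = "cmod (hs n Y (gam_rot n R I))" and ?b = "cmod (hs n Y (gam_rot n R J))"
    have "2 * (?a * ?b) \<le> ?a\<^sup>2 + ?b\<^sup>2" using sum_squares_bound[of ?a ?b] by simp
    moreover have "0 \<le> ?a * ?b" by simp
    ultimately have "?a * ?b \<le> ?a\<^sup>2 + ?b\<^sup>2" by linarith
    then show "norm (hs n Y (gam_rot n R I) * cnj (hs n Y (gam_rot n R J))) \<le>
      weight n (card I) Y + weight n (card J) Y"
      using hs_gam_rot_le[OF R Y I] hs_gam_rot_le[OF R Y J] by (simp add: norm_mult)
  qed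
  show "(\<lambda>R. hs n Y (gam_rot n R I) * cnj (hs n Y (gam_rot n R J))) \<in> borel_measurable \<mu>"
    by (intro borel_measurable_times measurable_hs measurable_cnj_hs I J)
qed

abbreviation M :: "real mat \<Rightarrow> complex mat" where
  "M R \<equiv> matchgate_unitary n R"

lemma M_is_matchgate: "R \<in> space \<mu> \<Longrightarrow> is_matchgate_unitary n R (M R)"
  by (simp add: space_haar is_matchgate_unitary_matchgate_unitary)

lemma M_carrier: "R \<in> space \<mu> \<Longrightarrow> M R \<in> ops n"
  using M_is_matchgate by (simp add: is_matchgate_unitary_iff)

text \<open>The vacuum projector is a sum of \<open>Z\<close> strings, each a monomial
  \<open>pairs Q\<close> up to phase. Cross terms average to zero, phases drop out of the diagonal
  terms, and the squared normalization \<open>1 / 2 ^ n\<close> gives \<open>4 ^ n\<close>.\<close>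

lemma integral_hs_vac:
  assumes Y: "Y \<in> ops n"
  shows "(\<integral>R. (cmod (hs n Y (M R * vac n * adj (M R))))\<^sup>2 \<partial>\<mu>) =
    (\<Sum>Q\<in>Pow {..<n}. weight n (2 * card Q) Y / real ((2 * n) choose (2 * card Q))) / 4 ^ n"
proof -
  have "\<forall>Q. \<exists>c. Q \<subseteq> {..<n} \<longrightarrow> cmod c = 1 \<and> pauli n 0 Q = c \<cdot>\<^sub>m gam n (pairs Q)"
    using pauli_Z_gam by blast
  then obtain c where c: "\<And>Q. Q \<subseteq> {..<n} \<Longrightarrow> cmod (c Q) = 1"
    "\<And>Q. Q \<subseteq> {..<n} \<Longrightarrow> pauli n 0 Q = c Q \<cdot>\<^sub>m gam n (pairs Q)"
    by metis
  define w where "w Q R = hs n Y (gam_rot n R (pairs Q))" for Q R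
  have hs_eq: "hs n Y (M R * vac n * adj (M R)) = (\<Sum>Q\<in>Pow {..<n}. c Q * w Q R) / 2 ^ n"
    if R: "R \<in> space \<mu>" for R
  proof -
    have "M R * vac n * adj (M R) =
        msum (2 ^ n) (\<lambda>Q. (1 / 2 ^ n) \<cdot>\<^sub>m (M R * pauli n 0 Q * adj (M R))) (Pow {..<n})"
      unfolding vac_expand by (rule conj_msum) (use M_carrier[OF R] in auto)
    also have "\<dots> = msum (2 ^ n) (\<lambda>Q. (c Q / 2 ^ n) \<cdot>\<^sub>m gam_rot n R (pairs Q)) (Pow {..<n})"
    proof (rule msum_cong[OF refl])
      fix Q assume "Q \<in> Pow {..<n}"
      then have Q: "Q \<subseteq> {..<n}" by simp
      have g: "gam n (pairs Q) \<in> ops n" using pairs_subset[OF Q] by simp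
      have "M R * pauli n 0 Q * adj (M R) = c Q \<cdot>\<^sub>m (M R * gam n (pairs Q) * adj (M R))"
        unfolding c(2)[OF Q] using M_carrier[OF R] g
        by (simp add: sq_ring[where d = "2^n"])
      then show "(1 / 2 ^ n) \<cdot>\<^sub>m (M R * pauli n 0 Q * adj (M R)) =
          (c Q / 2 ^ n) \<cdot>\<^sub>m gam_rot n R (pairs Q)"
        by (simp add: conj_gam[OF M_is_matchgate[OF R] pairs_subset[OF Q]])
    qed
    finally show ?thesis
      by (simp add: hs_msum_right hs_smult_right w_def sum_divide_distrib)
  qed
  let ?P = "Pow {..<n}"
  have int: "integrable \<mu> (\<lambda>R. a * (w Q R * cnj (w Q' R)))" if "Q \<in> ?P" "Q' \<in> ?P" for a Q Q'
    unfolding w_def using that pairs_subset by (intro integrable_mult_right integrable_hs_cross[OF Y]) auto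
  have "complex_of_real (\<integral>R. (cmod (hs n Y (M R * vac n * adj (M R))))\<^sup>2 \<partial>\<mu>) =
      (\<integral>R. complex_of_real ((cmod (hs n Y (M R * vac n * adj (M R))))\<^sup>2) \<partial>\<mu>)"
    by (rule integral_complex_of_real[symmetric])
  also have "\<dots> = (\<integral>R. (\<Sum>Q\<in>?P. \<Sum>Q'\<in>?P. (c Q * cnj (c Q') / 4 ^ n) * (w Q R * cnj (w Q' R))) \<partial>\<mu>)"
  proof (rule Bochner_Integration.integral_cong[OF refl])
    fix R assume R: "R \<in> space \<mu>"
    have four: "(4 :: complex) ^ n = 2 ^ n * 2 ^ n" by (simp flip: power_mult_distrib)
    show "complex_of_real ((cmod (hs n Y (M R * vac n * adj (M R))))\<^sup>2) =
        (\<Sum>Q\<in>?P. \<Sum>Q'\<in>?P. (c Q * cnj (c Q') / 4 ^ n) * (w Q R * cnj (w Q' R)))"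
      unfolding complex_norm_square hs_eq[OF R] four
      by (simp add: sum_product sum_divide_distrib mult_ac)
  qed
  also have "\<dots> = (\<Sum>Q\<in>?P. \<integral>R. (\<Sum>Q'\<in>?P. (c Q * cnj (c Q') / 4 ^ n) * (w Q R * cnj (w Q' R))) \<partial>\<mu>)"
    by (rule Bochner_Integration.integral_sum, rule Bochner_Integration.integrable_sum, rule int)
  also have "\<dots> = (\<Sum>Q\<in>?P. \<Sum>Q'\<in>?P. \<integral>R. (c Q * cnj (c Q') / 4 ^ n) * (w Q R * cnj (w Q' R)) \<partial>\<mu>)"
    by (intro sum.cong refl Bochner_Integration.integral_sum int)
  also have "\<dots> = (\<Sum>Q\<in>?P. \<Sum>Q'\<in>?P. (c Q * cnj (c Q') / 4 ^ n) * (\<integral>R. w Q R * cnj (w Q' R) \<partial>\<mu>))"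
    by (intro sum.cong refl integral_mult_right_zero)
  also have "\<dots> = (\<Sum>Q\<in>?P. \<Sum>Q'\<in>?P. if Q' = Q then
      complex_of_real (weight n (2 * card Q) Y / real ((2 * n) choose (2 * card Q)) / 4 ^ n) else 0)"
  proof (intro sum.cong refl)
    fix Q Q' assume "Q \<in> ?P" "Q' \<in> ?P"
    then have Q: "Q \<subseteq> {..<n}" "Q' \<subseteq> {..<n}" by auto
    show "(c Q * cnj (c Q') / 4 ^ n) * (\<integral>R. w Q R * cnj (w Q' R) \<partial>\<mu>) = (if Q' = Q then
      complex_of_real (weight n (2 * card Q) Y / real ((2 * n) choose (2 * card Q)) / 4 ^ n) else 0)"
    proof (cases "Q' = Q")
      case True
      have fin: "finite Q" using Q(1) by (rule finite_subset) simp
      have "(\<integral>R. w Q R * cnj (w Q R) \<partial>\<mu>) = (\<integral>R. complex_of_real ((cmod (w Q R))\<^sup>2) \<partial>\<mu>)"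
        by (simp add: complex_norm_square del: of_real_power)
      also have "\<dots> = complex_of_real (weight n (2 * card Q) Y / real ((2 * n) choose (2 * card Q)))"
        using integral_hs_square[OF Y pairs_subset[OF Q(1)]]
        by (simp only: integral_complex_of_real w_def card_pairs[OF fin])
      finally have "(\<integral>R. w Q R * cnj (w Q R) \<partial>\<mu>) =
        complex_of_real (weight n (2 * card Q) Y / real ((2 * n) choose (2 * card Q)))" .
      moreover have "c Q * cnj (c Q) = 1"
        using c(1)[OF Q(1)] complex_norm_square[of "c Q"] by simp
      ultimately show ?thesis using True by simp
    next
      case False
      then have "pairs Q \<noteq> pairs Q'" using pairs_inj by blast
      then show ?thesis
        using False integral_hs_cross[OF Y pairs_subset[OF Q(1)] pairs_subset[OF Q(2)]] by (simp add: w_def)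
    qed
  qed
  also have "\<dots> = complex_of_real
      ((\<Sum>Q\<in>?P. weight n (2 * card Q) Y / real ((2 * n) choose (2 * card Q))) / 4 ^ n)"
    by (simp add: sum_divide_distrib)
  finally show ?thesis by (simp only: of_real_eq_iff)
qed

text \<open>Expanding \<open>Y\<close> in monomials turns the conjugation into a fixed linear
  combination of \<open>gam_rot\<close> entries, which no longer mention the chosen unitary.\<close>

lemma measurable_conj_entry:
  assumes Y: "Y \<in> ops n" and xy: "x < 2 ^ n" "y < 2 ^ n"
  shows "(\<lambda>R. (M R * Y * adj (M R)) $$ (x, y)) \<in> borel_measurable \<mu>"
proof -
  have "(M R * Y * adj (M R)) $$ (x, y) =
      (\<Sum>I\<in>Pow {..<2 * n}. (hs n (gam n I) Y / 2 ^ n) * gam_rot n R I $$ (x, y))" if R: "R \<in> space \<mu>" for R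
  proof -
    have "M R * Y * adj (M R) =
        msum (2 ^ n) (\<lambda>I. (hs n (gam n I) Y / 2 ^ n) \<cdot>\<^sub>m (M R * gam n I * adj (M R))) (Pow {..<2 * n})"
      by (subst gam_expand[OF Y], rule conj_msum) (use M_carrier[OF R] in auto)
    then show ?thesis
      using xy by (auto intro!: sum.cong simp: conj_gam[OF M_is_matchgate[OF R]] smult_entry[OF gam_rot_carrier])
  qed
  moreover have "(\<lambda>R. \<Sum>I\<in>Pow {..<2 * n}. (hs n (gam n I) Y / 2 ^ n) * gam_rot n R I $$ (x, y))
      \<in> borel_measurable \<mu>"
    using xy by (intro borel_measurable_sum borel_measurable_times borel_measurable_const
        measurable_gam_rot_entry) auto
  ultimately show ?thesis by (subst measurable_cong) auto
qed

end

subsection \<open>Second moments of matchgate amplitudes\<close>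

text \<open>The vacuum expectation of \<open>U * Z * adj U\<close> with \<open>Z\<close> on qubit
  \<open>k\<close>, as the mean of a character over the distribution given by row \<open>0\<close>.
  The column version \<open>col_z\<close> is the vacuum expectation of \<open>adj U * Z * U\<close>.
  Second-layer blocks enter through rows, first-layer blocks through columns.\<close>

definition row_z :: "nat \<Rightarrow> nat \<Rightarrow> complex mat \<Rightarrow> real" where
  "row_z n k U = (\<Sum>y<2 ^ n. chi {k} y * (cmod (U $$ (0, y)))\<^sup>2)"

definition col_z :: "nat \<Rightarrow> nat \<Rightarrow> complex mat \<Rightarrow> real" where
  "col_z n k U = (\<Sum>x<2 ^ n. chi {k} x * (cmod (U $$ (x, 0)))\<^sup>2)"

lemma sum_Pow_card:
  fixes g :: "nat \<Rightarrow> real"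
  shows "(\<Sum>Q\<in>Pow {..<n}. g (card Q)) = (\<Sum>k\<le>n. real (n choose k) * g k)"
proof -
  have "(\<Sum>Q\<in>Pow {..<n}. g (card Q)) = (\<Sum>k\<le>n. \<Sum>Q\<in>{Q \<in> Pow {..<n}. card Q = k}. g (card Q))"
    by (rule sum.group[symmetric]) (auto intro: subset_eq_atLeast0_lessThan_card
        simp: card_mono[of "{..<n}", simplified])
  also have "\<dots> = (\<Sum>k\<le>n. real (card {Q. Q \<subseteq> {..<n} \<and> card Q = k}) * g k)"
    by (intro sum.cong) auto
  finally show ?thesis by (simp add: n_subsets)
qed

text \<open>The middle term of Vandermonde's sum.\<close>

lemma choose_square_le: "(n choose k) * (n choose k) \<le> (2 * n) choose (2 * k)"
proof (cases "k \<le> n")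
  case True
  have "(n choose k) * (n choose (2 * k - k)) \<le> (\<Sum>j\<le>2 * k. (n choose j) * (n choose (2 * k - j)))"
    by (rule member_le_sum) auto
  then show ?thesis using vandermonde[of n n "2 * k"] by (simp add: mult_2)
qed (simp add: binomial_eq_0)

lemma choose_two_double: "real ((2 * n) choose 2) = real n * (2 * real n - 1)"
proof (cases n)
  case (Suc m)
  have "(2 * n) choose 2 = n * (2 * n - 1)"
    by (simp add: choose_two)
  then show ?thesis using Suc by (simp add: algebra_simps)
qed simp

lemma pauli_Z_vac_entry: "q < n \<Longrightarrow> cmod (gam n (pairs {q}) $$ (0, 0)) = 1"
proof -
  assume q: "q < n"
  obtain c where c: "cmod c = 1" "pauli n 0 {q} = c \<cdot>\<^sub>m gam n (pairs {q})"
    using pauli_Z_gam[of "{q}" n] q by auto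
  have g: "gam n (pairs {q}) \<in> ops n"
    using pairs_subset[of "{q}" n] q by simp
  have "pauli n 0 {q} $$ (0, 0) = c * gam n (pairs {q}) $$ (0, 0)"
    unfolding c(2) by (rule smult_entry[OF g]) auto
  then have "1 = c * gam n (pairs {q}) $$ (0, 0)"
    by (simp add: pauli_entry)
  then show ?thesis using c(1) by (metis mult_1 norm_mult norm_one)
qed

lemma weight_vac_ge: "weight n 2 (vac n) \<ge> real n"
proof -
  let ?T = "(\<lambda>q. pairs {q}) ` {..<n}"
  have inj: "inj_on (\<lambda>q. pairs {q}) {..<n}" by (auto intro!: inj_onI dest: pairs_inj)
  have "?T \<subseteq> gsets n 2"
  proof
    fix I assume "I \<in> ?T"
    then obtain q where q: "q < n" "I = pairs {q}" by auto
    then show "I \<in> gsets n 2" using pairs_subset[of "{q}" n] card_pairs[of "{q}"] by simp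
  qed
  then have "weight n 2 (vac n) \<ge> (\<Sum>I\<in>?T. (cmod (hs n (vac n) (gam n I)))\<^sup>2)"
    by (rule weight_ge)
  also have "(\<Sum>I\<in>?T. (cmod (hs n (vac n) (gam n I)))\<^sup>2) = real n"
    by (simp add: sum.reindex[OF inj] hs_vac pauli_Z_vac_entry)
  finally show ?thesis .
qed

text \<open>The string is itself a quadratic monomial up to phase; its pairing with that monomial
  has modulus \<open>2 ^ n\<close>.\<close>

lemma weight_pauli_Z_ge:
  assumes q: "q < n"
  shows "weight n 2 (pauli n 0 {q}) \<ge> 4 ^ n"
proof -
  obtain c where c: "cmod c = 1" "pauli n 0 {q} = c \<cdot>\<^sub>m gam n (pairs {q})"
    using pauli_Z_gam[of "{q}" n] q by auto
  have sub: "pairs {q} \<subseteq> {..<2 * n}" using pairs_subset[of "{q}" n] q by simp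
  have g: "gam n (pairs {q}) \<in> ops n" using sub by simp
  have "hs n (pauli n 0 {q}) (pauli n 0 {q}) = (\<Sum>x<(2::nat) ^ n. 1)"
    unfolding hs_pauli_Z by (intro sum.cong) (auto simp: pauli_entry simp flip: of_real_mult)
  then have "c * hs n (pauli n 0 {q}) (gam n (pairs {q})) = 2 ^ n"
    using hs_smult_right[OF g, of "pauli n 0 {q}" c] by (simp add: c(2)[symmetric])
  then have "cmod (hs n (pauli n 0 {q}) (gam n (pairs {q}))) = 2 ^ n"
    using c(1) by (metis mult_1 norm_mult norm_numeral norm_power)
  then have "4 ^ n = (\<Sum>I\<in>{pairs {q}}. (cmod (hs n (pauli n 0 {q}) (gam n I)))\<^sup>2)"
    by (simp add: power2_eq_square flip: power_mult_distrib)
  also have "\<dots> \<le> weight n 2 (pauli n 0 {q})"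
    by (rule weight_ge) (use sub card_pairs[of "{q}"] in simp)
  finally show ?thesis .
qed

lemma signed_sum_le_1:
  assumes "(\<Sum>x\<in>A. p x) = 1" "\<And>x. x \<in> A \<Longrightarrow> p x \<ge> 0"
  shows "\<bar>\<Sum>x\<in>A. chi C x * p x\<bar> \<le> 1"
proof -
  have "\<bar>\<Sum>x\<in>A. chi C x * p x\<bar> \<le> (\<Sum>x\<in>A. \<bar>chi C x * p x\<bar>)" by (rule sum_abs)
  also have "\<dots> = (\<Sum>x\<in>A. p x)"
  proof (intro sum.cong refl)
    fix x assume "x \<in> A"
    then show "\<bar>chi C x * p x\<bar> = p x"
      using chi_cases[of C x] assms(2) by (auto simp: abs_mult)
  qed
  finally show ?thesis using assms by simp
qed

context matchgate_haar
begin

lemma M_unitary: "R \<in> space \<mu> \<Longrightarrow> M R * adj (M R) = 1\<^sub>m (2 ^ n)"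
  using M_is_matchgate by (simp add: is_matchgate_unitary_iff)

lemma M_amplitude_fourth_moment_le:
  "4 ^ n * (\<integral>R. cmod (M R $$ (0, 0)) ^ 4 \<partial>\<mu>) \<le> real n + 1"
proof -
  have eq: "(\<integral>R. cmod (M R $$ (0, 0)) ^ 4 \<partial>\<mu>) =
      (\<integral>R. (cmod (hs n (vac n) (M R * vac n * adj (M R))))\<^sup>2 \<partial>\<mu>)"
  proof (rule Bochner_Integration.integral_cong[OF refl])
    fix R assume "R \<in> space \<mu>"
    then show "cmod (M R $$ (0, 0)) ^ 4 = (cmod (hs n (vac n) (M R * vac n * adj (M R))))\<^sup>2"
      by (simp add: hs_vac conj_unit_mat_entry M_carrier norm_mult power2_eq_square power4_eq_xxxx mult.assoc)
  qed
  have "4 ^ n * (\<integral>R. cmod (M R $$ (0, 0)) ^ 4 \<partial>\<mu>) =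
      (\<Sum>Q\<in>Pow {..<n}. weight n (2 * card Q) (vac n) / real ((2 * n) choose (2 * card Q)))"
    unfolding eq integral_hs_vac[OF unit_mat_carrier] by simp
  \<comment> \<open>After this bound the sets of each size contribute one in total, which yields
    \<open>n + 1\<close>.\<close>
  also have "\<dots> \<le> (\<Sum>Q\<in>Pow {..<n}. 1 / real (n choose card Q))"
  proof (rule sum_mono)
    fix Q assume "Q \<in> Pow {..<n}"
    then have "card Q \<le> n" using card_mono[of "{..<n}" Q] by simp
    then have pos: "real (n choose card Q) > 0" "real ((2 * n) choose (2 * card Q)) > 0" by simp_all
    have "weight n (2 * card Q) (vac n) * real (n choose card Q) \<le>
        real (n choose card Q) * real (n choose card Q)"
      using weight_vac_le[of n "card Q"] by (intro mult_right_mono) auto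
    also have "\<dots> \<le> real ((2 * n) choose (2 * card Q))"
      using choose_square_le[of n "card Q"] by (simp flip: of_nat_mult)
    finally show "weight n (2 * card Q) (vac n) / real ((2 * n) choose (2 * card Q)) \<le>
        1 / real (n choose card Q)"
      using pos by (simp add: field_simps)
  qed
  also have "\<dots> = (\<Sum>k\<le>n. real (n choose k) * (1 / real (n choose k)))"
    by (rule sum_Pow_card)
  also have "\<dots> = (\<Sum>k\<le>n. 1)" by (intro sum.cong) auto
  finally show ?thesis by simp
qed

text \<open>Of all \<open>Q\<close> in \<open>integral_hs_vac\<close> only the \<open>n\<close>
  singletons are kept. Each has weight at least \<open>4 ^ n\<close> over
  \<open>(2 * n) choose 2\<close>, which is \<open>n\<close> times \<open>2 * n - 1\<close>, and
  \<open>4 ^ n\<close> cancels the normalization.\<close>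

lemma col_z_second_moment_ge:
  assumes k: "k < n"
  shows "(\<integral>R. (col_z n k (M R))\<^sup>2 \<partial>\<mu>) \<ge> 1 / (2 * real n - 1)"
proof -
  let ?Z = "pauli n 0 {k}"
  let ?w = "\<lambda>Q. weight n (2 * card Q) ?Z / real ((2 * n) choose (2 * card Q))"
  have "(\<integral>R. (col_z n k (M R))\<^sup>2 \<partial>\<mu>) = (\<integral>R. (cmod (hs n ?Z (M R * vac n * adj (M R))))\<^sup>2 \<partial>\<mu>)"
  proof (rule Bochner_Integration.integral_cong[OF refl])
    fix R assume R: "R \<in> space \<mu>"
    have "hs n ?Z (M R * vac n * adj (M R)) = complex_of_real (col_z n k (M R))"
      using M_carrier[OF R]
      by (simp add: hs_pauli_Z conj_unit_mat_entry col_z_def complex_norm_square del: of_real_power)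
    then show "(col_z n k (M R))\<^sup>2 = (cmod (hs n ?Z (M R * vac n * adj (M R))))\<^sup>2"
      by simp
  qed
  also have "\<dots> = (\<Sum>Q\<in>Pow {..<n}. ?w Q) / 4 ^ n"
    by (rule integral_hs_vac) simp
  also have "\<dots> \<ge> (\<Sum>Q\<in>(\<lambda>q. {q}) ` {..<n}. ?w Q) / 4 ^ n"
    by (intro divide_right_mono sum_mono2) (auto simp: weight_nonneg)
  also have "(\<Sum>Q\<in>(\<lambda>q. {q}) ` {..<n}. ?w Q) = real n * (weight n 2 ?Z / (real n * (2 * real n - 1)))"
    by (simp add: sum.reindex choose_two_double)
  also have "\<dots> = weight n 2 ?Z / (2 * real n - 1)"
    using k by simp
  also have "\<dots> / 4 ^ n \<ge> (4 ^ n / (2 * real n - 1)) / 4 ^ n"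
    using weight_pauli_Z_ge[OF k] k by (intro divide_right_mono) auto
  finally show ?thesis by simp
qed

text \<open>The roles are exchanged: the conjugated operator is one quadratic monomial, and the
  vacuum has weight at least \<open>n\<close> in degree two, again divided by
  \<open>(2 * n) choose 2\<close>.\<close>

lemma row_z_second_moment_ge:
  assumes k: "k < n"
  shows "(\<integral>R. (row_z n k (M R))\<^sup>2 \<partial>\<mu>) \<ge> 1 / (2 * real n - 1)"
proof -
  obtain c where c: "cmod c = 1" "pauli n 0 {k} = c \<cdot>\<^sub>m gam n (pairs {k})"
    using pauli_Z_gam[of "{k}" n] k by auto
  have sub: "pairs {k} \<subseteq> {..<2 * n}" using pairs_subset[of "{k}" n] k by simp
  have "(\<integral>R. (row_z n k (M R))\<^sup>2 \<partial>\<mu>) = (\<integral>R. (cmod (hs n (vac n) (gam_rot n R (pairs {k}))))\<^sup>2 \<partial>\<mu>)"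
  proof (rule Bochner_Integration.integral_cong[OF refl])
    fix R assume R: "R \<in> space \<mu>"
    have "M R * pauli n 0 {k} * adj (M R) = c \<cdot>\<^sub>m (M R * gam n (pairs {k}) * adj (M R))"
      unfolding c(2) using M_carrier[OF R] sub
      by (simp add: sq_ring[where d = "2^n"])
    also have "\<dots> = c \<cdot>\<^sub>m gam_rot n R (pairs {k})"
      by (simp add: conj_gam[OF M_is_matchgate[OF R] sub])
    finally have "complex_of_real (row_z n k (M R)) = c * gam_rot n R (pairs {k}) $$ (0, 0)"
      using conj_pauli_Z_diag[OF M_carrier[OF R], of 0 "{k}"]
      by (simp add: row_z_def smult_entry[OF gam_rot_carrier])
    then have "cmod (complex_of_real (row_z n k (M R))) = cmod (gam_rot n R (pairs {k}) $$ (0, 0))"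
      using c(1) by (simp add: norm_mult)
    then have "\<bar>row_z n k (M R)\<bar> = cmod (gam_rot n R (pairs {k}) $$ (0, 0))"
      by (simp only: norm_of_real)
    then show "(row_z n k (M R))\<^sup>2 = (cmod (hs n (vac n) (gam_rot n R (pairs {k}))))\<^sup>2"
      by (metis hs_vac power2_abs)
  qed
  also have "\<dots> = weight n 2 (vac n) / (real n * (2 * real n - 1))"
    using integral_hs_square[OF unit_mat_carrier sub] card_pairs[of "{k}"] by (simp add: choose_two_double)
  also have "\<dots> \<ge> real n / (real n * (2 * real n - 1))"
    using weight_vac_ge k by (intro divide_right_mono) auto
  finally show ?thesis using k by simp
qed

lemma col_z_le_1: "R \<in> space \<mu> \<Longrightarrow> \<bar>col_z n k (M R)\<bar> \<le> 1"
  unfolding col_z_def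
  by (rule signed_sum_le_1, rule unitary_col[OF M_carrier M_unitary]) auto

lemma row_z_le_1: "R \<in> space \<mu> \<Longrightarrow> \<bar>row_z n k (M R)\<bar> \<le> 1"
  unfolding row_z_def
  by (rule signed_sum_le_1, rule unitary_row[OF M_carrier M_unitary]) auto

text \<open>An entry of a conjugated matrix unit, so the choice of phase in \<open>M R\<close>
  cancels.\<close>

lemma measurable_amplitude:
  assumes x: "x < 2 ^ n" "x' < 2 ^ n" and y: "y < 2 ^ n" "y' < 2 ^ n"
  shows "(\<lambda>R. M R $$ (x, y) * cnj (M R $$ (x', y'))) \<in> borel_measurable \<mu>"
proof -
  have eq: "(M R * unit_mat n y y' * adj (M R)) $$ (x, x') = M R $$ (x, y) * cnj (M R $$ (x', y'))"
    if "R \<in> space \<mu>" for R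
    using M_carrier[OF that] x y by (simp add: conj_unit_mat_entry)
  show ?thesis
    using measurable_conj_entry[OF unit_mat_carrier x] by (subst measurable_cong[OF eq[symmetric]])
qed

lemma measurable_probability:
  assumes "x < 2 ^ n" "y < 2 ^ n"
  shows "(\<lambda>R. (cmod (M R $$ (x, y)))\<^sup>2) \<in> borel_measurable \<mu>"
proof -
  have "(\<lambda>R. Re (M R $$ (x, y) * cnj (M R $$ (x, y)))) \<in> borel_measurable \<mu>"
    by (rule measurable_compose[OF measurable_amplitude borel_measurable_continuous_onI])
      (use assms in \<open>auto intro!: continuous_intros\<close>)
  then show ?thesis by (simp only: complex_norm_square[symmetric] Re_complex_of_real)
qed

lemma integrable_col_z: "integrable \<mu> (\<lambda>R. (col_z n k (M R))\<^sup>2)"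
  and integrable_row_z: "integrable \<mu> (\<lambda>R. (row_z n k (M R))\<^sup>2)"
proof -
  have "(\<lambda>R. (col_z n k (M R))\<^sup>2) \<in> borel_measurable \<mu>" "(\<lambda>R. (row_z n k (M R))\<^sup>2) \<in> borel_measurable \<mu>"
    unfolding col_z_def row_z_def
    by (intro borel_measurable_power borel_measurable_sum borel_measurable_times borel_measurable_const
        measurable_probability; simp)+
  then show "integrable \<mu> (\<lambda>R. (col_z n k (M R))\<^sup>2)" "integrable \<mu> (\<lambda>R. (row_z n k (M R))\<^sup>2)"
    using col_z_le_1 row_z_le_1
    by (auto intro!: integrable_const_bound[where B = 1] AE_I2 simp: abs_square_le_1)
qed

end

subsection \<open>Layers of disjoint blocks\<close>

lemma bit_subindex: "bit (subindex qs x) k \<longleftrightarrow> k < length qs \<and> bit x (qs ! k)"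
  by (auto simp: subindex_def bit_horner_sum_bit_iff)

lemma subindex_less: "subindex qs x < 2 ^ length qs"
  unfolding subindex_def using horner_sum_of_bool_2_less[of "map (bit x) qs"] by simp

lemma subindex_cong: "(\<And>q. q \<in> set qs \<Longrightarrow> bit x q = bit y q) \<Longrightarrow> subindex qs x = subindex qs y"
  by (intro bit_eqI) (auto simp: bit_subindex)

lemma subindex_xor: "subindex qs (x XOR y) = subindex qs x XOR subindex qs y"
  by (intro bit_eqI) (auto simp: bit_subindex bit_xor_iff)

lemma subindex_zero [simp]: "subindex qs 0 = 0"
  by (intro bit_eqI) (auto simp: bit_subindex)

text \<open>One bijection encodes that blocks are disjoint, cover all qubits and list each qubit
  once; products over qubits are reindexed along it.\<close>

locale block_partition =
  fixes n N h :: nat and qs :: "nat \<Rightarrow> nat list"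
  assumes length_qs: "b < h \<Longrightarrow> length (qs b) = N"
    and bij_qs: "bij_betw (\<lambda>(b, k). qs b ! k) ({..<h} \<times> {..<N}) {..<n}"
begin

lemma n_eq: "n = h * N"
  using bij_betw_same_card[OF bij_qs] by simp

lemma qs_less: "b < h \<Longrightarrow> k < N \<Longrightarrow> qs b ! k < n"
  using bij_betw_apply[OF bij_qs, of "(b, k)"] by simp

lemma set_qs: "b < h \<Longrightarrow> set (qs b) = (\<lambda>k. qs b ! k) ` {..<N}"
  using length_qs by (auto simp: set_conv_nth)

lemma qs_disjoint: "b < h \<Longrightarrow> b' < h \<Longrightarrow> q \<in> set (qs b) \<Longrightarrow> q \<in> set (qs b') \<Longrightarrow> b = b'"
  using bij_qs unfolding bij_betw_def inj_on_def by (auto simp: set_qs)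

lemma qs_cover: "q < n \<Longrightarrow> \<exists>b<h. q \<in> set (qs b)"
proof -
  assume "q < n"
  then have "q \<in> (\<lambda>(b, k). qs b ! k) ` ({..<h} \<times> {..<N})"
    using bij_qs by (simp add: bij_betw_def)
  then show ?thesis by (auto simp: set_qs)
qed

lemma sub_less: "b < h \<Longrightarrow> subindex (qs b) x < 2 ^ N"
  using subindex_less[of "qs b" x] length_qs by simp

lemma sub_inj:
  assumes "x < 2 ^ n" "y < 2 ^ n" "\<And>b. b < h \<Longrightarrow> subindex (qs b) x = subindex (qs b) y"
  shows "x = y"
proof -
  have "bit x q = bit y q" if "q < n" for q
  proof -
    obtain b where b: "b < h" "q \<in> set (qs b)" using qs_cover[OF \<open>q < n\<close>] by blast
    then obtain k where k: "k < length (qs b)" "qs b ! k = q" by (auto simp: in_set_conv_nth)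
    have "bit (subindex (qs b) x) k = bit (subindex (qs b) y) k" using assms(3)[OF b(1)] by simp
    then show ?thesis using k by (simp add: bit_subindex)
  qed
  then show ?thesis using nat_eq_iff_bits[OF assms(1,2)] by blast
qed

text \<open>Injective because the blocks cover all qubits, and then onto by counting, since
  \<open>n = h * N\<close>.\<close>

lemma bij_sub:
  "bij_betw (\<lambda>x. \<lambda>b\<in>{..<h}. subindex (qs b) x) {..<2 ^ n} (PiE {..<h} (\<lambda>_. {..<2 ^ N}))"
proof -
  let ?f = "\<lambda>x. \<lambda>b\<in>{..<h}. subindex (qs b) x"
  have inj: "inj_on ?f {..<2 ^ n}"
  proof (rule inj_onI)
    fix x y assume xy: "x \<in> {..<2 ^ n}" "y \<in> {..<2 ^ n}" "?f x = ?f y"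
    have "subindex (qs b) x = subindex (qs b) y" if "b < h" for b
      using fun_cong[OF xy(3), of b] that by simp
    then show "x = y" using xy sub_inj by auto
  qed
  have sub: "?f ` {..<2 ^ n} \<subseteq> PiE {..<h} (\<lambda>_. {..<2 ^ N})"
    using sub_less by (auto split: if_splits)
  have "card (?f ` {..<2 ^ n}) = card {..<(2::nat) ^ n}"
    by (rule card_image[OF inj])
  also have "\<dots> = (2 ^ N) ^ h"
    by (metis card_lessThan n_eq mult.commute power_mult)
  also have "\<dots> = card (PiE {..<h} (\<lambda>_. {..<(2::nat) ^ N}))"
    by (simp add: card_PiE)
  finally have "card (?f ` {..<2 ^ n}) = card (PiE {..<h} (\<lambda>_. {..<(2::nat) ^ N}))" .
  then have "?f ` {..<2 ^ n} = PiE {..<h} (\<lambda>_. {..<2 ^ N})"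
    by (intro card_subset_eq[OF finite_PiE sub]) auto
  then show ?thesis using inj by (simp add: bij_betw_def)
qed

lemma sum_factor:
  fixes f :: "nat \<Rightarrow> nat \<Rightarrow> 'a :: comm_semiring_1"
  shows "(\<Sum>x<2 ^ n. \<Prod>b<h. f b (subindex (qs b) x)) = (\<Prod>b<h. \<Sum>s<2 ^ N. f b s)"
proof -
  have "(\<Prod>b<h. \<Sum>s<2 ^ N. f b s) = (\<Sum>g\<in>PiE {..<h} (\<lambda>_. {..<2 ^ N}). \<Prod>b<h. f b (g b))"
    by (rule prod_sum_PiE) auto
  also have "\<dots> = (\<Sum>x<2 ^ n. \<Prod>b<h. f b ((\<lambda>b\<in>{..<h}. subindex (qs b) x) b))"
    by (rule sum.reindex_bij_betw[OF bij_sub, symmetric])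
  also have "\<dots> = (\<Sum>x<2 ^ n. \<Prod>b<h. f b (subindex (qs b) x))"
    by (intro sum.cong prod.cong) auto
  finally show ?thesis by simp
qed

lemma chi_factor:
  assumes C: "C \<subseteq> {..<n}"
  shows "chi C x = (\<Prod>b<h. chi {k. k < N \<and> qs b ! k \<in> C} (subindex (qs b) x))"
proof -
  let ?s = "\<lambda>q. if q \<in> C then (if bit x q then - 1 else 1) else (1 :: real)"
  have "{..<n} \<inter> {q. q \<in> C} = C" using C by auto
  then have "chi C x = (\<Prod>q<n. ?s q)"
    unfolding chi_def by (simp add: prod.If_cases)
  also have "\<dots> = (\<Prod>p\<in>{..<h} \<times> {..<N}. ?s ((\<lambda>(b, k). qs b ! k) p))"
    by (rule prod.reindex_bij_betw[OF bij_qs, symmetric])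
  also have "\<dots> = (\<Prod>b<h. \<Prod>k<N. ?s (qs b ! k))"
    by (subst prod.cartesian_product, rule prod.cong) auto
  also have "\<dots> = (\<Prod>b<h. chi {k. k < N \<and> qs b ! k \<in> C} (subindex (qs b) x))"
  proof (intro prod.cong refl)
    fix b assume "b \<in> {..<h}"
    then have b: "b < h" by simp
    have "chi {k. k < N \<and> qs b ! k \<in> C} (subindex (qs b) x) =
        (\<Prod>k\<in>{k. k < N \<and> qs b ! k \<in> C}. if bit x (qs b ! k) then - 1 else 1)"
      unfolding chi_def using length_qs[OF b] by (intro prod.cong) (auto simp: bit_subindex)
    also have "\<dots> = (\<Prod>k<N. ?s (qs b ! k))"
      by (rule prod.mono_neutral_cong_left) auto
    finally show "(\<Prod>k<N. ?s (qs b ! k)) = chi {k. k < N \<and> qs b ! k \<in> C} (subindex (qs b) x)" by simp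
  qed
  finally show ?thesis .
qed

text \<open>Stated for the blocks from \<open>k\<close> on, so that blocks can be added from the
  right. On qubits that these blocks do not reach the product acts as the identity, hence the
  condition on the bits.\<close>

lemma layer_suffix_entry:
  assumes "k \<le> h" "x < 2 ^ n" "y < 2 ^ n"
  shows "foldr (*) (map (\<lambda>b. act_on n (qs b) (U b)) [k..<h]) (1\<^sub>m (2 ^ n)) $$ (x, y) =
    (if \<forall>j<n. (\<forall>b\<in>{k..<h}. j \<notin> set (qs b)) \<longrightarrow> bit x j = bit y j
     then \<Prod>b\<in>{k..<h}. U b $$ (subindex (qs b) x, subindex (qs b) y) else 0)"
  using assms
proof (induction arbitrary: x rule: inc_induct)
  case base
  then show ?case using nat_eq_iff_bits[of x n y] by auto
next
  case (step k)
  let ?T = "\<lambda>k. foldr (*) (map (\<lambda>b. act_on n (qs b) (U b)) [k..<h]) (1\<^sub>m (2 ^ n))"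
  have k: "k < h" using step by simp
  have Tc: "?T k \<in> ops n" for k
    by (rule foldr_mult_smult[THEN conjunct2]) auto
  \<comment> \<open>The only intermediate state that contributes: block \<open>k\<close> has already
    been brought to the bits of \<open>y\<close> on the right-hand side, all other qubits carry
    those of \<open>x\<close>. The outer \<open>subindex\<close> does not change the value and
    serves to bound it by \<open>2 ^ n\<close>.\<close>
  define z0 where "z0 = subindex [0..<n] (horner_sum of_bool 2 (map (\<lambda>j. if j \<in> set (qs k) then bit y j else bit x j) [0..<n]) :: nat)"
  have z0: "z0 < 2 ^ n" using subindex_less[of "[0..<n]"] by (simp add: z0_def)
  have bit_z0: "bit z0 j = (if j \<in> set (qs k) then bit y j else bit x j)" if "j < n" for j
    using that by (simp add: z0_def bit_subindex bit_horner_sum_bit_iff)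
  let ?R = "\<lambda>j. \<forall>b\<in>{Suc k..<h}. j \<notin> set (qs b)"
  have disj: "?R j" if "j \<in> set (qs k)" for j
    using qs_disjoint[of k] k that by fastforce
  define c where "c \<longleftrightarrow> (\<forall>j<n. (\<forall>b\<in>{k..<h}. j \<notin> set (qs b)) \<longrightarrow> bit x j = bit y j)"
  let ?p = "\<Prod>b\<in>{k..<h}. U b $$ (subindex (qs b) x, subindex (qs b) y)"
  have split: "(\<forall>b\<in>{k..<h}. j \<notin> set (qs b)) \<longleftrightarrow> j \<notin> set (qs k) \<and> ?R j" for j
    using k by (auto simp: Suc_le_eq order_le_less)
  have cond: "(\<forall>j<n. ?R j \<longrightarrow> bit z0 j = bit y j) \<longleftrightarrow> c"
    unfolding c_def split using bit_z0 disj by auto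
  have p_split: "?p = U k $$ (subindex (qs k) x, subindex (qs k) y) *
      (\<Prod>b\<in>{Suc k..<h}. U b $$ (subindex (qs b) x, subindex (qs b) y))"
    using k by (simp add: prod.atLeast_Suc_lessThan)
  have term_eq: "act_on n (qs k) (U k) $$ (x, z) * ?T (Suc k) $$ (z, y) =
      (if z = z0 then if c then ?p else 0 else 0)" if z: "z < 2 ^ n" for z
  proof (cases "z = z0")
    case True
    have "\<forall>j<n. j \<notin> set (qs k) \<longrightarrow> bit x j = bit z0 j" using bit_z0 by simp
    moreover have "subindex (qs k) z0 = subindex (qs k) y"
      using bit_z0 qs_less k by (intro subindex_cong) (auto simp: set_qs)
    ultimately have 1: "act_on n (qs k) (U k) $$ (x, z0) = U k $$ (subindex (qs k) x, subindex (qs k) y)"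
      using step.prems z0 by (simp add: act_on_def)
    have "subindex (qs b) z0 = subindex (qs b) x" if "b \<in> {Suc k..<h}" for b
    proof (rule subindex_cong)
      fix q assume q: "q \<in> set (qs b)"
      then have "q \<notin> set (qs k)" using qs_disjoint[of b k q] that k by auto
      moreover have "q < n" using q that qs_less by (auto simp: set_qs)
      ultimately show "bit z0 q = bit x q" using bit_z0 by simp
    qed
    then have "(\<Prod>b\<in>{Suc k..<h}. U b $$ (subindex (qs b) z0, subindex (qs b) y)) =
        (\<Prod>b\<in>{Suc k..<h}. U b $$ (subindex (qs b) x, subindex (qs b) y))"
      by (intro prod.cong) simp_all
    then have 2: "?T (Suc k) $$ (z0, y) =
        (if c then \<Prod>b\<in>{Suc k..<h}. U b $$ (subindex (qs b) x, subindex (qs b) y) else 0)"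
      using step.IH[OF z0 step.prems(2)] unfolding cond by simp
    show ?thesis using True 1 2 p_split by simp
  next
    case False
    then obtain j where j: "j < n" "bit z j \<noteq> bit z0 j" using nat_eq_iff_bits[OF z z0] by blast
    show ?thesis
    proof (cases "j \<in> set (qs k)")
      case True
      then have "?T (Suc k) $$ (z, y) = 0"
        using step.IH[OF z step.prems(2)] j bit_z0[OF j(1)] disj[OF True] by auto
      then show ?thesis using False by simp
    next
      case nin: False
      then have "act_on n (qs k) (U k) $$ (x, z) = 0"
        using j bit_z0[OF j(1)] step.prems z by (auto simp: act_on_def)
      then show ?thesis using False by simp
    qed
  qed
  have "?T k = act_on n (qs k) (U k) * ?T (Suc k)"
    using k by (simp add: upt_conv_Cons)
  then have "?T k $$ (x, y) = (\<Sum>z<2 ^ n. act_on n (qs k) (U k) $$ (x, z) * ?T (Suc k) $$ (z, y))"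
    using step.prems by (simp only:) (rule mult_entry[OF act_on_carrier Tc])
  also have "\<dots> = (\<Sum>z<2 ^ n. if z = z0 then if c then ?p else 0 else 0)"
    by (intro sum.cong refl term_eq) simp
  also have "\<dots> = (if c then ?p else 0)"
    using z0 by simp
  finally show ?case unfolding c_def .
qed

lemma layer_entry:
  assumes "x < 2 ^ n" "y < 2 ^ n"
  shows "foldr (*) (map (\<lambda>b. act_on n (qs b) (U b)) [0..<h]) (1\<^sub>m (2 ^ n)) $$ (x, y) =
    (\<Prod>b<h. U b $$ (subindex (qs b) x, subindex (qs b) y))"
proof -
  have "\<forall>j<n. (\<forall>b\<in>{0..<h}. j \<notin> set (qs b)) \<longrightarrow> bit x j = bit y j"
    using qs_cover by fastforce
  then show ?thesis
    using layer_suffix_entry[OF _ assms, of 0 U] by (simp add: atLeast0LessThan)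
qed

end

lemma block_partition_block_qubits:
  assumes "\<xi> > 0" "n = h * (2 * \<xi>)"
  shows "block_partition n (2 * \<xi>) h (block_qubits n \<xi> l)"
proof
  have nth: "block_qubits n \<xi> l b ! k = (b * (2 * \<xi>) + k + l * \<xi>) mod n" if "k < 2 * \<xi>" for b k
    using that by (simp add: block_qubits_def algebra_simps)
  show "length (block_qubits n \<xi> l b) = 2 * \<xi>" if "b < h" for b
    by (simp add: block_qubits_def algebra_simps)
  let ?f = "\<lambda>(b, k). block_qubits n \<xi> l b ! k"
  have inj: "inj_on ?f ({..<h} \<times> {..<2 * \<xi>})"
  proof (rule inj_onI, clarify)
    fix b k b' k' assume b: "b < h" "b' < h" and k: "k < 2 * \<xi>" "k' < 2 * \<xi>"
      and eq: "block_qubits n \<xi> l b ! k = block_qubits n \<xi> l b' ! k'"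
    have less: "b * (2 * \<xi>) + k < n" if "b < h" "k < 2 * \<xi>" for b k
    proof -
      have "b * (2 * \<xi>) + k < (b + 1) * (2 * \<xi>)" using that by simp
      also have "\<dots> \<le> n" unfolding assms(2) using that by (intro mult_right_mono) auto
      finally show ?thesis .
    qed
    have "[b * (2 * \<xi>) + k + l * \<xi> = b' * (2 * \<xi>) + k' + l * \<xi>] (mod n)"
      using eq k by (simp add: nth cong_def)
    \<comment> \<open>The cyclic shift of the layer cancels modulo \<open>n\<close>; both unshifted
      positions are below \<open>n\<close>, so the congruence becomes an equality.\<close>
    then have "[b * (2 * \<xi>) + k = b' * (2 * \<xi>) + k'] (mod n)"
      by (simp only: cong_add_rcancel_nat)
    then have *: "b * (2 * \<xi>) + k = b' * (2 * \<xi>) + k'"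
      using less[OF b(1) k(1)] less[OF b(2) k(2)] by (simp add: cong_def)
    have "(b * (2 * \<xi>) + k) div (2 * \<xi>) = b" "(b' * (2 * \<xi>) + k') div (2 * \<xi>) = b'"
      using k by simp_all
    then have "b = b'" using * by simp
    then show "b = b' \<and> k = k'" using * by simp
  qed
  have "?f ` ({..<h} \<times> {..<2 * \<xi>}) \<subseteq> {..<n}"
  proof (rule image_subsetI)
    fix p assume "p \<in> {..<h} \<times> {..<2 * \<xi>}"
    then obtain b k where p: "p = (b, k)" "b < h" "k < 2 * \<xi>" by auto
    then have "n > 0" using assms by auto
    then show "?f p \<in> {..<n}" using p by (simp add: nth)
  qed
  moreover have "card (?f ` ({..<h} \<times> {..<2 * \<xi>})) = card {..<n}"
    by (simp only: card_image[OF inj]) (simp add: assms)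
  ultimately have "?f ` ({..<h} \<times> {..<2 * \<xi>}) = {..<n}"
    by (intro card_subset_eq) auto
  then show "bij_betw ?f ({..<h} \<times> {..<2 * \<xi>}) {..<n}"
    using inj by (simp add: bij_betw_def)
qed

subsection \<open>Averaging over Pauli strings\<close>

lemma chi_parseval:
  fixes w :: "nat \<Rightarrow> complex"
  shows "(\<Sum>C\<in>Pow {..<n}. (cmod (\<Sum>y<2 ^ n. complex_of_real (chi C y) * w y))\<^sup>2) =
    2 ^ n * (\<Sum>y<2 ^ n. (cmod (w y))\<^sup>2)"
proof -
  let ?P = "Pow {..<n}"
  have "complex_of_real (\<Sum>C\<in>?P. (cmod (\<Sum>y<2 ^ n. complex_of_real (chi C y) * w y))\<^sup>2) =
      (\<Sum>C\<in>?P. \<Sum>y<2 ^ n. \<Sum>z<2 ^ n. (w y * cnj (w z)) * complex_of_real (chi C y * chi C z))"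
    unfolding of_real_sum complex_norm_square
    by (intro sum.cong refl) (simp add: sum_product mult_ac)
  also have "\<dots> = (\<Sum>y<2 ^ n. \<Sum>z<2 ^ n. \<Sum>C\<in>?P. (w y * cnj (w z)) * complex_of_real (chi C y * chi C z))"
    by (subst sum.swap, subst (2) sum.swap) (rule refl)
  also have "\<dots> = (\<Sum>y<2 ^ n. \<Sum>z<2 ^ n. if z = y then 2 ^ n * (w y * cnj (w y)) else 0)"
  proof (intro sum.cong refl)
    fix y z :: nat assume "y \<in> {..<2 ^ n}" "z \<in> {..<2 ^ n}"
    then show "(\<Sum>C\<in>?P. (w y * cnj (w z)) * complex_of_real (chi C y * chi C z)) =
        (if z = y then 2 ^ n * (w y * cnj (w y)) else 0)"
      unfolding sum_distrib_left[symmetric] of_real_sum[symmetric]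
      by (subst sum_chi_mult[of _ n]) auto
  qed
  also have "\<dots> = (\<Sum>y<2 ^ n. 2 ^ n * (w y * cnj (w y)))"
    by simp
  also have "\<dots> = complex_of_real (2 ^ n * (\<Sum>y<2 ^ n. (cmod (w y))\<^sup>2))"
    by (simp add: sum_distrib_left flip: complex_norm_square)
  finally show ?thesis by (simp only: of_real_eq_iff)
qed

lemma chi_parseval_dual:
  fixes g :: "nat \<Rightarrow> real"
  shows "(\<Sum>Q\<in>Pow {..<n}. (\<Sum>a<2 ^ n. chi Q a * g a)\<^sup>2) = 2 ^ n * (\<Sum>a<2 ^ n. (g a)\<^sup>2)"
proof -
  have "cmod (\<Sum>y<2 ^ n. complex_of_real (chi C y) * complex_of_real (g y)) = \<bar>\<Sum>a<2 ^ n. chi C a * g a\<bar>" for C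
    unfolding of_real_mult[symmetric] of_real_sum[symmetric] by (rule norm_of_real)
  then show ?thesis
    using chi_parseval[where n = n and w = "\<lambda>y. complex_of_real (g y)"] by simp
qed

lemma chi_convolution:
  fixes p q :: "nat \<Rightarrow> real"
  shows "(\<Sum>a<2 ^ n. chi Q a * (\<Sum>y<2 ^ n. p (y XOR a) * q y)) =
    (\<Sum>y<2 ^ n. chi Q y * p y) * (\<Sum>y<2 ^ n. chi Q y * q y)"
proof -
  have "(\<Sum>a<2 ^ n. chi Q a * (\<Sum>y<2 ^ n. p (y XOR a) * q y)) =
      (\<Sum>y<2 ^ n. \<Sum>a<2 ^ n. chi Q a * (p (y XOR a) * q y))"
    unfolding sum_distrib_left by (rule sum.swap)
  also have "\<dots> = (\<Sum>y<2 ^ n. \<Sum>z<2 ^ n. (chi Q z * p z) * (chi Q y * q y))"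
  proof (rule sum.cong[OF refl])
    fix y :: nat assume "y \<in> {..<2 ^ n}"
    then have bij: "bij_betw (\<lambda>a. a XOR y) {..<2 ^ n} {..<2 ^ n}" by (intro bij_betw_xor) simp
    have "(\<Sum>z<2 ^ n. (chi Q z * p z) * (chi Q y * q y)) =
        (\<Sum>a<2 ^ n. (chi Q (a XOR y) * p (a XOR y)) * (chi Q y * q y))"
      by (rule sum.reindex_bij_betw[OF bij, symmetric])
    also have "\<dots> = (\<Sum>a<2 ^ n. chi Q a * (p (y XOR a) * q y))"
    proof (intro sum.cong refl)
      fix a :: nat assume "a \<in> {..<2 ^ n}"
      have "chi Q (a XOR y) * chi Q y = chi Q a" by (simp add: chi_xor mult.assoc)
      then show "(chi Q (a XOR y) * p (a XOR y)) * (chi Q y * q y) = chi Q a * (p (y XOR a) * q y)"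
        by (simp add: xor.commute mult_ac)
    qed
    finally show "(\<Sum>a<2 ^ n. chi Q a * (p (y XOR a) * q y)) =
        (\<Sum>z<2 ^ n. (chi Q z * p z) * (chi Q y * q y))" by simp
  qed
  also have "\<dots> = (\<Sum>y<2 ^ n. chi Q y * p y) * (\<Sum>y<2 ^ n. chi Q y * q y)"
    unfolding sum_product by (rule sum.swap)
  finally show ?thesis .
qed

text \<open>
  The average over the phases \<open>C\<close> is bounded below by Jensen's inequality, which leaves the
  convolution of the two output distributions; its Fourier coefficients factorize.
\<close>

lemma pauli_average_ge:
  fixes u v :: "nat \<Rightarrow> complex"
  assumes F: "F \<subseteq> Pow {..<n}"
  shows "(\<Sum>a<2 ^ n. \<Sum>C\<in>Pow {..<n}.
      cmod (\<Sum>y<2 ^ n. u (y XOR a) * complex_of_real (chi C y) * v y) ^ 4) \<ge>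
    (\<Sum>Q\<in>F. (\<Sum>y<2 ^ n. chi Q y * (cmod (u y))\<^sup>2)\<^sup>2 * (\<Sum>y<2 ^ n. chi Q y * (cmod (v y))\<^sup>2)\<^sup>2)"
proof -
  let ?P = "Pow {..<n}"
  define g where "g a = (\<Sum>y<2 ^ n. (cmod (u (y XOR a)))\<^sup>2 * (cmod (v y))\<^sup>2)" for a
  have inner: "(\<Sum>C\<in>?P. cmod (\<Sum>y<2 ^ n. u (y XOR a) * complex_of_real (chi C y) * v y) ^ 4) \<ge>
      2 ^ n * (g a)\<^sup>2" for a
  proof -
    define X where "X C = (cmod (\<Sum>y<2 ^ n. u (y XOR a) * complex_of_real (chi C y) * v y))\<^sup>2" for C
    have "(\<Sum>C\<in>?P. X C) = 2 ^ n * g a"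
      using chi_parseval[where n = n and w = "\<lambda>y. u (y XOR a) * v y"]
      by (simp add: X_def g_def norm_mult power_mult_distrib mult_ac)
    then have "(2 ^ n * g a)\<^sup>2 \<le> (\<Sum>C\<in>?P. (X C)\<^sup>2) * 2 ^ n"
      using sum_squared_le_sum_of_squares[of X ?P] by (simp add: card_Pow)
    then have "2 ^ n * (2 ^ n * (g a)\<^sup>2) \<le> 2 ^ n * (\<Sum>C\<in>?P. (X C)\<^sup>2)"
      by (simp add: power2_eq_square mult_ac)
    then have "2 ^ n * (g a)\<^sup>2 \<le> (\<Sum>C\<in>?P. (X C)\<^sup>2)"
      by (simp only: mult_le_cancel_left_pos zero_less_power zero_less_numeral)
    then show ?thesis by (simp add: X_def flip: power_mult)
  qed
  have "(\<Sum>Q\<in>F. (\<Sum>y<2 ^ n. chi Q y * (cmod (u y))\<^sup>2)\<^sup>2 * (\<Sum>y<2 ^ n. chi Q y * (cmod (v y))\<^sup>2)\<^sup>2)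
      = (\<Sum>Q\<in>F. (\<Sum>a<2 ^ n. chi Q a * g a)\<^sup>2)"
    unfolding g_def chi_convolution[where p = "\<lambda>y. (cmod (u y))\<^sup>2" and q = "\<lambda>y. (cmod (v y))\<^sup>2"]
    by (simp add: power_mult_distrib)
  \<comment> \<open>Adding the other characters only adds squares; Parseval's identity in the flip
    mask \<open>a\<close> then leads back to \<open>g\<close>.\<close>
  also have "\<dots> \<le> (\<Sum>Q\<in>?P. (\<Sum>a<2 ^ n. chi Q a * g a)\<^sup>2)"
    by (rule sum_mono2) (use F in auto)
  also have "\<dots> = (\<Sum>a<2 ^ n. 2 ^ n * (g a)\<^sup>2)"
    by (simp add: chi_parseval_dual sum_distrib_left)
  also have "\<dots> \<le> (\<Sum>a<2 ^ n. \<Sum>C\<in>?P. cmod (\<Sum>y<2 ^ n. u (y XOR a) * complex_of_real (chi C y) * v y) ^ 4)"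
    by (intro sum_mono inner)
  finally show ?thesis .
qed

text \<open>A finite product measure is determined by its values on rectangles, and a coordinatewise
  map pulls rectangles back to rectangles.\<close>

lemma distr_PiM_coordinatewise:
  assumes fin: "finite I" and M: "\<And>i. prob_space (M i)"
    and f: "\<And>i. i \<in> I \<Longrightarrow> f i \<in> M i \<rightarrow>\<^sub>M M i" and inv: "\<And>i. i \<in> I \<Longrightarrow> distr (M i) (M i) (f i) = M i"
  shows "(\<lambda>\<omega>. \<lambda>i\<in>I. f i (\<omega> i)) \<in> PiM I M \<rightarrow>\<^sub>M PiM I M"
    and "distr (PiM I M) (PiM I M) (\<lambda>\<omega>. \<lambda>i\<in>I. f i (\<omega> i)) = PiM I M"
proof -
  interpret product_prob_space M by (intro product_prob_spaceI M)
  let ?T = "\<lambda>\<omega>. \<lambda>i\<in>I. f i (\<omega> i)"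
  show T: "?T \<in> PiM I M \<rightarrow>\<^sub>M PiM I M"
  proof (rule measurable_restrict)
    fix i assume i: "i \<in> I"
    show "(\<lambda>\<omega>. f i (\<omega> i)) \<in> PiM I M \<rightarrow>\<^sub>M M i"
      by (rule measurable_compose[OF measurable_component_singleton[OF i, of M] f[OF i]])
  qed
  show "distr (PiM I M) (PiM I M) ?T = PiM I M"
  proof (rule PiM_eqI[OF fin])
    fix A assume A: "\<And>i. i \<in> I \<Longrightarrow> A i \<in> sets (M i)"
    let ?B = "\<lambda>i. f i -` A i \<inter> space (M i)"
    have B: "?B i \<in> sets (M i)" if "i \<in> I" for i
      using measurable_sets[OF f[OF that] A[OF that]] .
    have "?T -` PiE I A \<inter> space (PiM I M) = PiE I ?B"
      by (auto simp: space_PiM PiE_iff)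
    then have "emeasure (distr (PiM I M) (PiM I M) ?T) (PiE I A) = emeasure (PiM I M) (PiE I ?B)"
      using A fin by (subst emeasure_distr[OF T]) (auto intro: sets_PiM_I_finite)
    also have "\<dots> = (\<Prod>i\<in>I. emeasure (M i) (?B i))"
      by (rule emeasure_PiM[OF fin B])
    also have "\<dots> = (\<Prod>i\<in>I. emeasure (M i) (A i))"
      by (intro prod.cong refl) (metis A emeasure_distr f inv)
    finally show "emeasure (distr (PiM I M) (PiM I M) ?T) (PiE I A) = (\<Prod>i\<in>I. emeasure (M i) (A i))" .
  qed simp
qed

subsection \<open>The superblock ensemble\<close>

locale superblock =
  fixes haar :: "nat \<Rightarrow> real mat measure" and n \<xi> h :: nat
  assumes haar: "\<And>N. is_normalized_haar N (haar N)"
    and \<xi>_pos: "\<xi> > 0" and n_eq: "n = h * (2 * \<xi>)"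
begin

declare One_nat_def [simp del]

abbreviation N :: nat where "N \<equiv> 2 * \<xi>"

abbreviation \<mu> :: "real mat measure" where "\<mu> \<equiv> haar (4 * \<xi>)"

abbreviation Ind :: "(nat \<times> nat) set" where "Ind \<equiv> {0, 1} \<times> {..<h}"

abbreviation P :: "(nat \<times> nat \<Rightarrow> real mat) measure" where "P \<equiv> superblock_ensemble haar n \<xi>"

lemma h_eq: "(n div \<xi>) div 2 = h"
  using \<xi>_pos by (simp add: n_eq)

lemma P_eq: "P = PiM Ind (\<lambda>_. \<mu>)"
  by (simp only: superblock_ensemble_def h_eq)

sublocale H: matchgate_haar N \<mu>
  using haar[of "4 * \<xi>"] by unfold_locales simp

sublocale prod: product_prob_space "\<lambda>_ :: nat \<times> nat. \<mu>"
  by (intro product_prob_spaceI H.prob_space_axioms)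

sublocale PP: prob_space P
  unfolding P_eq by (rule prob_space_PiM) (rule H.prob_space_axioms)

sublocale blocks: block_partition n N h "block_qubits n \<xi> l" for l
  by (rule block_partition_block_qubits[OF \<xi>_pos n_eq])

lemma space_component: "\<omega> \<in> space P \<Longrightarrow> i \<in> Ind \<Longrightarrow> \<omega> i \<in> space \<mu>"
  by (auto simp: P_eq space_PiM PiE_iff)

abbreviation sub :: "nat \<Rightarrow> nat \<Rightarrow> nat \<Rightarrow> nat" where
  "sub l b x \<equiv> subindex (block_qubits n \<xi> l b) x"

text \<open>The product form of a layer entry, available because the blocks of a layer are disjoint
  and cover all qubits.\<close>

definition amp :: "(nat \<times> nat \<Rightarrow> real mat) \<Rightarrow> nat \<Rightarrow> nat \<Rightarrow> nat \<Rightarrow> complex" where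
  "amp \<omega> l x y = (\<Prod>b<h. H.M (\<omega> (l, b)) $$ (sub l b x, sub l b y))"

lemma layer_eq_amp:
  "x < 2 ^ n \<Longrightarrow> y < 2 ^ n \<Longrightarrow> superblock_layer n \<xi> \<omega> l $$ (x, y) = amp \<omega> l x y"
  unfolding superblock_layer_def h_eq amp_def by (rule blocks.layer_entry)

lemma layer_carrier: "superblock_layer n \<xi> \<omega> l \<in> ops n"
  unfolding superblock_layer_def by (rule foldr_mult_smult[THEN conjunct2]) auto

lemma circuit_entry:
  "superblock_circuit n \<xi> \<omega> $$ (0, 0) = (\<Sum>y<2 ^ n. amp \<omega> 1 0 y * amp \<omega> 0 y 0)"
proof -
  have "superblock_circuit n \<xi> \<omega> $$ (0, 0) =
      (\<Sum>y<2 ^ n. superblock_layer n \<xi> \<omega> 1 $$ (0, y) * superblock_layer n \<xi> \<omega> 0 $$ (y, 0))"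
    unfolding superblock_circuit_def by (rule mult_entry[OF layer_carrier layer_carrier]) auto
  then show ?thesis by (simp add: layer_eq_amp)
qed

lemma amp_norm_square:
  "(cmod (amp \<omega> l x y))\<^sup>2 = (\<Prod>b<h. (cmod (H.M (\<omega> (l, b)) $$ (sub l b x, sub l b y)))\<^sup>2)"
  by (simp add: amp_def prod_norm[symmetric] prod_power_distrib)

text \<open>
  This qubit is the first one of the right half of block \<open>b\<close> of the first layer, and the first one of
  block \<open>b\<close> of the second layer.
\<close>

definition mark :: "nat \<Rightarrow> nat" where "mark b = (2 * b + 1) * \<xi>"

lemma mark_less: "b < h \<Longrightarrow> mark b < n"
proof -
  assume "b < h"
  then have "2 * b + 1 < 2 * h" by simp
  then have "mark b < 2 * h * \<xi>" unfolding mark_def using \<xi>_pos by (intro mult_strict_right_mono) auto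
  then show ?thesis by (simp add: n_eq mult_ac)
qed

lemma inj_mark: "inj mark"
  using \<xi>_pos by (intro injI) (simp add: mark_def)

lemma mark_nth:
  assumes "b < h"
  shows "block_qubits n \<xi> 0 b ! \<xi> = mark b" "block_qubits n \<xi> 1 b ! 0 = mark b"
  using mark_less[OF assms] \<xi>_pos by (simp_all add: block_qubits_def mark_def algebra_simps)

text \<open>\<open>mark b\<close> sits at position \<open>\<xi>\<close> of its first-layer block and
  at position \<open>0\<close> of its second-layer block, and blocks of one layer are disjoint. A
  character on marked qubits therefore restricts to at most a single \<open>Z\<close> on each
  block.\<close>

lemma marks_in_block:
  assumes B: "B \<subseteq> {..<h}" and b: "b < h" and l: "(l = 0 \<and> k0 = \<xi>) \<or> (l = 1 \<and> k0 = 0)"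
  shows "{k. k < N \<and> block_qubits n \<xi> l b ! k \<in> mark ` B} = (if b \<in> B then {k0} else {})"
proof -
  have k0: "k0 < N" and nth: "\<And>b. b < h \<Longrightarrow> block_qubits n \<xi> l b ! k0 = mark b"
    using l mark_nth \<xi>_pos by auto
  have inj: "inj_on (\<lambda>(b, k). block_qubits n \<xi> l b ! k) ({..<h} \<times> {..<N})"
    using blocks.bij_qs[of l] by (simp add: bij_betw_def)
  have "k = k0 \<and> b \<in> B" if k: "k < N" "block_qubits n \<xi> l b ! k \<in> mark ` B" for k
  proof -
    obtain b' where b': "b' \<in> B" "block_qubits n \<xi> l b ! k = mark b'" using k(2) by blast
    then have "b' < h" using B by auto
    then have "(\<lambda>(b, k). block_qubits n \<xi> l b ! k) (b, k) = (\<lambda>(b, k). block_qubits n \<xi> l b ! k) (b', k0)"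
      using nth b' by simp
    then have "(b, k) = (b', k0)"
      by (rule inj_onD[OF inj]) (use b k \<open>b' < h\<close> k0 in auto)
    then show ?thesis using b' by simp
  qed
  then have "k < N \<and> block_qubits n \<xi> l b ! k \<in> mark ` B \<longleftrightarrow> k = k0 \<and> b \<in> B" for k
    using k0 nth[OF b] by blast
  then show ?thesis by auto
qed

text \<open>Character and amplitudes both factorize over blocks. A block without a mark sums to one,
  because rows and columns of its unitary are normalized.\<close>

lemma sum_chi_amp:
  assumes B: "B \<subseteq> {..<h}" and \<omega>: "\<omega> \<in> space P"
  shows "(\<Sum>y<2 ^ n. chi (mark ` B) y * (cmod (amp \<omega> 1 0 y))\<^sup>2) =
      (\<Prod>b<h. if b \<in> B then row_z N 0 (H.M (\<omega> (1, b))) else 1)"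
    and "(\<Sum>y<2 ^ n. chi (mark ` B) y * (cmod (amp \<omega> 0 y 0))\<^sup>2) =
      (\<Prod>b<h. if b \<in> B then col_z N \<xi> (H.M (\<omega> (0, b))) else 1)"
proof -
  let ?C = "\<lambda>l b. {k. k < N \<and> block_qubits n \<xi> l b ! k \<in> mark ` B}"
  have sub: "mark ` B \<subseteq> {..<n}" using B mark_less by auto
  have U: "H.M (\<omega> (l, b)) \<in> ops N" "H.M (\<omega> (l, b)) * adj (H.M (\<omega> (l, b))) = 1\<^sub>m (2 ^ N)"
    if "b < h" "l \<in> {0, 1}" for l b
    using that space_component[OF \<omega>, of "(l, b)"] H.M_carrier H.M_unitary by auto
  have "(\<Sum>y<2 ^ n. chi (mark ` B) y * (cmod (amp \<omega> 1 0 y))\<^sup>2) =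
      (\<Sum>y<2 ^ n. \<Prod>b<h. chi (?C 1 b) (sub 1 b y) * (cmod (H.M (\<omega> (1, b)) $$ (0, sub 1 b y)))\<^sup>2)"
    unfolding blocks.chi_factor[OF sub, where l = 1] amp_norm_square prod.distrib[symmetric] by simp
  also have "\<dots> = (\<Prod>b<h. \<Sum>s<2 ^ N. chi (?C 1 b) s * (cmod (H.M (\<omega> (1, b)) $$ (0, s)))\<^sup>2)"
    by (rule blocks.sum_factor)
  also have "\<dots> = (\<Prod>b<h. if b \<in> B then row_z N 0 (H.M (\<omega> (1, b))) else 1)"
    using marks_in_block[OF B, of _ 1 0] unitary_row[OF U, of _ 1 0]
    by (intro prod.cong) (simp_all add: row_z_def)
  finally show "(\<Sum>y<2 ^ n. chi (mark ` B) y * (cmod (amp \<omega> 1 0 y))\<^sup>2) = \<dots>" .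
  have "(\<Sum>y<2 ^ n. chi (mark ` B) y * (cmod (amp \<omega> 0 y 0))\<^sup>2) =
      (\<Sum>y<2 ^ n. \<Prod>b<h. chi (?C 0 b) (sub 0 b y) * (cmod (H.M (\<omega> (0, b)) $$ (sub 0 b y, 0)))\<^sup>2)"
    unfolding blocks.chi_factor[OF sub, where l = 0] amp_norm_square prod.distrib[symmetric] by simp
  also have "\<dots> = (\<Prod>b<h. \<Sum>s<2 ^ N. chi (?C 0 b) s * (cmod (H.M (\<omega> (0, b)) $$ (s, 0)))\<^sup>2)"
    by (rule blocks.sum_factor)
  also have "\<dots> = (\<Prod>b<h. if b \<in> B then col_z N \<xi> (H.M (\<omega> (0, b))) else 1)"
    using marks_in_block[OF B, of _ 0 \<xi>] unitary_col[OF U, of _ 0 0]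
    by (intro prod.cong) (simp_all add: col_z_def)
  finally show "(\<Sum>y<2 ^ n. chi (mark ` B) y * (cmod (amp \<omega> 0 y 0))\<^sup>2) = \<dots>" .
qed

text \<open>Pairing with a conjugate amplitude cancels the arbitrary phase of each block
  separately.\<close>

lemma measurable_amp_product:
  assumes "x < 2 ^ n" "y < 2 ^ n" "x' < 2 ^ n" "y' < 2 ^ n" "l \<in> {0, 1}"
  shows "(\<lambda>\<omega>. amp \<omega> l x y * cnj (amp \<omega> l x' y')) \<in> borel_measurable P"
proof -
  have "(\<lambda>\<omega>. \<Prod>b<h. H.M (\<omega> (l, b)) $$ (sub l b x, sub l b y) *
      cnj (H.M (\<omega> (l, b)) $$ (sub l b x', sub l b y'))) \<in> borel_measurable P"
  proof (rule borel_measurable_prod)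
    fix b assume "b \<in> {..<h}"
    then have b: "b < h" by simp
    have "(\<lambda>\<omega>. \<omega> (l, b)) \<in> P \<rightarrow>\<^sub>M \<mu>"
      unfolding P_eq by (rule measurable_component_singleton) (use b assms in auto)
    moreover have "(\<lambda>R. H.M R $$ (sub l b x, sub l b y) *
        cnj (H.M R $$ (sub l b x', sub l b y'))) \<in> borel_measurable \<mu>"
      by (rule H.measurable_amplitude) (rule blocks.sub_less[OF b])+
    ultimately show "(\<lambda>\<omega>. H.M (\<omega> (l, b)) $$ (sub l b x, sub l b y) *
      cnj (H.M (\<omega> (l, b)) $$ (sub l b x', sub l b y'))) \<in> borel_measurable P"
      by (rule measurable_compose)
  qed
  then show ?thesis by (simp add: amp_def prod.distrib)
qed

definition prob4 :: "(nat \<times> nat \<Rightarrow> real mat) \<Rightarrow> real" where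
  "prob4 \<omega> = cmod (superblock_circuit n \<xi> \<omega> $$ (0, 0)) ^ 4"

lemma measurable_prob4: "prob4 \<in> borel_measurable P"
proof -
  let ?z = "\<lambda>\<omega>. superblock_circuit n \<xi> \<omega> $$ (0, 0)"
  have "?z \<omega> * cnj (?z \<omega>) = (\<Sum>y<2 ^ n. \<Sum>y'<2 ^ n. (amp \<omega> 1 0 y * cnj (amp \<omega> 1 0 y')) *
      (amp \<omega> 0 y 0 * cnj (amp \<omega> 0 y' 0)))" for \<omega>
    unfolding circuit_entry by (simp add: sum_product mult_ac)
  moreover have "(\<lambda>\<omega>. \<Sum>y<2 ^ n. \<Sum>y'<2 ^ n. (amp \<omega> 1 0 y * cnj (amp \<omega> 1 0 y')) *
      (amp \<omega> 0 y 0 * cnj (amp \<omega> 0 y' 0))) \<in> borel_measurable P"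
    by (intro borel_measurable_sum borel_measurable_times measurable_amp_product) auto
  ultimately have "(\<lambda>\<omega>. ?z \<omega> * cnj (?z \<omega>)) \<in> borel_measurable P" by simp
  then have "(\<lambda>\<omega>. (norm (?z \<omega> * cnj (?z \<omega>)))\<^sup>2) \<in> borel_measurable P"
    by (intro borel_measurable_power measurable_compose[OF _ borel_measurable_norm])
  moreover have "(norm (?z \<omega> * cnj (?z \<omega>)))\<^sup>2 = prob4 \<omega>" for \<omega>
    by (simp add: prob4_def norm_mult power2_eq_square power4_eq_xxxx mult.assoc)
  ultimately show ?thesis by (simp add: fun_eq_iff[symmetric] cong: measurable_cong_simp)
qed

text \<open>The circuit amplitude is an inner product of two normalized vectors.\<close>

lemma prob4_le_1:
  assumes \<omega>: "\<omega> \<in> space P"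
  shows "prob4 \<omega> \<le> 1"
proof -
  have 1: "(\<Sum>y<2 ^ n. (cmod (amp \<omega> 1 0 y))\<^sup>2) = 1" "(\<Sum>y<2 ^ n. (cmod (amp \<omega> 0 y 0))\<^sup>2) = 1"
    using sum_chi_amp[of "{}", OF _ \<omega>] by simp_all
  have "cmod (\<Sum>y<2 ^ n. amp \<omega> 1 0 y * amp \<omega> 0 y 0) \<le>
      (\<Sum>y<2 ^ n. ((cmod (amp \<omega> 1 0 y))\<^sup>2 + (cmod (amp \<omega> 0 y 0))\<^sup>2) / 2)"
  proof (rule sum_norm_le)
    fix y
    show "norm (amp \<omega> 1 0 y * amp \<omega> 0 y 0) \<le> ((cmod (amp \<omega> 1 0 y))\<^sup>2 + (cmod (amp \<omega> 0 y 0))\<^sup>2) / 2"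
      using sum_squares_bound[of "cmod (amp \<omega> 1 0 y)" "cmod (amp \<omega> 0 y 0)"] by (simp add: norm_mult)
  qed
  also have "\<dots> = 1" using 1 by (simp add: sum.distrib flip: sum_divide_distrib)
  finally show ?thesis by (simp add: prob4_def circuit_entry power_le_one)
qed

lemma integrable_prob4: "integrable P prob4"
  by (rule PP.integrable_const_bound[where B = 1])
    (use prob4_le_1 measurable_prob4 in \<open>auto simp: prob4_def intro: AE_I2\<close>)

text \<open>The twist inserts a Pauli string between the layers. It splits over the second-layer
  blocks, and each block absorbs its part by left multiplication of its parameter with a sign
  matrix. This map of the parameters preserves the product measure, and the block phases combine to
  the modulus-one factor \<open>\<Theta>\<close>.\<close>

lemma twisted_invariance:
  assumes a: "a < 2 ^ n" and C: "C \<subseteq> {..<n}"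
  defines "g \<equiv> \<lambda>\<omega>. cmod (\<Sum>y<2 ^ n. amp \<omega> 1 0 (y XOR a) * complex_of_real (chi C y) * amp \<omega> 0 y 0) ^ 4"
  shows "integrable P g" "(\<integral>\<omega>. g \<omega> \<partial>P) = (\<integral>\<omega>. prob4 \<omega> \<partial>P)"
proof -
  let ?Cb = "\<lambda>b. {k. k < N \<and> block_qubits n \<xi> 1 b ! k \<in> C}"
  let ?a = "\<lambda>b. sub 1 b a"
  let ?good = "\<lambda>b D. D \<in> orth_group (2 * N) \<and> (\<forall>R\<in>orth_group (2 * N). \<exists>\<theta>. cmod \<theta> = 1 \<and>
      H.M (D * R) = \<theta> \<cdot>\<^sub>m (H.M R * pauli N (?a b) (?Cb b)))"
  have "\<exists>D. ?good b D" if "b < h" for b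
    unfolding Bex_def[symmetric] by (rule matchgate_unitary_pauli[OF blocks.sub_less[OF that]]) simp
  then have "\<forall>b. \<exists>D. b < h \<longrightarrow> ?good b D" by blast
  from choice[OF this] obtain D where D': "\<forall>b. b < h \<longrightarrow> ?good b (D b)" by blast
  then have D: "\<And>b. b < h \<Longrightarrow> D b \<in> orth_group (2 * N)"
    "\<And>b R. b < h \<Longrightarrow> R \<in> orth_group (2 * N) \<Longrightarrow> \<exists>\<theta>. cmod \<theta> = 1 \<and>
      H.M (D b * R) = \<theta> \<cdot>\<^sub>m (H.M R * pauli N (?a b) (?Cb b))"
    by blast+
  define f where "f i R = (if fst i = (1 :: nat) then D (snd i) * R else R)" for i and R :: "real mat"
  define T where "T \<omega> = (\<lambda>i\<in>Ind. f i (\<omega> i))" for \<omega> :: "nat \<times> nat \<Rightarrow> real mat"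
  have f: "f i \<in> \<mu> \<rightarrow>\<^sub>M \<mu>" "distr \<mu> \<mu> (f i) = \<mu>" if i: "i \<in> Ind" for i
  proof -
    have "f i \<in> \<mu> \<rightarrow>\<^sub>M \<mu> \<and> distr \<mu> \<mu> (f i) = \<mu>"
    proof (cases "fst i = 1")
      case True
      then have Di: "D (snd i) \<in> orth_group (2 * N)" using i D(1) by auto
      have "f i = (\<lambda>R. D (snd i) * R)" using True by (simp add: f_def fun_eq_iff)
      then show ?thesis
        using H.measurable_left_mult[OF Di] H.haar Di by (simp add: is_normalized_haar_def)
    next
      case False
      then have "f i = (\<lambda>R. R)" by (simp add: f_def fun_eq_iff)
      then show ?thesis by (simp add: distr_id2)
    qed
    then show "f i \<in> \<mu> \<rightarrow>\<^sub>M \<mu>" "distr \<mu> \<mu> (f i) = \<mu>" by auto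
  qed
  have T: "T \<in> P \<rightarrow>\<^sub>M P" "distr P P T = P"
    using distr_PiM_coordinatewise[of Ind "\<lambda>_. \<mu>" f] f H.prob_space_axioms
    unfolding P_eq T_def[abs_def] by auto
  have gT: "prob4 (T \<omega>) = g \<omega>" if \<omega>: "\<omega> \<in> space P" for \<omega>
  proof -
    let ?U = "\<lambda>b. H.M (\<omega> (1, b))"
    have T0: "amp (T \<omega>) 0 y 0 = amp \<omega> 0 y 0" for y
      unfolding amp_def by (intro prod.cong refl) (simp add: T_def f_def)
    have "\<exists>\<theta>. cmod \<theta> = 1 \<and> H.M (T \<omega> (1, b)) =
        \<theta> \<cdot>\<^sub>m (?U b * pauli N (?a b) (?Cb b))" if "b < h" for b
    proof -
      have "\<omega> (1, b) \<in> orth_group (2 * N)"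
        using space_component[OF \<omega>, of "(1, b)"] that by (simp add: H.space_haar)
      moreover have "T \<omega> (1, b) = D b * \<omega> (1, b)" using that by (simp add: T_def f_def)
      ultimately show ?thesis using D(2)[OF that] by simp
    qed
    then have "\<forall>b. \<exists>\<theta>. b < h \<longrightarrow> cmod \<theta> = 1 \<and> H.M (T \<omega> (1, b)) =
        \<theta> \<cdot>\<^sub>m (?U b * pauli N (?a b) (?Cb b))" by blast
    from choice[OF this] obtain \<theta> where \<theta>: "\<And>b. b < h \<Longrightarrow> cmod (\<theta> b) = 1"
      "\<And>b. b < h \<Longrightarrow> H.M (T \<omega> (1, b)) = \<theta> b \<cdot>\<^sub>m (?U b * pauli N (?a b) (?Cb b))"
      by blast
    define \<Theta> where "\<Theta> = (\<Prod>b<h. \<theta> b)"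
    have \<Theta>: "cmod \<Theta> = 1" using \<theta>(1) by (simp add: \<Theta>_def prod_norm[symmetric])
    have T1: "amp (T \<omega>) 1 0 y = \<Theta> * (amp \<omega> 1 0 (y XOR a) * complex_of_real (chi C y))" for y
    proof -
      have "H.M (T \<omega> (1, b)) $$ (0, sub 1 b y) =
          \<theta> b * (?U b $$ (0, sub 1 b (y XOR a)) * complex_of_real (chi (?Cb b) (sub 1 b y)))"
        if b: "b < h" for b
      proof -
        have U: "?U b \<in> ops N"
          using H.M_carrier space_component[OF \<omega>, of "(1, b)"] b by simp
        show ?thesis
          unfolding \<theta>(2)[OF b] subindex_xor
          using smult_entry[OF mult_carrier_sq[OF U pauli_carrier], of 0 "sub 1 b y"]
            mult_pauli_entry[OF U blocks.sub_less[OF b], of 0 "sub 1 b y"] blocks.sub_less[OF b]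
          by simp
      qed
      then show ?thesis
        unfolding amp_def \<Theta>_def blocks.chi_factor[OF C, where l = 1] of_real_prod prod.distrib[symmetric]
        by (intro prod.cong) simp_all
    qed
    have "(\<Sum>y<2 ^ n. amp (T \<omega>) 1 0 y * amp (T \<omega>) 0 y 0) =
        \<Theta> * (\<Sum>y<2 ^ n. amp \<omega> 1 0 (y XOR a) * complex_of_real (chi C y) * amp \<omega> 0 y 0)"
      by (simp add: T0 T1 sum_distrib_left mult_ac)
    then show ?thesis by (simp add: prob4_def circuit_entry g_def norm_mult \<Theta>)
  qed
  have "integrable (distr P P T) prob4" using T(2) integrable_prob4 by simp
  then have "integrable P (\<lambda>\<omega>. prob4 (T \<omega>))"
    by (rule integrable_distr[OF T(1)])
  then show "integrable P g"
    by (subst Bochner_Integration.integrable_cong[OF refl gT[symmetric]]) auto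
  have "(\<integral>\<omega>. prob4 \<omega> \<partial>P) = (\<integral>\<omega>. prob4 \<omega> \<partial>distr P P T)" by (simp add: T(2))
  also have "\<dots> = (\<integral>\<omega>. prob4 (T \<omega>) \<partial>P)" by (rule integral_distr[OF T(1) measurable_prob4])
  also have "\<dots> = (\<integral>\<omega>. g \<omega> \<partial>P)" by (rule Bochner_Integration.integral_cong[OF refl gT])
  finally show "(\<integral>\<omega>. g \<omega> \<partial>P) = (\<integral>\<omega>. prob4 \<omega> \<partial>P)" by simp
qed

text \<open>Arranges the squared Fourier coefficients as a product of functions of one block
  parameter each, so that independence applies.\<close>

definition zfac :: "nat set \<Rightarrow> nat \<times> nat \<Rightarrow> real mat \<Rightarrow> real" where
  "zfac B i R = (if snd i \<in> B then
     (if fst i = 1 then (row_z N 0 (H.M R))\<^sup>2 else (col_z N \<xi> (H.M R))\<^sup>2) else 1)"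

lemma prod_Ind:
  fixes F :: "nat \<times> nat \<Rightarrow> 'a :: comm_monoid_mult"
  shows "(\<Prod>i\<in>Ind. F i) = (\<Prod>b<h. F (1, b)) * (\<Prod>b<h. F (0, b))"
proof -
  have "(\<Prod>i\<in>Ind. F i) = (\<Prod>l\<in>{0, 1}. \<Prod>b<h. F (l, b))"
    by (simp only: prod.cartesian_product case_prod_eta)
  then show ?thesis by (simp add: mult.commute)
qed

lemma integral_zfac_ge:
  assumes B: "B \<subseteq> {..<h}"
  shows "integrable P (\<lambda>\<omega>. \<Prod>i\<in>Ind. zfac B i (\<omega> i))"
    "(\<integral>\<omega>. (\<Prod>i\<in>Ind. zfac B i (\<omega> i)) \<partial>P) \<ge> ((1 / (2 * real N - 1))\<^sup>2) ^ card B"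
proof -
  have int: "integrable \<mu> (zfac B i)" for i
    by (cases "snd i \<in> B"; cases "fst i = 1")
      (simp_all add: zfac_def[abs_def] H.integrable_row_z H.integrable_col_z)
  show "integrable P (\<lambda>\<omega>. \<Prod>i\<in>Ind. zfac B i (\<omega> i))"
    unfolding P_eq by (rule prod.product_integrable_prod) (use int in auto)
  let ?k = "1 / (2 * real N - 1)"
  have pos: "?k \<ge> 0" using \<xi>_pos by simp
  have ge: "(\<integral>R. zfac B i R \<partial>\<mu>) \<ge> (if snd i \<in> B then ?k else 1)" for i
    using H.row_z_second_moment_ge[of 0] H.col_z_second_moment_ge[of \<xi>] \<xi>_pos
    by (cases "snd i \<in> B"; cases "fst i = 1") (simp_all add: zfac_def[abs_def] H.prob_space)
  have "{..<h} \<inter> {b. b \<in> B} = B" using B by auto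
  then have "k ^ card B * k ^ card B = (\<Prod>i\<in>Ind. if snd i \<in> B then k else 1)" for k :: real
    unfolding prod_Ind by (simp add: prod.If_cases)
  from this[of ?k] have "(?k\<^sup>2) ^ card B = (\<Prod>i\<in>Ind. if snd i \<in> B then ?k else 1)"
    by (simp only: power2_eq_square power_mult_distrib)
  also have "\<dots> \<le> (\<Prod>i\<in>Ind. \<integral>R. zfac B i R \<partial>\<mu>)"
    by (rule prod_mono) (use pos ge in auto)
  also have "\<dots> = (\<integral>\<omega>. (\<Prod>i\<in>Ind. zfac B i (\<omega> i)) \<partial>P)"
    unfolding P_eq by (rule prod.product_integral_prod[symmetric]) (use int in auto)
  finally show "(\<integral>\<omega>. (\<Prod>i\<in>Ind. zfac B i (\<omega> i)) \<partial>P) \<ge> (?k\<^sup>2) ^ card B" .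
qed

lemma fourth_moment_ge:
  "4 ^ n * (\<integral>\<omega>. prob4 \<omega> \<partial>P) \<ge> (1 + (1 / (4 * real \<xi> - 1))\<^sup>2) ^ h"
proof -
  let ?g = "\<lambda>a C \<omega>. cmod (\<Sum>y<2 ^ n. amp \<omega> 1 0 (y XOR a) * complex_of_real (chi C y) * amp \<omega> 0 y 0) ^ 4"
  let ?PB = "Pow {..<h}"
  let ?k = "1 / (4 * real \<xi> - 1)"
  have inj: "inj_on (\<lambda>B. mark ` B) ?PB"
    by (rule inj_onI) (simp add: inj_image_eq_iff[OF inj_mark])
  have lower: "(\<Sum>B\<in>?PB. \<Prod>i\<in>Ind. zfac B i (\<omega> i)) \<le> (\<Sum>a<2 ^ n. \<Sum>C\<in>Pow {..<n}. ?g a C \<omega>)"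
    if \<omega>: "\<omega> \<in> space P" for \<omega>
  proof -
    have "(\<Prod>i\<in>Ind. zfac B i (\<omega> i)) =
        (\<Sum>y<2 ^ n. chi (mark ` B) y * (cmod (amp \<omega> 1 0 y))\<^sup>2)\<^sup>2 *
        (\<Sum>y<2 ^ n. chi (mark ` B) y * (cmod (amp \<omega> 0 y 0))\<^sup>2)\<^sup>2" if "B \<in> ?PB" for B
    proof -
      have B: "B \<subseteq> {..<h}" using that by simp
      show ?thesis
        unfolding prod_Ind sum_chi_amp[OF B \<omega>] prod_power_distrib
        by (intro arg_cong2[of _ _ _ _ "(*)"] prod.cong) (auto simp: zfac_def)
    qed
    then have "(\<Sum>B\<in>?PB. \<Prod>i\<in>Ind. zfac B i (\<omega> i)) = (\<Sum>Q\<in>(\<lambda>B. mark ` B) ` ?PB.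
        (\<Sum>y<2 ^ n. chi Q y * (cmod (amp \<omega> 1 0 y))\<^sup>2)\<^sup>2 *
        (\<Sum>y<2 ^ n. chi Q y * (cmod (amp \<omega> 0 y 0))\<^sup>2)\<^sup>2)"
      by (simp add: sum.reindex[OF inj])
    also have "\<dots> \<le> (\<Sum>a<2 ^ n. \<Sum>C\<in>Pow {..<n}. ?g a C \<omega>)"
      by (rule pauli_average_ge) (use mark_less in auto)
    finally show ?thesis .
  qed
  \<comment> \<open>Expanding the power gives one term for each set \<open>B\<close> of blocks whose
    marked qubits carry a \<open>Z\<close>.\<close>
  have "(1 + ?k\<^sup>2) ^ h = (\<Prod>b<h. ?k\<^sup>2 + 1)" by (simp add: add.commute)
  also have "\<dots> = (\<Sum>B\<in>?PB. (?k\<^sup>2) ^ card B)"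
    by (subst prod_add) auto
  also have "\<dots> \<le> (\<Sum>B\<in>?PB. \<integral>\<omega>. (\<Prod>i\<in>Ind. zfac B i (\<omega> i)) \<partial>P)"
    using integral_zfac_ge(2) by (intro sum_mono) auto
  also have "\<dots> = (\<integral>\<omega>. (\<Sum>B\<in>?PB. \<Prod>i\<in>Ind. zfac B i (\<omega> i)) \<partial>P)"
    by (rule Bochner_Integration.integral_sum[symmetric]) (use integral_zfac_ge(1) in auto)
  also have "\<dots> \<le> (\<integral>\<omega>. (\<Sum>a<2 ^ n. \<Sum>C\<in>Pow {..<n}. ?g a C \<omega>) \<partial>P)"
  proof (rule integral_mono)
    show "integrable P (\<lambda>\<omega>. \<Sum>B\<in>?PB. \<Prod>i\<in>Ind. zfac B i (\<omega> i))"
      by (rule Bochner_Integration.integrable_sum) (use integral_zfac_ge(1) in auto)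
    show "integrable P (\<lambda>\<omega>. \<Sum>a<2 ^ n. \<Sum>C\<in>Pow {..<n}. ?g a C \<omega>)"
      by (intro Bochner_Integration.integrable_sum twisted_invariance(1)) auto
  qed (rule lower)
  also have "\<dots> = (\<Sum>a<2 ^ n. \<integral>\<omega>. (\<Sum>C\<in>Pow {..<n}. ?g a C \<omega>) \<partial>P)"
    by (intro Bochner_Integration.integral_sum Bochner_Integration.integrable_sum twisted_invariance(1)) auto
  also have "\<dots> = (\<Sum>a<2 ^ n. \<Sum>C\<in>Pow {..<n}. \<integral>\<omega>. ?g a C \<omega> \<partial>P)"
    by (intro sum.cong refl Bochner_Integration.integral_sum twisted_invariance(1)) auto
  \<comment> \<open>All twisted moments have the same mean; the \<open>2 ^ n\<close> masks
    \<open>a\<close> and the \<open>2 ^ n\<close> sets \<open>C\<close> make up the factor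
    \<open>4 ^ n\<close>.\<close>
  also have "\<dots> = (\<Sum>a<(2::nat) ^ n. \<Sum>C\<in>Pow {..<n}. \<integral>\<omega>. prob4 \<omega> \<partial>P)"
    by (intro sum.cong refl twisted_invariance(2)) auto
  also have "\<dots> = 4 ^ n * (\<integral>\<omega>. prob4 \<omega> \<partial>P)"
    by (simp add: card_Pow flip: power_mult_distrib mult.assoc)
  finally show ?thesis .
qed

end

subsection \<open>Lower bound on the block size\<close>

text \<open>From \<open>exp t \<le> 1 + t + t^2\<close> at \<open>t = x / 2\<close>, where the
  square is at most \<open>x / 2\<close>.\<close>

lemma half_le_ln_one_plus:
  fixes x :: real
  assumes "0 \<le> x" "x \<le> 1"
  shows "x / 2 \<le> ln (1 + x)"
proof -
  have "exp (x / 2) \<le> 1 + x / 2 + (x / 2)\<^sup>2"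
    using assms by (intro exp_bound) auto
  also have "\<dots> \<le> 1 + x"
    using assms mult_left_mono[of x 1 x] by (simp add: power2_eq_square)
  finally show ?thesis using assms by (subst ln_ge_iff) auto
qed

lemma block_size_cube_ge:
  fixes haar :: "nat \<Rightarrow> real mat measure"
  assumes haar: "\<And>N. is_normalized_haar N (haar N)"
    and \<xi>: "\<xi> > 0" "\<xi> dvd n" "even (n div \<xi>)"
    and anti: "2 ^ (2 * n) * (\<integral>\<omega>. cmod (superblock_circuit n \<xi> \<omega> $$ (0, 0)) ^ 4
                       \<partial>superblock_ensemble haar n \<xi>)
      \<le> (1 + \<epsilon>) * 2 ^ (2 * n) * (\<integral>R. cmod (matchgate_unitary n R $$ (0, 0)) ^ 4 \<partial>haar (2 * n))"
    and n: "n \<ge> 2" "1 + \<bar>\<epsilon>\<bar> \<le> real n"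
  shows "real n \<le> 192 * real \<xi> ^ 3 * ln (real n)"
proof -
  obtain h where "n div \<xi> = 2 * h" using \<xi>(3) by (auto elim: evenE)
  then have n_eq: "n = h * (2 * \<xi>)" using \<xi>(2) by (metis dvd_div_mult_self mult.assoc mult.commute)
  interpret S: superblock haar n \<xi> h by unfold_locales (use haar \<xi>(1) n_eq in auto)
  interpret G: matchgate_haar n "haar (2 * n)" by unfold_locales (rule haar)
  let ?I = "\<integral>R. cmod (matchgate_unitary n R $$ (0, 0)) ^ 4 \<partial>haar (2 * n)"
  let ?k = "(1 / (4 * real \<xi> - 1))\<^sup>2"
  have four: "(2::real) ^ (2 * n) = 4 ^ n" by (simp add: power_mult)
  have I0: "0 \<le> 4 ^ n * ?I" by simp
  have "(1 + ?k) ^ h \<le> 4 ^ n * (\<integral>\<omega>. S.prob4 \<omega> \<partial>superblock_ensemble haar n \<xi>)"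
    by (rule S.fourth_moment_ge)
  also have "\<dots> \<le> (1 + \<epsilon>) * (4 ^ n * ?I)"
    using anti by (simp add: four S.prob4_def[abs_def] mult.assoc)
  also have "\<dots> \<le> (1 + \<bar>\<epsilon>\<bar>) * (4 ^ n * ?I)"
    using I0 by (intro mult_right_mono) auto
  \<comment> \<open>For large \<open>n\<close> one factor \<open>n\<close> absorbs the constant of
    the hypothesis; the logarithm only sees that the bound is polynomial.\<close>
  also have "\<dots> \<le> real n * (real n + 1)"
    using n G.M_amplitude_fourth_moment_le by (intro mult_mono) auto
  also have "\<dots> \<le> real n * (real n * real n)"
  proof -
    have "real n + 1 \<le> 2 * real n" using n by simp
    also have "\<dots> \<le> real n * real n" using n by (intro mult_right_mono) auto
    finally show ?thesis by (intro mult_left_mono) auto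
  qed
  finally have le: "(1 + ?k) ^ h \<le> real n ^ 3" by (simp add: power3_eq_cube mult.assoc)
  have x1: "real \<xi> \<ge> 1" using \<xi>(1) by simp
  have k: "1 / (16 * (real \<xi>)\<^sup>2) \<le> ?k" "?k \<le> 1"
  proof -
    have "(4 * real \<xi> - 1)\<^sup>2 \<le> (4 * real \<xi>)\<^sup>2" using x1 by (intro power_mono) auto
    then show "1 / (16 * (real \<xi>)\<^sup>2) \<le> ?k"
      using x1 by (simp add: power_divide power_mult_distrib frac_le)
    have "1 / (4 * real \<xi> - 1) \<le> 1" using x1 by simp
    then show "?k \<le> 1" using x1 by (intro power_le_one) auto
  qed
  have "?k / 2 \<le> ln (1 + ?k)"
    by (rule half_le_ln_one_plus[OF _ k(2)]) simp
  then have "real h * (?k / 2) \<le> real h * ln (1 + ?k)" by (intro mult_left_mono) auto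
  also have "\<dots> = ln ((1 + ?k) ^ h)" by (rule ln_realpow[symmetric])
  also have "\<dots> \<le> ln (real n ^ 3)" using le by (intro ln_mono) (auto simp: add_pos_nonneg n)
  also have "\<dots> = 3 * ln (real n)" using n by (simp add: ln_realpow)
  finally have "real h * (?k / 2) \<le> 3 * ln (real n)" .
  moreover have "real h * (1 / (16 * (real \<xi>)\<^sup>2) / 2) \<le> real h * (?k / 2)"
    using k by (intro mult_left_mono divide_right_mono) auto
  ultimately have "real h * (1 / (16 * (real \<xi>)\<^sup>2) / 2) \<le> 3 * ln (real n)" by linarith
  \<comment> \<open>The constant is 3 from the cube of \<open>n\<close>, times 16 from
    \<open>(4 \<xi>)^2\<close>, times 2 from the estimate of the logarithm;
    \<open>n = 2 \<xi> h\<close> then doubles it to 192.\<close>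
  then have "real h \<le> 96 * (real \<xi>)\<^sup>2 * ln (real n)"
    using x1 by (simp add: field_simps)
  then have "real h * (2 * real \<xi>) \<le> (96 * (real \<xi>)\<^sup>2 * ln (real n)) * (2 * real \<xi>)"
    using x1 by (intro mult_right_mono) auto
  then show ?thesis using n_eq by (simp add: power2_eq_square power3_eq_cube mult_ac)
qed

text \<open>The set \<open>S\<close> holds the system sizes that admit the construction with block
  parameter \<open>\<xi> n\<close>, and the asymptotics run along \<open>S\<close>; a single
  \<open>\<epsilon>\<close> serves all of them.\<close>

theorem theoremS28:
  fixes haar :: "nat \<Rightarrow> real mat measure"
    and S :: "nat set" and \<xi> :: "nat \<Rightarrow> nat" and \<epsilon> :: real
  assumes haar: "\<And>N. is_normalized_haar N (haar N)"
    and patches: "\<And>n. n \<in> S \<Longrightarrow> \<xi> n > 0 \<and> \<xi> n dvd n \<and> even (n div \<xi> n)"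
    and anticoncentration: "\<And>n. n \<in> S \<Longrightarrow>
      2 ^ (2 * n) * (\<integral>\<omega>. cmod (superblock_circuit n (\<xi> n) \<omega> $$ (0, 0)) ^ 4
                       \<partial>superblock_ensemble haar n (\<xi> n))
      \<le> (1 + \<epsilon>) * 2 ^ (2 * n) * (\<integral>R. cmod (matchgate_unitary n R $$ (0, 0)) ^ 4 \<partial>haar (2 * n))"
  shows "(\<lambda>n. real (\<xi> n)) \<in> \<Omega>[inf at_top (principal S)](\<lambda>n. real n powr (1 / 3) / ln (real n))"
\<comment> \<open>The constant comes from 192 being at most 216, the cube of 6; replacing
  \<open>ln n\<close> by its cube lets the cube root be taken exactly.\<close>
proof (rule landau_omega.bigI[where c = "1 / 6"])
  have key: "norm (real (\<xi> n)) \<ge> 1 / 6 * norm (real n powr (1 / 3) / ln (real n))"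
    \<comment> \<open>The threshold 3 exceeds \<open>exp 1\<close> and so gives
      \<open>ln n \<ge> 1\<close>; the other one lets \<open>n\<close> dominate
      \<open>1 + \<bar>\<epsilon>\<bar>\<close>.\<close>
    if n: "n \<ge> max 3 (nat \<lceil>1 + \<bar>\<epsilon>\<bar>\<rceil>)" and S: "n \<in> S" for n
  proof -
    have n3: "n \<ge> 3" and n\<epsilon>: "1 + \<bar>\<epsilon>\<bar> \<le> real n"
      using n by (simp_all add: nat_le_iff ceiling_le_iff)
    have "3 \<le> real n" using n3 by simp
    then have "exp 1 \<le> real n" using exp_le by linarith
    then have ln1: "ln (real n) \<ge> 1" using n3 by (subst ln_ge_iff) auto
    have "real n \<le> 192 * real (\<xi> n) ^ 3 * ln (real n)"
      using patches[OF S] anticoncentration[OF S] n3 n\<epsilon> by (intro block_size_cube_ge[OF haar]) auto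
    also have "\<dots> \<le> (6 * real (\<xi> n) * ln (real n)) ^ 3"
    proof -
      have "ln (real n) * 1 \<le> ln (real n) * (ln (real n))\<^sup>2"
        using ln1 by (intro mult_left_mono) (auto simp: one_le_power)
      then have "ln (real n) \<le> ln (real n) ^ 3" by (simp add: power2_eq_square power3_eq_cube)
      then have "192 * real (\<xi> n) ^ 3 * ln (real n) \<le> 216 * real (\<xi> n) ^ 3 * ln (real n) ^ 3"
        using ln1 by (intro mult_mono) auto
      then show ?thesis by (simp add: power_mult_distrib)
    qed
    finally have "real n powr (1 / 3) \<le> ((6 * real (\<xi> n) * ln (real n)) ^ 3) powr (1 / 3)"
      by (intro powr_mono2) auto
    also have "\<dots> = 6 * real (\<xi> n) * ln (real n)"
    proof -
      have "6 * real (\<xi> n) * ln (real n) > 0" using patches[OF S] ln1 by simp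
      then show ?thesis by (simp add: powr_powr flip: powr_numeral)
    qed
    finally show ?thesis using ln1 by (simp add: field_simps)
  qed
  then show "\<forall>\<^sub>F n in inf at_top (principal S). norm (real (\<xi> n)) \<ge> 1 / 6 * norm (real n powr (1 / 3) / ln (real n))"
    unfolding eventually_inf_principal
    by (intro eventually_mono[OF eventually_ge_at_top[of "max 3 (nat \<lceil>1 + \<bar>\<epsilon>\<bar>\<rceil>)"]]) auto
qed simp

end
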